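(* Let $L,G^1,\ldots,G^r\in C^1([a,b]\times\mathbb{R}^{2N};\mathbb{R})$, $\mathbf{y}^a,\mathbf{y}^b\in\mathbb{R}^N$, $l_1,\ldots,l_r\in\mathbb{R}$, and set $$\mathcal{J}(\mathbf{y})=\int_a^bL[\mathbf{y}]^{\alpha,\beta}_{\gamma}(x)\,dx,\qquad \mathcal{G}^j(\mathbf{y})=\int_a^bG^j[\mathbf{y}]^{\alpha,\beta}_{\gamma}(x)\,dx,\quad j=1,\ldots,r.$$ Let $\mathbf{y}$ be a local minimizer of $\mathcal{J}$ over all functions in $\mathbf{D}$ satisfying the boundary conditions $\mathbf{y}(a)=\mathbf{y}^a$, $\mathbf{y}(b)=\mathbf{y}^b$ and the isoperimetric constraints $\mathcal{G}^j(\mathbf{y})=l_j$, $j=1,\ldots,r$. Assume that $\mathcal{J},\mathcal{G}^1,\ldots,\mathcal{G}^r$ are defined in a neighborhood of $\mathbf{y}$ and have continuous first variations in this neighborhood, and that there are functions $\mathbf{h}^1,\ldots,\mathbf{h}^r\in\mathbf{D}$ such that the $r\times r$ matrix $A=(a_{km})$, $a_{km}=\delta\mathcal{G}^k(\mathbf{y};\mathbf{h}^m)$, has maximal rank $r$. Then there exist constants $\lambda_1,\ldots,\lambda_r\in\mathbb{R}$ such that, with $F:=L-\sum_{j=1}^r\lambda_jG^j$, $\mathbf{y}$ satisfies the system of $N$ fractional Euler--Lagrange equations $$\partial_iF[\mathbf{y}]^{\alpha,\beta}_{\gamma}(x)+D^{\beta_{i-1},\alpha_{i-1}}_{1-\gamma_{i-1}}\,\partial_{N+i}F[\mathbf{y}]^{\alpha,\beta}_{\gamma}(x)=0,\qquad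 i=2,\ldots,N+1,$$ for all $x\in[a,b]$.
   Context: Let $a<b$, $N,r\in\mathbb{N}$, and $\alpha,\beta,\gamma\in\mathbb{R}^N$ with $\alpha_i,\beta_i\in(0,1)$, $\gamma_i\in[0,1]$. For scalar $\alpha\in(0,1)$, the left and right Riemann--Liouville fractional integrals are ${}_aI_x^{\alpha}f(x)=\frac{1}{\Gamma(\alpha)}\int_a^x(x-t)^{\alpha-1}f(t)\,dt$ and ${}_xI_b^{\alpha}f(x)=\frac{1}{\Gamma(\alpha)}\int_x^b(t-x)^{\alpha-1}f(t)\,dt$. The left and right Riemann--Liouville derivatives are ${}_aD_x^{\alpha}f=\frac{d}{dx}\,{}_aI_x^{1-\alpha}f$ and ${}_xD_b^{\alpha}f=-\frac{d}{dx}\,{}_xI_b^{1-\alpha}f$. For $f\in AC([a,b])$ (absolutely continuous), the left and right Caputo derivatives are ${}^C_aD_x^{\alpha}f={}_aI_x^{1-\alpha}f'$ and ${}^C_xD_b^{\alpha}f=-\,{}_xI_b^{1-\alpha}f'$. For scalars $\alpha,\beta\in(0,1)$, $\gamma\in[0,1]$: the combined Caputo derivative is ${}^CD^{\alpha,\beta}_{\gamma}=\gamma\,{}^C_aD_x^{\alpha}+(1-\gamma)\,{}^C_xD_b^{\beta}$, and $D^{\beta,\alpha}_{1-\gamma}=(1-\gamma)\,{}_aD_x^{\beta}+\gamma\,{}_xD_b^{\alpha}$. For vector parameters and $\mathbf{y}=(y_1,\ldots,y_N)$, ${}^CD^{\alpha,\beta}_{\gamma}\mathbf{y}=[{}^CD^{\alpha_1,\beta_1}_{\gamma_1}y_1,\ldots,{}^CD^{\alpha_N,\beta_N}_{\gamma_N}y_N]$.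 $\mathbf{D}$ is the set of $\mathbf{y}:[a,b]\to\mathbb{R}^N$ with components in $AC([a,b])$ such that ${}^CD^{\alpha,\beta}_{\gamma}\mathbf{y}$ exists and is continuous on $[a,b]$, with norm $\|\mathbf{y}\|_{1,\infty}=\max_{[a,b]}\|\mathbf{y}(x)\|+\max_{[a,b]}\|{}^CD^{\alpha,\beta}_{\gamma}\mathbf{y}(x)\|$, where $\|\cdot\|$ is a norm on $\mathbb{R}^N$. $[\mathbf{y}]^{\alpha,\beta}_{\gamma}(x)=(x,\mathbf{y}(x),{}^CD^{\alpha,\beta}_{\gamma}\mathbf{y}(x))$, and $K[\mathbf{y}]^{\alpha,\beta}_{\gamma}(x)$ is $K$ evaluated at this point. $\partial_iK$ is the partial derivative of $K$ with respect to its $i$th argument (for $i=2,\ldots,N+1$, $\partial_iK$ is with respect to the $(i-1)$th component of $\mathbf{y}$ and $\partial_{N+i}K$ with respect to the $(i-1)$th component of the fractional derivative). The first variation of a functional $\mathcal{J}$ at $\mathbf{y}\in\mathbf{D}$ in the direction $\mathbf{h}\in\mathbf{D}$ is $\delta\mathcal{J}(\mathbf{y};\mathbf{h})=\lim_{\varepsilon\to0}\frac{\mathcal{J}(\mathbf{y}+\varepsilon\mathbf{h})-\mathcal{J}(\mathbf{y})}{\varepsilon}$, provided the limit exists. A local minimizer of $\mathcal{J}$ on an admissible set $\mathcal{D}\subset\mathbf{D}$ is $\bar{\mathbf{y}}\in\mathcal{D}$ for which there is $\delta>0$ with $\mathcal{J}(\bar{\mathbf{y}})\le\mathcal{J}(\mathbf{y})$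 for all $\mathbf{y}\in\mathcal{D}$ with $\|\mathbf{y}-\bar{\mathbf{y}}\|_{1,\infty}<\delta$.
   Formalization: The functions h^m are also required to vanish at a and b (false otherwise); the equations hold at each x in [a,b] where the Riemann–Liouville derivatives with nonzero coefficient exist (they may not), and everywhere with the sum of derivatives read as the derivative of the sum. *)

theory Defs
  imports "HOL-Analysis.Analysis"
begin

text \<open>
  Functions on \<open>[a,b]\<close> are represented by total functions on \<open>real\<close>; only their values on
  \<open>[a,b]\<close> matter. The components of a vector in \<open>\<real>\<^sup>N\<close> are indexed by a finite type \<open>'n\<close>.
\<close>

definition AC_on :: "real \<Rightarrow> real \<Rightarrow> (real \<Rightarrow> real) \<Rightarrow> bool" where
  "AC_on a b f \<longleftrightarrow>
     (\<forall>\<epsilon>>0. \<exists>\<delta>>0. \<forall>P::(real \<times> real) set.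
        finite P \<longrightarrow>
        (\<forall>(u, v)\<in>P. a \<le> u \<and> u \<le> v \<and> v \<le> b) \<longrightarrow>
        pairwise (\<lambda>p q. {fst p<..<snd p} \<inter> {fst q<..<snd q} = {}) P \<longrightarrow>
        (\<Sum>(u, v)\<in>P. v - u) < \<delta> \<longrightarrow>
        (\<Sum>(u, v)\<in>P. \<bar>f v - f u\<bar>) < \<epsilon>)"

definition frac_int_left_exists :: "real \<Rightarrow> real \<Rightarrow> (real \<Rightarrow> real) \<Rightarrow> real \<Rightarrow> bool" where
  "frac_int_left_exists a \<mu> f x \<longleftrightarrow>
     set_integrable lebesgue {a..x} (\<lambda>t. (x - t) powr (\<mu> - 1) * f t)"

definition frac_int_right_exists :: "real \<Rightarrow> real \<Rightarrow> (real \<Rightarrow> real) \<Rightarrow> real \<Rightarrow> bool" where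
  "frac_int_right_exists b \<mu> f x \<longleftrightarrow>
     set_integrable lebesgue {x..b} (\<lambda>t. (t - x) powr (\<mu> - 1) * f t)"

definition frac_int_left :: "real \<Rightarrow> real \<Rightarrow> (real \<Rightarrow> real) \<Rightarrow> real \<Rightarrow> real" where
  "frac_int_left a \<mu> f x =
     1 / Gamma \<mu> * (LINT t:{a..x}|lebesgue. (x - t) powr (\<mu> - 1) * f t)"

definition frac_int_right :: "real \<Rightarrow> real \<Rightarrow> (real \<Rightarrow> real) \<Rightarrow> real \<Rightarrow> real" where
  "frac_int_right b \<mu> f x =
     1 / Gamma \<mu> * (LINT t:{x..b}|lebesgue. (t - x) powr (\<mu> - 1) * f t)"

text \<open>The derivatives of the fractional integrals are one-sided at the end points of \<open>[a,b]\<close>.\<close>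

definition RL_left :: "real \<Rightarrow> real \<Rightarrow> real \<Rightarrow> (real \<Rightarrow> real) \<Rightarrow> real \<Rightarrow> real" where
  "RL_left a b \<alpha> f x = vector_derivative (frac_int_left a (1 - \<alpha>) f) (at x within {a..b})"

definition RL_right :: "real \<Rightarrow> real \<Rightarrow> real \<Rightarrow> (real \<Rightarrow> real) \<Rightarrow> real \<Rightarrow> real" where
  "RL_right a b \<alpha> f x = - vector_derivative (frac_int_right b (1 - \<alpha>) f) (at x within {a..b})"

text \<open>
  For absolutely continuous \<open>f\<close>, \<open>deriv f\<close> is the derivative almost everywhere on \<open>[a,b]\<close>; its
  arbitrary values on the remaining null set do not affect the integrals.
\<close>

definition caputo_left :: "real \<Rightarrow> real \<Rightarrow> (real \<Rightarrow> real) \<Rightarrow> real \<Rightarrow> real" where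
  "caputo_left a \<alpha> f x = frac_int_left a (1 - \<alpha>) (deriv f) x"

definition caputo_right :: "real \<Rightarrow> real \<Rightarrow> (real \<Rightarrow> real) \<Rightarrow> real \<Rightarrow> real" where
  "caputo_right b \<alpha> f x = - frac_int_right b (1 - \<alpha>) (deriv f) x"

text \<open>
  In the combined operators a summand with coefficient \<open>0\<close> is regarded as absent, so that it need
  not exist.
\<close>

definition combined_caputo ::
  "real \<Rightarrow> real \<Rightarrow> real \<Rightarrow> real \<Rightarrow> real \<Rightarrow> (real \<Rightarrow> real) \<Rightarrow> real \<Rightarrow> real" where
  "combined_caputo a b \<alpha> \<beta> \<gamma> f x = \<gamma> * caputo_left a \<alpha> f x + (1 - \<gamma>) * caputo_right b \<beta> f x"

definition combined_caputo_exists ::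
  "real \<Rightarrow> real \<Rightarrow> real \<Rightarrow> real \<Rightarrow> real \<Rightarrow> (real \<Rightarrow> real) \<Rightarrow> real \<Rightarrow> bool" where
  "combined_caputo_exists a b \<alpha> \<beta> \<gamma> f x \<longleftrightarrow>
     (\<gamma> \<noteq> 0 \<longrightarrow> frac_int_left_exists a (1 - \<alpha>) (deriv f) x) \<and>
     (1 - \<gamma> \<noteq> 0 \<longrightarrow> frac_int_right_exists b (1 - \<beta>) (deriv f) x)"

text \<open>
  \<open>combined_RL a b \<beta> \<alpha> c\<close> is \<open>c\<close> times the left derivative of order \<open>\<beta>\<close> plus \<open>1 - c\<close> times the right
  derivative of order \<open>\<alpha>\<close>; the operator dual to \<open>combined_caputo a b \<alpha> \<beta> \<gamma>\<close> has \<open>c = 1 - \<gamma>\<close>.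
\<close>

definition combined_RL ::
  "real \<Rightarrow> real \<Rightarrow> real \<Rightarrow> real \<Rightarrow> real \<Rightarrow> (real \<Rightarrow> real) \<Rightarrow> real \<Rightarrow> real" where
  "combined_RL a b \<beta> \<alpha> c f x = c * RL_left a b \<beta> f x + (1 - c) * RL_right a b \<alpha> f x"

definition combined_RL_exists ::
  "real \<Rightarrow> real \<Rightarrow> real \<Rightarrow> real \<Rightarrow> real \<Rightarrow> (real \<Rightarrow> real) \<Rightarrow> real \<Rightarrow> bool" where
  "combined_RL_exists a b \<beta> \<alpha> c f x \<longleftrightarrow>
     (c \<noteq> 0 \<longrightarrow> frac_int_left a (1 - \<beta>) f differentiable (at x within {a..b})) \<and>
     (1 - c \<noteq> 0 \<longrightarrow> frac_int_right b (1 - \<alpha>) f differentiable (at x within {a..b}))"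

text \<open>
  The derivative of \<open>combined_RL_primitive\<close> is \<open>combined_RL\<close> wherever the summands of the latter
  exist. The primitive can be differentiable where the separate summands are not: their
  singularities may cancel.
\<close>

definition combined_RL_primitive ::
  "real \<Rightarrow> real \<Rightarrow> real \<Rightarrow> real \<Rightarrow> real \<Rightarrow> (real \<Rightarrow> real) \<Rightarrow> real \<Rightarrow> real" where
  "combined_RL_primitive a b \<beta> \<alpha> c f x =
     c * frac_int_left a (1 - \<beta>) f x - (1 - c) * frac_int_right b (1 - \<alpha>) f x"

definition vec_caputo ::
  "real \<Rightarrow> real \<Rightarrow> real^'n \<Rightarrow> real^'n \<Rightarrow> real^'n \<Rightarrow> (real \<Rightarrow> real^'n) \<Rightarrow> real \<Rightarrow> real^'n" where
  "vec_caputo a b \<alpha> \<beta> \<gamma> y x =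
     (\<chi> i. combined_caputo a b (\<alpha> $ i) (\<beta> $ i) (\<gamma> $ i) (\<lambda>t. y t $ i) x)"

definition space_D ::
  "real \<Rightarrow> real \<Rightarrow> real^'n \<Rightarrow> real^'n \<Rightarrow> real^'n \<Rightarrow> (real \<Rightarrow> real^'n) set" where
  "space_D a b \<alpha> \<beta> \<gamma> =
     {y. (\<forall>i. AC_on a b (\<lambda>t. y t $ i)) \<and>
         (\<forall>i. \<forall>x\<in>{a..b}. combined_caputo_exists a b (\<alpha> $ i) (\<beta> $ i) (\<gamma> $ i) (\<lambda>t. y t $ i) x) \<and>
         continuous_on {a..b} (vec_caputo a b \<alpha> \<beta> \<gamma> y)}"

definition is_norm :: "('v::real_vector \<Rightarrow> real) \<Rightarrow> bool" where
  "is_norm \<nu> \<longleftrightarrow>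
     (\<forall>v. 0 \<le> \<nu> v) \<and> (\<forall>v. \<nu> v = 0 \<longleftrightarrow> v = 0) \<and>
     (\<forall>c v. \<nu> (c *\<^sub>R v) = \<bar>c\<bar> * \<nu> v) \<and> (\<forall>v w. \<nu> (v + w) \<le> \<nu> v + \<nu> w)"

text \<open>Both suprema are maxima for \<open>y\<close> in \<^const>\<open>space_D\<close>.\<close>

definition norm_D ::
  "(real^'n \<Rightarrow> real) \<Rightarrow> real \<Rightarrow> real \<Rightarrow> real^'n \<Rightarrow> real^'n \<Rightarrow> real^'n \<Rightarrow> (real \<Rightarrow> real^'n) \<Rightarrow> real" where
  "norm_D \<nu> a b \<alpha> \<beta> \<gamma> y =
     (SUP x\<in>{a..b}. \<nu> (y x)) + (SUP x\<in>{a..b}. \<nu> (vec_caputo a b \<alpha> \<beta> \<gamma> y x))"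

definition frac_arg ::
  "real \<Rightarrow> real \<Rightarrow> real^'n \<Rightarrow> real^'n \<Rightarrow> real^'n \<Rightarrow> (real \<Rightarrow> real^'n) \<Rightarrow> real
     \<Rightarrow> real \<times> (real^'n) \<times> (real^'n)" where
  "frac_arg a b \<alpha> \<beta> \<gamma> y x = (x, y x, vec_caputo a b \<alpha> \<beta> \<gamma> y x)"

definition functional_defined ::
  "real \<Rightarrow> real \<Rightarrow> real^'n \<Rightarrow> real^'n \<Rightarrow> real^'n \<Rightarrow> (real \<times> (real^'n) \<times> (real^'n) \<Rightarrow> real)
     \<Rightarrow> (real \<Rightarrow> real^'n) \<Rightarrow> bool" where
  "functional_defined a b \<alpha> \<beta> \<gamma> K y \<longleftrightarrow>
     set_integrable lebesgue {a..b} (\<lambda>x. K (frac_arg a b \<alpha> \<beta> \<gamma> y x))"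

definition functional ::
  "real \<Rightarrow> real \<Rightarrow> real^'n \<Rightarrow> real^'n \<Rightarrow> real^'n \<Rightarrow> (real \<times> (real^'n) \<times> (real^'n) \<Rightarrow> real)
     \<Rightarrow> (real \<Rightarrow> real^'n) \<Rightarrow> real" where
  "functional a b \<alpha> \<beta> \<gamma> K y = (LINT x:{a..b}|lebesgue. K (frac_arg a b \<alpha> \<beta> \<gamma> y x))"

text \<open>\<open>C\<^sup>1\<close> on \<open>[a,b] \<times> \<real>\<^sup>N \<times> \<real>\<^sup>N\<close>, with one-sided derivatives in the first argument at \<open>a\<close> and \<open>b\<close>.\<close>

definition C1_integrand ::
  "real \<Rightarrow> real \<Rightarrow> (real \<times> (real^'n) \<times> (real^'n) \<Rightarrow> real) \<Rightarrow> bool" where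
  "C1_integrand a b K \<longleftrightarrow>
     (\<exists>K' :: real \<times> (real^'n) \<times> (real^'n) \<Rightarrow> (real \<times> (real^'n) \<times> (real^'n)) \<Rightarrow>\<^sub>L real.
        continuous_on ({a..b} \<times> UNIV) K' \<and>
        (\<forall>p\<in>{a..b} \<times> UNIV. (K has_derivative blinfun_apply (K' p)) (at p within {a..b} \<times> UNIV)))"

definition partial_y ::
  "(real \<times> (real^'n) \<times> (real^'n) \<Rightarrow> real) \<Rightarrow> 'n \<Rightarrow> real \<times> (real^'n) \<times> (real^'n) \<Rightarrow> real" where
  "partial_y K i = (\<lambda>(x, u, v). deriv (\<lambda>s. K (x, u + s *\<^sub>R axis i 1, v)) 0)"

definition partial_v ::
  "(real \<times> (real^'n) \<times> (real^'n) \<Rightarrow> real) \<Rightarrow> 'n \<Rightarrow> real \<times> (real^'n) \<times> (real^'n) \<Rightarrow> real" where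
  "partial_v K i = (\<lambda>(x, u, v). deriv (\<lambda>s. K (x, u, v + s *\<^sub>R axis i 1)) 0)"

definition variation_quotient ::
  "((real \<Rightarrow> real^'n) \<Rightarrow> real) \<Rightarrow> (real \<Rightarrow> real^'n) \<Rightarrow> (real \<Rightarrow> real^'n) \<Rightarrow> real \<Rightarrow> real" where
  "variation_quotient J y h \<epsilon> = (J (\<lambda>x. y x + \<epsilon> *\<^sub>R h x) - J y) / \<epsilon>"

definition first_variation_exists ::
  "((real \<Rightarrow> real^'n) \<Rightarrow> real) \<Rightarrow> (real \<Rightarrow> real^'n) \<Rightarrow> (real \<Rightarrow> real^'n) \<Rightarrow> bool" where
  "first_variation_exists J y h \<longleftrightarrow> (\<exists>l. (variation_quotient J y h \<longlongrightarrow> l) (at 0))"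

definition first_variation ::
  "((real \<Rightarrow> real^'n) \<Rightarrow> real) \<Rightarrow> (real \<Rightarrow> real^'n) \<Rightarrow> (real \<Rightarrow> real^'n) \<Rightarrow> real" where
  "first_variation J y h = Lim (at 0) (variation_quotient J y h)"

text \<open>
  The functional with integrand \<open>K\<close> is defined in a neighbourhood \<open>U\<close> of \<open>y\<close> and has continuous
  first variations there: for every direction \<open>h\<close>, the first variation in the direction \<open>h\<close> exists
  on \<open>U\<close> and depends continuously on the point of \<open>U\<close>.
\<close>

definition continuous_variations_near ::
  "(real^'n \<Rightarrow> real) \<Rightarrow> real \<Rightarrow> real \<Rightarrow> real^'n \<Rightarrow> real^'n \<Rightarrow> real^'n
     \<Rightarrow> (real \<times> (real^'n) \<times> (real^'n) \<Rightarrow> real) \<Rightarrow> (real \<Rightarrow> real^'n) \<Rightarrow> bool" where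
  "continuous_variations_near \<nu> a b \<alpha> \<beta> \<gamma> K y \<longleftrightarrow>
     (\<exists>\<rho>>0.
        let U = {z \<in> space_D a b \<alpha> \<beta> \<gamma>. norm_D \<nu> a b \<alpha> \<beta> \<gamma> (\<lambda>x. z x - y x) < \<rho>};
            J = functional a b \<alpha> \<beta> \<gamma> K
        in (\<forall>z\<in>U. functional_defined a b \<alpha> \<beta> \<gamma> K z) \<and>
           (\<forall>h\<in>space_D a b \<alpha> \<beta> \<gamma>. \<forall>z\<in>U.
              first_variation_exists J z h \<and>
              (\<forall>e>0. \<exists>d>0. \<forall>w\<in>U. norm_D \<nu> a b \<alpha> \<beta> \<gamma> (\<lambda>x. w x - z x) < d \<longrightarrow>
                 \<bar>first_variation J w h - first_variation J z h\<bar> < e)))"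

definition local_minimizer ::
  "(real^'n \<Rightarrow> real) \<Rightarrow> real \<Rightarrow> real \<Rightarrow> real^'n \<Rightarrow> real^'n \<Rightarrow> real^'n
     \<Rightarrow> ((real \<Rightarrow> real^'n) \<Rightarrow> real) \<Rightarrow> (real \<Rightarrow> real^'n) set \<Rightarrow> (real \<Rightarrow> real^'n) \<Rightarrow> bool" where
  "local_minimizer \<nu> a b \<alpha> \<beta> \<gamma> J S y \<longleftrightarrow>
     y \<in> S \<and>
     (\<exists>\<delta>>0. \<forall>z\<in>S. norm_D \<nu> a b \<alpha> \<beta> \<gamma> (\<lambda>x. z x - y x) < \<delta> \<longrightarrow> J y \<le> J z)"

end

(*
  The map (s, t) |-> (J, G)(y + s phi + sum_m t_m h_m) is differentiable with continuous
  derivative. If phi vanishes at a and b and dJ(phi) differed from sum_j lam_j dG_j(phi), where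
  lam is determined by the values on the h_m, the derivative of that map at 0 would be onto, and
  the open mapping theorem would give an admissible function near y with a smaller value of J.
  So the variation of L - sum_j lam_j G^j vanishes in all directions phi. For phi in C^1,
  Fubini's theorem moves the fractional integrals from phi' to the other factor, and the lemma of
  du Bois-Reymond gives the equation for the primitive.

  That the combined Caputo derivative, an integral of deriv, is linear rests on the
  differentiability almost everywhere of absolutely continuous functions, which is
  obtained here from the Vitali covering theorem.
*)

theory Submission
  imports Defs
begin

section \<open>Differentiability of absolutely continuous functions\<close>

text \<open>At a point where a function is not differentiable, \<open>deriv\<close> is an arbitrary
  value, so \<open>deriv\<close> of a sum may differ there from the sum of the
  \<open>deriv\<close>s. Unless such points form a null set, not even
  \<open>y + \<epsilon> h\<close> could be handled. The classical theorem that settles this is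
  reached without monotone functions or bounded variation: absolute continuity is applied directly
  to the gaps between two finite families of disjoint intervals on which the function has different
  slopes.

  No calculus in an infinite-dimensional space takes place. The functions compared with
  \<open>y\<close> differ from it by combinations of finitely many directions; the coefficients
  range over a finite-dimensional space, in which the integrals are differentiated under the
  integral sign.

  The variational argument only shows that an ordinary primitive plus a combination of a left and a
  right fractional integral is constant. This makes the combination differentiable but says nothing
  about its two summands, which is why the equation appears for the primitive first.\<close>

text \<open>The intervals contain \<open>x\<close> in their interior, so that the set of such \<open>x\<close> is a \<open>G\<^sub>\<delta>\<close> set.\<close>

definition fine_at :: "(real \<Rightarrow> real \<Rightarrow> bool) \<Rightarrow> real \<Rightarrow> bool" where
  "fine_at R x \<longleftrightarrow> (\<forall>d>0. \<exists>u v. u < x \<and> x < v \<and> v - u < d \<and> R u v)"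

lemma fine_at_alt:
  "fine_at R x \<longleftrightarrow> (\<forall>n. x \<in> (\<Union>(u, v)\<in>{(u, v). v - u < 1 / real (Suc n) \<and> R u v}. {u<..<v}))"
proof
  assume "fine_at R x"
  then show "\<forall>n. x \<in> (\<Union>(u, v)\<in>{(u, v). v - u < 1 / real (Suc n) \<and> R u v}. {u<..<v})"
    unfolding fine_at_def
  proof (intro allI)
    fix n
    assume "\<forall>d>0. \<exists>u v. u < x \<and> x < v \<and> v - u < d \<and> R u v"
    then obtain u v where "u < x" "x < v" "v - u < 1 / real (Suc n)" "R u v"
      by (meson of_nat_0_less_iff zero_less_Suc zero_less_divide_1_iff)
    then show "x \<in> (\<Union>(u, v)\<in>{(u, v). v - u < 1 / real (Suc n) \<and> R u v}. {u<..<v})"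
      by auto
  qed
next
  assume *: "\<forall>n. x \<in> (\<Union>(u, v)\<in>{(u, v). v - u < 1 / real (Suc n) \<and> R u v}. {u<..<v})"
  show "fine_at R x"
    unfolding fine_at_def
  proof (intro allI impI)
    fix d :: real assume "0 < d"
    then obtain n where n: "1 / real (Suc n) < d"
      using nat_approx_posE by blast
    obtain u v where "v - u < 1 / real (Suc n)" "R u v" "u < x" "x < v"
      using *[rule_format, of n] by auto
    then show "\<exists>u v. u < x \<and> x < v \<and> v - u < d \<and> R u v"
      using n by (intro exI[of _ u] exI[of _ v]) auto
  qed
qed

lemma borel_fine_at: "{x. fine_at R x} \<in> sets borel"
proof -
  have "{x. fine_at R x} =
      (\<Inter>n. \<Union>(u, v)\<in>{(u, v). v - u < 1 / real (Suc n) \<and> R u v}. {u<..<v})"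
    by (auto simp: fine_at_alt)
  also have "\<dots> \<in> sets borel"
    by (intro sets.countable_INT') (auto intro!: borel_open open_UN)
  finally show ?thesis .
qed

text \<open>Vitali's theorem exhausts \<open>E\<close> up to a null set by countably many disjoint
  intervals, and finitely many of them already carry all but \<open>\<epsilon>\<close> of its
  measure. Keeping them inside \<open>U\<close> bounds their total length by the measure of
  \<open>U\<close>. Measuring \<open>E\<close> inside their union, rather than the union itself,
  allows a second application to that part of \<open>E\<close>.\<close>

lemma Vitali_finite_intervals:
  fixes E U :: "real set"
  assumes E: "E \<in> lmeasurable" and "open U" "E \<subseteq> U" and fine: "\<And>x. x \<in> E \<Longrightarrow> fine_at R x"
    and "0 < \<epsilon>"
  obtains P where "finite P" "\<And>u v. (u, v) \<in> P \<Longrightarrow> u < v \<and> R u v \<and> {u..v} \<subseteq> U"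
    "pairwise (\<lambda>p q. {fst p..snd p} \<inter> {fst q..snd q} = {}) P"
    "measure lebesgue E - \<epsilon> < measure lebesgue (E \<inter> (\<Union>(u, v)\<in>P. {u..v}))"
proof -
  define K where "K = {(u, v). u < v \<and> R u v \<and> {u..v} \<subseteq> U}"
  \<comment> \<open>The covering theorem speaks of balls, so an interval is described by its centre
    and half its length.\<close>
  define mid rad where "mid p = (fst p + snd p) / 2" and "rad p = (snd p - fst p) / 2"
    for p :: "real \<times> real"
  have cb: "cball (mid p) (rad p) = {fst p..snd p}" for p
    by (simp add: mid_def rad_def cball_eq_atLeastAtMost field_simps)
  obtain C where C: "countable C" "C \<subseteq> K"
    and pw: "pairwise (\<lambda>i j. disjnt (cball (mid i) (rad i)) (cball (mid j) (rad j))) C"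
    and neg: "negligible (E - (\<Union>i\<in>C. cball (mid i) (rad i)))"
  proof (rule Vitali_covering_theorem_cballs[of K rad E mid])
    show "0 < rad i" if "i \<in> K" for i
      using that by (auto simp: K_def rad_def)
    fix x d :: real
    assume x: "x \<in> E" and "0 < d"
    obtain e where e: "0 < e" "ball x e \<subseteq> U"
      using \<open>open U\<close> \<open>E \<subseteq> U\<close> x by (meson openE subsetD)
    obtain u v where uv: "u < x" "x < v" "v - u < min d e" "R u v"
      using fine[OF x] \<open>0 < d\<close> e(1) unfolding fine_at_def by (metis min_less_iff_conj)
    have "{u..v} \<subseteq> ball x e"
      using uv by (auto simp: dist_real_def)
    then show "\<exists>i. i \<in> K \<and> x \<in> cball (mid i) (rad i) \<and> rad i < d"
      unfolding cb using uv e by (intro exI[of _ "(u, v)"]) (auto simp: K_def rad_def)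
  qed blast
  \<comment> \<open>Intersecting with \<open>E\<close> gives all finite unions the common bound
    \<open>measure lebesgue E\<close>, which the approximation by finite subfamilies
    requires.\<close>
  define \<D> where "\<D> = (\<lambda>p. E \<inter> {fst p..snd p}) ` C"
  have mD: "d \<in> lmeasurable" if "d \<in> \<D>" for d
    using that E by (auto simp: \<D>_def intro: fmeasurable.Int)
  have le: "measure lebesgue (\<Union>D') \<le> measure lebesgue E" if "D' \<subseteq> \<D>" "finite D'" for D'
    using that mD E by (intro measure_mono_fmeasurable) (auto simp: \<D>_def intro!: sets.finite_Union)
  obtain D' where D': "D' \<subseteq> \<D>" "finite D'"
    "measure lebesgue (\<Union>\<D>) - \<epsilon> < measure lebesgue (\<Union>D')"
  proof (rule measure_countable_Union_approachable[of \<D> \<epsilon> "measure lebesgue E"])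
    show "countable \<D>" using C(1) by (simp add: \<D>_def)
  qed (use mD le \<open>0 < \<epsilon>\<close> in auto)
  obtain P where P: "P \<subseteq> C" "finite P" "D' = (\<lambda>p. E \<inter> {fst p..snd p}) ` P"
    using D'(1,2) unfolding \<D>_def by (meson finite_subset_image)
  have "measure lebesgue (\<Union>\<D>) = measure lebesgue E"
  proof (rule measure_negligible_symdiff)
    have "E - \<Union>\<D> = E - (\<Union>i\<in>C. cball (mid i) (rad i))" "\<Union>\<D> - E = {}"
      by (auto simp: \<D>_def cb)
    then show "negligible ((E - \<Union>\<D>) \<union> (\<Union>\<D> - E))"
      using neg by simp
    show "E \<in> lmeasurable" by (rule E)
  qed
  moreover have "\<Union>D' = E \<inter> (\<Union>(u, v)\<in>P. {u..v})"
    by (auto simp: P)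
  moreover have "pairwise (\<lambda>p q. {fst p..snd p} \<inter> {fst q..snd q} = {}) P"
    using pairwise_subset[OF pw P(1)] by (simp add: cb disjnt_def)
  moreover have "u < v \<and> R u v \<and> {u..v} \<subseteq> U" if "(u, v) \<in> P" for u v
    using that P(1) C(2) unfolding K_def by blast
  ultimately show ?thesis
    using that[of P] P(2) D'(3) by metis
qed

text \<open>
  \<open>\<Gamma>\<close> consists of the gaps that \<open>Q\<close> leaves in the intervals of \<open>P\<close>. The last conjunct makes the
  induction on \<open>Q\<close> work: a further interval splits exactly one gap.
\<close>

lemma gap_intervals:
  fixes P Q :: "(real \<times> real) set"
  assumes "finite Q" "finite P" and P: "\<forall>(u, v)\<in>P. u < v"
    and PP: "pairwise (\<lambda>p q. {fst p<..<snd p} \<inter> {fst q<..<snd q} = {}) P"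
    and Q: "\<forall>(u, v)\<in>Q. u < v \<and> (\<exists>(s, t)\<in>P. s < u \<and> v < t)"
    and QQ: "pairwise (\<lambda>p q. {fst p..snd p} \<inter> {fst q..snd q} = {}) Q"
  shows "\<exists>\<Gamma>. finite \<Gamma> \<and> (\<forall>(u, v)\<in>\<Gamma>. u < v \<and> (\<exists>(s, t)\<in>P. s \<le> u \<and> v \<le> t)) \<and>
    pairwise (\<lambda>p q. {fst p<..<snd p} \<inter> {fst q<..<snd q} = {}) \<Gamma> \<and>
    (\<forall>g :: real \<Rightarrow> real. (\<Sum>(u, v)\<in>\<Gamma>. g v - g u) + (\<Sum>(u, v)\<in>Q. g v - g u) = (\<Sum>(u, v)\<in>P. g v - g u)) \<and>
    (\<forall>u v. u < v \<and> (\<exists>(s, t)\<in>P. s < u \<and> v < t) \<and> (\<forall>(s, t)\<in>Q. {u..v} \<inter> {s..t} = {})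
       \<longrightarrow> (\<exists>(s, t)\<in>\<Gamma>. s < u \<and> v < t))"
  using \<open>finite Q\<close> Q QQ
proof (induction Q)
  case empty
  then show ?case
    using assms by (intro exI[of _ P]) auto
next
  case (insert p Q)
  obtain u v where p: "p = (u, v)" by force
  have Q: "\<forall>(u, v)\<in>Q. u < v \<and> (\<exists>(s, t)\<in>P. s < u \<and> v < t)"
    using insert.prems(1) by blast
  have QQ: "pairwise (\<lambda>p q. {fst p..snd p} \<inter> {fst q..snd q} = {}) Q"
    using insert.prems(2) by (rule pairwise_subset) auto
  from insert.IH[OF Q QQ] obtain \<Gamma> where \<Gamma>: "finite \<Gamma>"
    "\<forall>(u, v)\<in>\<Gamma>. u < v \<and> (\<exists>(s, t)\<in>P. s \<le> u \<and> v \<le> t)"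
    and pw: "pairwise (\<lambda>p q. {fst p<..<snd p} \<inter> {fst q<..<snd q} = {}) \<Gamma>"
    and sm: "\<forall>g :: real \<Rightarrow> real. (\<Sum>(u, v)\<in>\<Gamma>. g v - g u) + (\<Sum>(u, v)\<in>Q. g v - g u) = (\<Sum>(u, v)\<in>P. g v - g u)"
    and ins: "\<forall>u v. u < v \<and> (\<exists>(s, t)\<in>P. s < u \<and> v < t) \<and> (\<forall>(s, t)\<in>Q. {u..v} \<inter> {s..t} = {})
       \<longrightarrow> (\<exists>(s, t)\<in>\<Gamma>. s < u \<and> v < t)"
    by (elim exE conjE) (rule that)
  have uv: "u < v" "\<exists>(s, t)\<in>P. s < u \<and> v < t"
    using insert.prems(1) p by auto
  have dj: "\<forall>(s, t)\<in>Q. {u..v} \<inter> {s..t} = {}"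
    using insert.prems(2) insert.hyps(2) p by (fastforce simp: pairwise_insert)
  obtain s t where st: "(s, t) \<in> \<Gamma>" "s < u" "v < t"
    using ins[rule_format, OF conjI[OF uv(1) conjI[OF uv(2) dj]]] by auto
  have disj: "{s<..<t} \<inter> {s'<..<t'} = {}" if "(s', t') \<in> \<Gamma> - {(s, t)}" for s' t'
    using pw st(1) that by (fastforce simp: pairwise_def)
  \<comment> \<open>\<open>\<Delta>\<close> is a set: if one of the two new pieces already belonged
    to \<open>\<Gamma>\<close>, its increment would be counted only once and the sum identity would
    fail.\<close>
  have n1: "(s, u) \<notin> \<Gamma>"
  proof
    assume "(s, u) \<in> \<Gamma>"
    then have "{s<..<t} \<inter> {s<..<u} = {}" using disj[of s u] st uv by auto
    moreover have "(s + u) / 2 \<in> {s<..<t} \<inter> {s<..<u}" using st uv by auto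
    ultimately show False by blast
  qed
  have n2: "(v, t) \<notin> \<Gamma>"
  proof
    assume "(v, t) \<in> \<Gamma>"
    then have "{s<..<t} \<inter> {v<..<t} = {}" using disj[of v t] st uv by auto
    moreover have "(v + t) / 2 \<in> {s<..<t} \<inter> {v<..<t}" using st uv by auto
    ultimately show False by blast
  qed
  define \<Delta> where "\<Delta> = insert (s, u) (insert (v, t) (\<Gamma> - {(s, t)}))"
  have "finite \<Delta>" using \<Gamma> by (simp add: \<Delta>_def)
  moreover have "\<forall>(u, v)\<in>\<Delta>. u < v \<and> (\<exists>(s, t)\<in>P. s \<le> u \<and> v \<le> t)"
  proof -
    obtain s' t' where "(s', t') \<in> P" "s' \<le> s" "t \<le> t'"
      using \<Gamma>(2) st(1) by auto
    then have "\<exists>(s', t')\<in>P. s' \<le> s \<and> u \<le> t'" "\<exists>(s', t')\<in>P. s' \<le> v \<and> t \<le> t'"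
      using st uv by (auto intro!: bexI[of _ "(s', t')"])
    then show ?thesis
      using \<Gamma>(2) st by (auto simp: \<Delta>_def)
  qed
  moreover have "pairwise (\<lambda>p q. {fst p<..<snd p} \<inter> {fst q<..<snd q} = {}) \<Delta>"
  proof -
    have sub: "{s<..<u} \<subseteq> {s<..<t}" "{v<..<t} \<subseteq> {s<..<t}" "disjnt {s<..<u} {v<..<t}"
      using st uv by (auto simp: disjnt_def)
    have pw': "pairwise (\<lambda>p q. disjnt {fst p<..<snd p} {fst q<..<snd q}) (\<Gamma> - {(s, t)})"
      unfolding disjnt_def using pw by (rule pairwise_subset) auto
    have dj': "disjnt {s<..<t} {fst q<..<snd q}" if "q \<in> \<Gamma> - {(s, t)}" for q
      using disj[of "fst q" "snd q"] that by (simp only: disjnt_def prod.collapse)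
    have "disjnt {s<..<u} {fst q<..<snd q} \<and> disjnt {fst q<..<snd q} {s<..<u} \<and>
        disjnt {v<..<t} {fst q<..<snd q} \<and> disjnt {fst q<..<snd q} {v<..<t}"
      if "q \<in> \<Gamma> - {(s, t)}" for q
      using dj'[OF that] sub(1,2) disjnt_subset1 disjnt_sym by metis
    then show ?thesis
      unfolding \<Delta>_def pairwise_insert fst_conv snd_conv disjnt_def[symmetric]
      using pw' sub(3) disjnt_sym[OF sub(3)] by auto
  qed
  moreover have "(\<Sum>(u, v)\<in>\<Delta>. g v - g u) + (\<Sum>(u, v)\<in>insert p Q. g v - g u) = (\<Sum>(u, v)\<in>P. g v - g u)"
    for g :: "real \<Rightarrow> real"
  proof -
    have "(\<Sum>(u, v)\<in>\<Gamma>. g v - g u) = (g t - g s) + (\<Sum>(u, v)\<in>\<Gamma> - {(s, t)}. g v - g u)"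
      using st \<Gamma> by (subst sum.remove[of _ "(s, t)"]) auto
    \<comment> \<open>The increments over \<open>(s, u)\<close>, \<open>(u, v)\<close> and
      \<open>(v, t)\<close> telescope to the increment over the old gap
      \<open>(s, t)\<close>.\<close>
    then show ?thesis
      unfolding sm[rule_format, of g, symmetric] \<Delta>_def using n1 n2 \<Gamma> st uv insert.hyps p by simp
  qed
  moreover have "\<exists>(s, t)\<in>\<Delta>. s < u' \<and> v' < t"
    if uv': "u' < v'" and I: "\<exists>(s, t)\<in>P. s < u' \<and> v' < t"
      and D: "\<forall>(s, t)\<in>insert p Q. {u'..v'} \<inter> {s..t} = {}" for u' v'
  proof -
    obtain s' t' where st': "(s', t') \<in> \<Gamma>" "s' < u'" "v' < t'"
      using ins[rule_format, of u' v'] uv' I D by auto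
    show ?thesis
    proof (cases "(s', t') = (s, t)")
      case True
      have "{u'..v'} \<inter> {u..v} = {}" using D p by auto
      then have "v' < u \<or> v < u'"
        using uv' uv by (smt (verit, ccfv_threshold) atLeastAtMost_iff disjoint_iff)
      then show ?thesis
        using True st' by (auto simp: \<Delta>_def)
    next
      case False
      then show ?thesis using st' by (auto simp: \<Delta>_def intro!: bexI[of _ "(s', t')"])
    qed
  qed
  ultimately show ?case
    by (intro exI[of _ \<Delta>] conjI allI impI) (simp, simp, simp, simp, meson)
qed

lemma measure_Union_intervals:
  fixes P :: "(real \<times> real) set"
  assumes "finite P" "\<And>u v. (u, v) \<in> P \<Longrightarrow> u \<le> v"
    and "pairwise (\<lambda>p q. {fst p..snd p} \<inter> {fst q..snd q} = {}) P"
  shows "measure lebesgue (\<Union>(u, v)\<in>P. {u..v}) = (\<Sum>(u, v)\<in>P. v - u)"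
proof -
  have "measure lebesgue (\<Union>p\<in>P. {fst p..snd p}) = (\<Sum>p\<in>P. measure lebesgue {fst p..snd p})"
    using assms by (intro measure_finite_Union) (auto simp: disjoint_family_on_def pairwise_def emeasure_eq_ennreal_measure)
  also have "\<dots> = (\<Sum>p\<in>P. snd p - fst p)"
    using assms by (intro sum.cong) auto
  finally show ?thesis by (simp add: case_prod_unfold)
qed

lemma AC_onE:
  assumes "AC_on a b f" "0 < \<eta>"
  obtains \<delta> where "0 < \<delta>"
    "\<And>P::(real \<times> real) set. \<lbrakk>finite P; \<forall>(u, v)\<in>P. a \<le> u \<and> u \<le> v \<and> v \<le> b;
      pairwise (\<lambda>p q. {fst p<..<snd p} \<inter> {fst q<..<snd q} = {}) P; (\<Sum>(u, v)\<in>P. v - u) < \<delta>\<rbrakk>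
      \<Longrightarrow> (\<Sum>(u, v)\<in>P. \<bar>f v - f u\<bar>) < \<eta>"
  using assms unfolding AC_on_def by meson

lemma pairwise_disjoint_open:
  fixes P :: "(real \<times> real) set"
  assumes "pairwise (\<lambda>p q. {fst p..snd p} \<inter> {fst q..snd q} = {}) P"
  shows "pairwise (\<lambda>p q. {fst p<..<snd p} \<inter> {fst q<..<snd q} = {}) P"
proof (rule pairwise_mono[OF assms])
  fix p q :: "real \<times> real"
  have "{fst p<..<snd p} \<inter> {fst q<..<snd q} \<subseteq> {fst p..snd p} \<inter> {fst q..snd q}" by auto
  then show "{fst p..snd p} \<inter> {fst q..snd q} = {} \<Longrightarrow> {fst p<..<snd p} \<inter> {fst q<..<snd q} = {}"
    by blast
qed simp

text \<open>
  Cover \<open>E\<close> up to \<open>\<epsilon>\<close> by disjoint intervals of slope at least \<open>q\<close>, and then \<open>E\<close> inside these by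
  disjoint intervals of slope at most \<open>p\<close>. The gaps have total length below \<open>3 \<epsilon>\<close>, so absolute
  continuity makes the two total increments of \<open>f\<close> almost equal.
\<close>

lemma Vitali_opposite_slopes:
  fixes f :: "real \<Rightarrow> real"
  assumes AC: "AC_on a b f" and "p < q" and E: "E \<in> lmeasurable"
    and up: "\<And>x. x \<in> E \<Longrightarrow> fine_at (\<lambda>u v. a \<le> u \<and> v \<le> b \<and> q * (v - u) \<le> f v - f u) x"
    and down: "\<And>x. x \<in> E \<Longrightarrow> fine_at (\<lambda>u v. a \<le> u \<and> v \<le> b \<and> f v - f u \<le> p * (v - u)) x"
  shows "negligible E"
proof (rule ccontr)
  define m where "m = measure lebesgue E"
  assume "\<not> negligible E"
  then have m: "0 < m"
    using E by (auto simp: m_def negligible_iff_measure0 zero_less_measure_iff measure_nonneg order.not_eq_order_implies_strict)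
  \<comment> \<open>Slopes at least \<open>q\<close> and slopes at most \<open>p\<close> on nearly
    all of a set of measure \<open>m\<close> make the two total increments differ by about
    \<open>(q - p) * m\<close>. The gaps are allowed to account for half of it.\<close>
  define \<eta> where "\<eta> = (q - p) * m / 2"
  have \<eta>: "0 < \<eta>" using m \<open>p < q\<close> by (simp add: \<eta>_def)
  obtain \<delta> where "0 < \<delta>" and \<delta>: "\<And>P::(real \<times> real) set. \<lbrakk>finite P; \<forall>(u, v)\<in>P. a \<le> u \<and> u \<le> v \<and> v \<le> b;
      pairwise (\<lambda>p q. {fst p<..<snd p} \<inter> {fst q<..<snd q} = {}) P; (\<Sum>(u, v)\<in>P. v - u) < \<delta>\<rbrakk>
      \<Longrightarrow> (\<Sum>(u, v)\<in>P. \<bar>f v - f u\<bar>) < \<eta>"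
    by (rule AC_onE[OF AC \<eta>]) (rule that)
  \<comment> \<open>\<open>\<delta> / 4\<close> makes gaps of total length below
    \<open>3 * \<epsilon>\<close> short enough for absolute continuity. The other bound keeps the
    errors \<open>\<epsilon> * (q - p)\<close> and \<open>3 * \<bar>p\<bar> * \<epsilon>\<close> of
    the final estimate below the remaining half of \<open>(q - p) * m\<close>.\<close>
  define \<epsilon> where "\<epsilon> = min (\<delta> / 4) ((q - p) * m / (2 * (q - p + 3 * \<bar>p\<bar> + 1)))"
  have D: "0 < q - p + 3 * \<bar>p\<bar> + 1" using \<open>p < q\<close> by simp
  have \<epsilon>: "0 < \<epsilon>" using m \<open>p < q\<close> \<open>0 < \<delta>\<close> D by (auto simp: \<epsilon>_def)
  have \<epsilon>1: "4 * \<epsilon> \<le> \<delta>" unfolding \<epsilon>_def by linarith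
  have "\<epsilon> * (q - p + 3 * \<bar>p\<bar> + 1) \<le> (q - p) * m / (2 * (q - p + 3 * \<bar>p\<bar> + 1)) * (q - p + 3 * \<bar>p\<bar> + 1)"
    using D by (intro mult_right_mono) (auto simp: \<epsilon>_def)
  also have "\<dots> = (q - p) * m / 2"
    using D nonzero_mult_divide_mult_cancel_right[of "q - p + 3 * \<bar>p\<bar> + 1" "(q - p) * m" 2] by simp
  finally have \<epsilon>2: "\<epsilon> * (q - p) + 3 * \<bar>p\<bar> * \<epsilon> < (q - p) * m / 2"
    using \<epsilon> by (simp add: algebra_simps)
  \<comment> \<open>Since \<open>U\<close> exceeds \<open>E\<close> by less than
    \<open>\<epsilon>\<close> in measure, disjoint intervals inside it have total length below
    \<open>m + \<epsilon>\<close>, whatever part of them misses \<open>E\<close>.\<close>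
  obtain U where U: "open U" "E \<subseteq> U" and UE: "U - E \<in> lmeasurable" "emeasure lebesgue (U - E) < ennreal \<epsilon>"
    using sets_lebesgue_outer_open[OF fmeasurableD[OF E] \<epsilon>] .
  have U_eq: "U = E \<union> (U - E)" using U(2) by blast
  have U3: "U \<in> lmeasurable"
    using E UE(1) by (subst U_eq) (rule fmeasurable.Un)
  have "measure lebesgue (U - E) < \<epsilon>"
    using UE \<epsilon> by (simp add: emeasure_eq_measure2 ennreal_less_iff)
  moreover have "measure lebesgue U \<le> m + measure lebesgue (U - E)"
    unfolding m_def using measure_Un_le[of E lebesgue "U - E"] E UE(1) U_eq by (metis fmeasurableD)
  ultimately have U4: "measure lebesgue U < m + \<epsilon>" by simp
  obtain P where P: "finite P" "\<And>u v. (u, v) \<in> P \<Longrightarrow> u < v \<and> (a \<le> u \<and> v \<le> b \<and> q * (v - u) \<le> f v - f u) \<and> {u..v} \<subseteq> U"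
    "pairwise (\<lambda>p q. {fst p..snd p} \<inter> {fst q..snd q} = {}) P"
    "m - \<epsilon> < measure lebesgue (E \<inter> (\<Union>(u, v)\<in>P. {u..v}))"
    using Vitali_finite_intervals[OF E U up \<epsilon>] unfolding m_def by blast
  have P': "u \<le> v" if "(u, v) \<in> P" for u v using P(2)[OF that] by simp
  \<comment> \<open>The second covering takes place inside the open intervals, so that each of its
    members can lie strictly inside a member of \<open>P\<close>. Only finitely many end points are
    lost, which does not change the measure.\<close>
  define V where "V = (\<Union>(u, v)\<in>P. {u<..<v})"
  define E1 where "E1 = E \<inter> V"
  have V: "open V" by (auto simp: V_def)
  have E1: "E1 \<in> lmeasurable" using E V by (auto simp: E1_def intro!: fmeasurable_Int_fmeasurable)
  have VW: "V \<subseteq> (\<Union>(u, v)\<in>P. {u..v})"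
    unfolding V_def by (rule UN_mono[OF order_refl]) auto
  have mE1: "measure lebesgue E1 = measure lebesgue (E \<inter> (\<Union>(u, v)\<in>P. {u..v}))"
  proof (rule measure_negligible_symdiff)
    show "E \<inter> (\<Union>(u, v)\<in>P. {u..v}) \<in> lmeasurable"
      using E P(1) by (auto intro!: fmeasurable_Int_fmeasurable sets.finite_UN)
    have "(E \<inter> (\<Union>(u, v)\<in>P. {u..v})) - E1 \<union> (E1 - (E \<inter> (\<Union>(u, v)\<in>P. {u..v}))) \<subseteq> fst ` P \<union> snd ` P"
    proof
      fix x assume "x \<in> (E \<inter> (\<Union>(u, v)\<in>P. {u..v})) - E1 \<union> (E1 - (E \<inter> (\<Union>(u, v)\<in>P. {u..v})))"
      moreover have "E1 - (E \<inter> (\<Union>(u, v)\<in>P. {u..v})) = {}"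
        using VW by (auto simp: E1_def)
      ultimately obtain u v where uv: "(u, v) \<in> P" "x \<in> {u..v}" "x \<in> E" "x \<notin> V"
        by (auto simp: E1_def)
      then have "x \<notin> {u<..<v}" by (auto simp: V_def)
      with uv(2) have "x = u \<or> x = v" by auto
      then show "x \<in> fst ` P \<union> snd ` P" using uv(1) by force
    qed
    then show "negligible ((E \<inter> (\<Union>(u, v)\<in>P. {u..v})) - E1 \<union> (E1 - (E \<inter> (\<Union>(u, v)\<in>P. {u..v}))))"
      using P(1) by (intro negligible_finite) (auto intro: finite_subset)
  qed
  define R where "R u v \<longleftrightarrow> (a \<le> u \<and> v \<le> b \<and> f v - f u \<le> p * (v - u)) \<and> (\<exists>(s, t)\<in>P. s < u \<and> v < t)" for u v
  have R: "fine_at R x" if xE1: "x \<in> E1" for x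
    unfolding fine_at_def
  proof (intro allI impI)
    fix d :: real assume "0 < d"
    obtain s t where st: "(s, t) \<in> P" "s < x" "x < t"
      using xE1 by (auto simp: E1_def V_def)
    have "0 < min d (min (x - s) (t - x))" using st \<open>0 < d\<close> by simp
    then obtain u v where "u < x" "x < v" "v - u < min d (min (x - s) (t - x))"
      "a \<le> u" "v \<le> b" "f v - f u \<le> p * (v - u)"
      using down[of x] xE1 unfolding fine_at_def E1_def by blast
    then show "\<exists>u v. u < x \<and> x < v \<and> v - u < d \<and> R u v"
      using st by (intro exI[of _ u] exI[of _ v]) (auto simp: R_def intro!: bexI[of _ "(s, t)"])
  qed
  have "E1 \<subseteq> V" by (simp add: E1_def)
  obtain Q where Q: "finite Q" "\<And>u v. (u, v) \<in> Q \<Longrightarrow> u < v \<and> R u v \<and> {u..v} \<subseteq> V"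
    "pairwise (\<lambda>p q. {fst p..snd p} \<inter> {fst q..snd q} = {}) Q"
    "measure lebesgue E1 - \<epsilon> < measure lebesgue (E1 \<inter> (\<Union>(u, v)\<in>Q. {u..v}))"
    using Vitali_finite_intervals[OF E1 V \<open>E1 \<subseteq> V\<close> R \<epsilon>] by blast
  \<comment> \<open>\<open>S\<close> lies between \<open>m - \<epsilon>\<close> and
    \<open>m + \<epsilon>\<close>, and \<open>T\<close> exceeds \<open>m - 2 * \<epsilon>\<close>
    because each of the two coverings loses less than \<open>\<epsilon>\<close>. Hence the bound
    \<open>3 * \<epsilon>\<close> on the gaps.\<close>
  define S T where "S = (\<Sum>(u, v)\<in>P. v - u)" and "T = (\<Sum>(u, v)\<in>Q. v - u)"
  have mP: "measure lebesgue (\<Union>(u, v)\<in>P. {u..v}) = S"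
    unfolding S_def using P P' by (intro measure_Union_intervals) auto
  have mQ: "measure lebesgue (\<Union>(u, v)\<in>Q. {u..v}) = T"
    unfolding T_def using Q by (intro measure_Union_intervals) (auto dest!: Q(2))
  have lm: "(\<Union>(u, v)\<in>X. {u..v}) \<in> lmeasurable" if "finite X" for X :: "(real \<times> real) set"
    using that by (intro fmeasurable.finite_UN) (auto simp: split_beta)
  have "S \<le> measure lebesgue U"
    unfolding mP[symmetric] using U3 lm[OF P(1)] P(2) by (intro measure_mono_fmeasurable) auto
  then have S1: "S < m + \<epsilon>" using U4 by simp
  have "measure lebesgue (E \<inter> (\<Union>(u, v)\<in>P. {u..v})) \<le> S"
    unfolding mP[symmetric] using E lm[OF P(1)] by (intro measure_mono_fmeasurable) auto
  then have S2: "m - \<epsilon> < S" using P by simp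
  have "measure lebesgue (E1 \<inter> (\<Union>(u, v)\<in>Q. {u..v})) \<le> T"
    unfolding mQ[symmetric] using E1 lm[OF Q(1)] by (intro measure_mono_fmeasurable) auto
  then have T2: "m - 2 * \<epsilon> < T" using Q(4) mE1 P(4) by simp
  have PP: "pairwise (\<lambda>p q. {fst p<..<snd p} \<inter> {fst q<..<snd q} = {}) P"
    using P(3) by (rule pairwise_disjoint_open)
  have Q': "\<forall>(u, v)\<in>Q. u < v \<and> (\<exists>(s, t)\<in>P. s < u \<and> v < t)"
    using Q(2) by (auto simp: R_def)
  have P'': "\<forall>(u, v)\<in>P. u < v" using P(2) by auto
  from gap_intervals[OF Q(1) P(1) P'' PP Q' Q(3)] obtain \<Gamma> where \<Gamma>: "finite \<Gamma>"
    "\<forall>(u, v)\<in>\<Gamma>. u < v \<and> (\<exists>(s, t)\<in>P. s \<le> u \<and> v \<le> t)"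
    "pairwise (\<lambda>p q. {fst p<..<snd p} \<inter> {fst q<..<snd q} = {}) \<Gamma>"
    and sm: "\<forall>g :: real \<Rightarrow> real. (\<Sum>(u, v)\<in>\<Gamma>. g v - g u) + (\<Sum>(u, v)\<in>Q. g v - g u) = (\<Sum>(u, v)\<in>P. g v - g u)"
    by (elim exE conjE) (rule that)
  \<comment> \<open>The gap identity holds for every \<open>g\<close>: the identity function gives
    the lengths, \<open>f\<close> gives the increments.\<close>
  have "(\<Sum>(u, v)\<in>\<Gamma>. v - u) = S - T"
    using sm[rule_format, of "\<lambda>x. x"] by (simp add: S_def T_def)
  also have "\<dots> < \<delta>" using S1 T2 \<epsilon> \<epsilon>1 by linarith
  finally have "(\<Sum>(u, v)\<in>\<Gamma>. v - u) < \<delta>" .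
  moreover have "\<forall>(u, v)\<in>\<Gamma>. a \<le> u \<and> u \<le> v \<and> v \<le> b"
    using \<Gamma>(2) P(2) by fastforce
  ultimately have "(\<Sum>(u, v)\<in>\<Gamma>. \<bar>f v - f u\<bar>) < \<eta>"
    using \<Gamma> \<delta> by blast
  moreover have "(\<Sum>(u, v)\<in>\<Gamma>. f v - f u) \<le> (\<Sum>(u, v)\<in>\<Gamma>. \<bar>f v - f u\<bar>)"
    by (intro sum_mono) auto
  moreover have "q * S \<le> (\<Sum>(u, v)\<in>P. f v - f u)"
    unfolding S_def sum_distrib_left using P(2) by (intro sum_mono) auto
  moreover have "(\<Sum>(u, v)\<in>Q. f v - f u) \<le> p * T"
    unfolding T_def sum_distrib_left using Q(2) by (intro sum_mono) (auto simp: R_def)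
  ultimately have "q * S < p * T + \<eta>"
    using sm[rule_format, of f] by linarith
  then have "(q - p) * S < p * (T - S) + \<eta>" by (simp add: algebra_simps)
  moreover have "p * (T - S) \<le> \<bar>p\<bar> * (3 * \<epsilon>)"
  proof -
    have "T \<le> S"
    proof -
      have "0 \<le> (\<Sum>(u, v)\<in>\<Gamma>. v - u)" using \<Gamma>(2) by (intro sum_nonneg) auto
      then show ?thesis using sm[rule_format, of "\<lambda>x. x"] by (simp add: S_def T_def)
    qed
    then have "\<bar>T - S\<bar> \<le> 3 * \<epsilon>" using S1 T2 by simp
    then have "\<bar>p\<bar> * \<bar>T - S\<bar> \<le> \<bar>p\<bar> * (3 * \<epsilon>)" by (intro mult_left_mono) auto
    then show ?thesis using abs_ge_self[of "p * (T - S)"] by (simp add: abs_mult)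
  qed
  moreover have "(q - p) * (m - \<epsilon>) \<le> (q - p) * S"
    using S2 \<open>p < q\<close> by (intro mult_left_mono) auto
  moreover have "(q - p) * (m - \<epsilon>) = (q - p) * m - \<epsilon> * (q - p)" "\<bar>p\<bar> * (3 * \<epsilon>) = 3 * \<bar>p\<bar> * \<epsilon>"
    by (simp_all add: algebra_simps)
  ultimately show False
    using \<epsilon>2 unfolding \<eta>_def by linarith
qed

text \<open>
  On an interval shorter than the \<open>\<delta>\<close> that belongs to \<open>\<epsilon> = 1\<close>, disjoint intervals of slope at least
  \<open>k\<close> have total length at most \<open>1 / k\<close>.
\<close>

lemma Vitali_unbounded_slopes:
  fixes f :: "real \<Rightarrow> real"
  assumes AC: "AC_on a b f" and E: "E \<in> lmeasurable" and Eab: "E \<subseteq> {a..b}"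
    and up: "\<And>x k. x \<in> E \<Longrightarrow> fine_at (\<lambda>u v. a \<le> u \<and> v \<le> b \<and> real k * (v - u) \<le> f v - f u) x"
  shows "negligible E"
proof -
  obtain \<delta> where "0 < \<delta>" and \<delta>: "\<And>P::(real \<times> real) set. \<lbrakk>finite P; \<forall>(u, v)\<in>P. a \<le> u \<and> u \<le> v \<and> v \<le> b;
      pairwise (\<lambda>p q. {fst p<..<snd p} \<inter> {fst q<..<snd q} = {}) P; (\<Sum>(u, v)\<in>P. v - u) < \<delta>\<rbrakk>
      \<Longrightarrow> (\<Sum>(u, v)\<in>P. \<bar>f v - f u\<bar>) < 1"
    by (rule AC_onE[OF AC zero_less_one]) (rule that)
  \<comment> \<open>Open windows of length \<open>3 * \<delta> / 4\<close> whose left ends are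
    \<open>\<delta> / 2\<close> apart: together they cover everything to the right of
    \<open>a\<close>, and disjoint intervals inside one window are short enough in total for
    absolute continuity.\<close>
  define I where "I n = {a + real n * (\<delta>/2) - \<delta>/8<..<a + (real n + 1) * (\<delta>/2) + \<delta>/8}" for n
  have "negligible (E \<inter> I n)" for n
  proof (rule ccontr)
    define m where "m = measure lebesgue (E \<inter> I n)"
    have En: "E \<inter> I n \<in> lmeasurable"
      using E by (auto simp: I_def intro!: fmeasurable_Int_fmeasurable)
    assume "\<not> negligible (E \<inter> I n)"
    then have m: "0 < m"
      using En by (auto simp: m_def negligible_iff_measure0 zero_less_measure_iff measure_nonneg order.not_eq_order_implies_strict)
    \<comment> \<open>The intervals will have total length above \<open>m / 2\<close>, so with slope
      \<open>k\<close> they force increments of at least \<open>1\<close> in total.\<close>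
    obtain k :: nat where k: "2 / m < real k" using reals_Archimedean2 by blast
    obtain P where P: "finite P" "\<And>u v. (u, v) \<in> P \<Longrightarrow> u < v \<and> (a \<le> u \<and> v \<le> b \<and> real k * (v - u) \<le> f v - f u) \<and> {u..v} \<subseteq> I n"
      "pairwise (\<lambda>p q. {fst p..snd p} \<inter> {fst q..snd q} = {}) P"
      "m - m/2 < measure lebesgue (E \<inter> I n \<inter> (\<Union>(u, v)\<in>P. {u..v}))"
    proof (rule Vitali_finite_intervals[OF En, of "I n" "\<lambda>u v. a \<le> u \<and> v \<le> b \<and> real k * (v - u) \<le> f v - f u" "m/2"])
      show "open (I n)" by (simp add: I_def)
    qed (use m m_def up in auto)
    define S where "S = (\<Sum>(u, v)\<in>P. v - u)"
    have mP: "measure lebesgue (\<Union>(u, v)\<in>P. {u..v}) = S"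
      unfolding S_def using P by (intro measure_Union_intervals) (auto simp: less_imp_le)
    have lm: "(\<Union>(u, v)\<in>P. {u..v}) \<in> lmeasurable"
      using P(1) by (intro fmeasurable.finite_UN) (auto simp: split_beta)
    have "S \<le> measure lebesgue (I n)"
      unfolding mP[symmetric] using lm P(2) by (intro measure_mono_fmeasurable) (auto simp: I_def)
    also have "\<dots> < \<delta>" using \<open>0 < \<delta>\<close> by (simp add: I_def field_simps)
    finally have "S < \<delta>" .
    have "measure lebesgue (E \<inter> I n \<inter> (\<Union>(u, v)\<in>P. {u..v})) \<le> S"
      unfolding mP[symmetric] using En lm by (intro measure_mono_fmeasurable) auto
    then have S2: "m / 2 < S" using P by simp
    have PP: "pairwise (\<lambda>p q. {fst p<..<snd p} \<inter> {fst q<..<snd q} = {}) P"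
      using P(3) by (rule pairwise_disjoint_open)
    have "(\<Sum>(u, v)\<in>P. \<bar>f v - f u\<bar>) < 1"
      using \<delta>[OF P(1) _ PP] P(2) \<open>S < \<delta>\<close> by (fastforce simp: S_def)
    moreover have "real k * S \<le> (\<Sum>(u, v)\<in>P. \<bar>f v - f u\<bar>)"
      unfolding S_def sum_distrib_left 
    proof (intro sum_mono)
      fix p assume "p \<in> P"
      then show "real k * (case p of (u, v) \<Rightarrow> v - u) \<le> (case p of (u, v) \<Rightarrow> \<bar>f v - f u\<bar>)"
        using P(2)[of "fst p" "snd p"] by (auto simp: split_beta)
    qed
    moreover have "2 / m * (m / 2) \<le> real k * S"
      using k S2 m by (intro mult_mono) auto
    ultimately show False using m by simp
  qed
  then have "negligible (\<Union>n. E \<inter> I n)"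
    by (intro negligible_countable_Union) auto
  moreover have "E \<subseteq> (\<Union>n. E \<inter> I n)"
  proof
    fix x assume x: "x \<in> E"
    define n where "n = nat \<lfloor>(x - a) / (\<delta>/2)\<rfloor>"
    have "0 \<le> (x - a) / (\<delta>/2)" using x Eab \<open>0 < \<delta>\<close> by auto
    then have "real n \<le> (x - a) / (\<delta>/2)" "(x - a) / (\<delta>/2) < real n + 1"
      unfolding n_def by linarith+
    then have "x \<in> I n" using \<open>0 < \<delta>\<close> by (simp add: I_def field_simps)
    then show "x \<in> (\<Union>n. E \<inter> I n)" using x by blast
  qed
  ultimately show ?thesis by (rule negligible_subset)
qed

section \<open>Elementary properties of absolutely continuous functions\<close>

lemma AC_on_Lipschitz:
  assumes "\<And>u v. \<lbrakk>a \<le> u; u \<le> v; v \<le> b\<rbrakk> \<Longrightarrow> \<bar>f v - f u\<bar> \<le> B * (v - u)"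
  shows "AC_on a b f"
  unfolding AC_on_def
proof (intro allI impI)
  fix \<epsilon> :: real assume "0 < \<epsilon>"
  show "\<exists>\<delta>>0. \<forall>P::(real \<times> real) set.
        finite P \<longrightarrow>
        (\<forall>(u, v)\<in>P. a \<le> u \<and> u \<le> v \<and> v \<le> b) \<longrightarrow>
        pairwise (\<lambda>p q. {fst p<..<snd p} \<inter> {fst q<..<snd q} = {}) P \<longrightarrow>
        (\<Sum>(u, v)\<in>P. v - u) < \<delta> \<longrightarrow>
        (\<Sum>(u, v)\<in>P. \<bar>f v - f u\<bar>) < \<epsilon>"
  proof (intro exI[of _ "\<epsilon> / (\<bar>B\<bar> + 1)"] conjI allI impI)
    show "0 < \<epsilon> / (\<bar>B\<bar> + 1)" using \<open>0 < \<epsilon>\<close> by auto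
    fix P :: "(real \<times> real) set"
    assume P: "\<forall>(u, v)\<in>P. a \<le> u \<and> u \<le> v \<and> v \<le> b"
      and lt: "(\<Sum>(u, v)\<in>P. v - u) < \<epsilon> / (\<bar>B\<bar> + 1)"
    have "(\<Sum>(u, v)\<in>P. \<bar>f v - f u\<bar>) \<le> (\<Sum>(u, v)\<in>P. (\<bar>B\<bar> + 1) * (v - u))"
    proof (intro sum_mono)
      fix p assume "p \<in> P"
      then have p: "a \<le> fst p" "fst p \<le> snd p" "snd p \<le> b" using P by auto
      have "\<bar>f (snd p) - f (fst p)\<bar> \<le> B * (snd p - fst p)" using assms p by blast
      also have "\<dots> \<le> (\<bar>B\<bar> + 1) * (snd p - fst p)"
        using p by (intro mult_right_mono) auto
      finally show "(case p of (u, v) \<Rightarrow> \<bar>f v - f u\<bar>) \<le> (case p of (u, v) \<Rightarrow> (\<bar>B\<bar> + 1) * (v - u))"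
        by (simp add: split_beta)
    qed
    also have "\<dots> = (\<bar>B\<bar> + 1) * (\<Sum>(u, v)\<in>P. v - u)"
      by (simp add: sum_distrib_left split_beta)
    also have "\<dots> < (\<bar>B\<bar> + 1) * (\<epsilon> / (\<bar>B\<bar> + 1))"
      using lt by (intro mult_strict_left_mono) auto
    finally show "(\<Sum>(u, v)\<in>P. \<bar>f v - f u\<bar>) < \<epsilon>" by simp
  qed
qed

lemma AC_on_lincomb:
  assumes "AC_on a b f" "AC_on a b g"
  shows "AC_on a b (\<lambda>x. c * f x + d * g x)"
  unfolding AC_on_def
proof (intro allI impI)
  fix \<epsilon> :: real assume "0 < \<epsilon>"
  define \<eta> where "\<eta> = \<epsilon> / (\<bar>c\<bar> + \<bar>d\<bar> + 1)"
  have D: "0 < \<bar>c\<bar> + \<bar>d\<bar> + 1" by linarith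
  then have "0 < \<eta>" using \<open>0 < \<epsilon>\<close> by (simp add: \<eta>_def)
  obtain \<delta>1 where "0 < \<delta>1" and \<delta>1: "\<And>P::(real \<times> real) set. \<lbrakk>finite P; \<forall>(u, v)\<in>P. a \<le> u \<and> u \<le> v \<and> v \<le> b;
      pairwise (\<lambda>p q. {fst p<..<snd p} \<inter> {fst q<..<snd q} = {}) P; (\<Sum>(u, v)\<in>P. v - u) < \<delta>1\<rbrakk>
      \<Longrightarrow> (\<Sum>(u, v)\<in>P. \<bar>f v - f u\<bar>) < \<eta>"
    by (rule AC_onE[OF assms(1) \<open>0 < \<eta>\<close>]) (rule that)
  obtain \<delta>2 where "0 < \<delta>2" and \<delta>2: "\<And>P::(real \<times> real) set. \<lbrakk>finite P; \<forall>(u, v)\<in>P. a \<le> u \<and> u \<le> v \<and> v \<le> b;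
      pairwise (\<lambda>p q. {fst p<..<snd p} \<inter> {fst q<..<snd q} = {}) P; (\<Sum>(u, v)\<in>P. v - u) < \<delta>2\<rbrakk>
      \<Longrightarrow> (\<Sum>(u, v)\<in>P. \<bar>g v - g u\<bar>) < \<eta>"
    by (rule AC_onE[OF assms(2) \<open>0 < \<eta>\<close>]) (rule that)
  show "\<exists>\<delta>>0. \<forall>P::(real \<times> real) set.
        finite P \<longrightarrow>
        (\<forall>(u, v)\<in>P. a \<le> u \<and> u \<le> v \<and> v \<le> b) \<longrightarrow>
        pairwise (\<lambda>p q. {fst p<..<snd p} \<inter> {fst q<..<snd q} = {}) P \<longrightarrow>
        (\<Sum>(u, v)\<in>P. v - u) < \<delta> \<longrightarrow>
        (\<Sum>(u, v)\<in>P. \<bar>c * f v + d * g v - (c * f u + d * g u)\<bar>) < \<epsilon>"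
  proof (intro exI[of _ "min \<delta>1 \<delta>2"] conjI allI impI)
    show "0 < min \<delta>1 \<delta>2" using \<open>0 < \<delta>1\<close> \<open>0 < \<delta>2\<close> by auto
    fix P :: "(real \<times> real) set"
    assume P: "finite P" "\<forall>(u, v)\<in>P. a \<le> u \<and> u \<le> v \<and> v \<le> b"
      "pairwise (\<lambda>p q. {fst p<..<snd p} \<inter> {fst q<..<snd q} = {}) P"
      and lt: "(\<Sum>(u, v)\<in>P. v - u) < min \<delta>1 \<delta>2"
    define F G where "F = (\<Sum>(u, v)\<in>P. \<bar>f v - f u\<bar>)" and "G = (\<Sum>(u, v)\<in>P. \<bar>g v - g u\<bar>)"
    have FG: "F < \<eta>" "G < \<eta>"
      using \<delta>1[OF P] \<delta>2[OF P] lt by (simp_all add: F_def G_def)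
    have "(\<Sum>(u, v)\<in>P. \<bar>c * f v + d * g v - (c * f u + d * g u)\<bar>)
        \<le> (\<Sum>(u, v)\<in>P. \<bar>c\<bar> * \<bar>f v - f u\<bar> + \<bar>d\<bar> * \<bar>g v - g u\<bar>)"
    proof (intro sum_mono, clarify)
      fix u v
      have "c * f v + d * g v - (c * f u + d * g u) = c * (f v - f u) + d * (g v - g u)"
        by (simp add: algebra_simps)
      then show "\<bar>c * f v + d * g v - (c * f u + d * g u)\<bar> \<le> \<bar>c\<bar> * \<bar>f v - f u\<bar> + \<bar>d\<bar> * \<bar>g v - g u\<bar>"
        by (metis abs_mult abs_triangle_ineq)
    qed
    also have "\<dots> = \<bar>c\<bar> * F + \<bar>d\<bar> * G"
      by (simp add: F_def G_def sum_distrib_left split_beta sum.distrib)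
    also have "\<dots> \<le> \<bar>c\<bar> * \<eta> + \<bar>d\<bar> * \<eta>"
      using FG by (intro add_mono mult_left_mono) auto
    also have "\<dots> < (\<bar>c\<bar> + \<bar>d\<bar> + 1) * \<eta>"
      using \<open>0 < \<eta>\<close> by (simp add: algebra_simps)
    also have "\<dots> = \<epsilon>" using D by (simp add: \<eta>_def)
    finally show "(\<Sum>(u, v)\<in>P. \<bar>c * f v + d * g v - (c * f u + d * g u)\<bar>) < \<epsilon>" .
  qed
qed

lemma AC_on_imp_continuous_on:
  assumes "AC_on a b f"
  shows "continuous_on {a..b} f"
  unfolding continuous_on_iff
proof (intro ballI allI impI)
  fix x e :: real assume x: "x \<in> {a..b}" and "0 < e"
  obtain \<delta> where "0 < \<delta>" and \<delta>: "\<And>P::(real \<times> real) set. \<lbrakk>finite P; \<forall>(u, v)\<in>P. a \<le> u \<and> u \<le> v \<and> v \<le> b;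
      pairwise (\<lambda>p q. {fst p<..<snd p} \<inter> {fst q<..<snd q} = {}) P; (\<Sum>(u, v)\<in>P. v - u) < \<delta>\<rbrakk>
      \<Longrightarrow> (\<Sum>(u, v)\<in>P. \<bar>f v - f u\<bar>) < e"
    by (rule AC_onE[OF assms \<open>0 < e\<close>]) (rule that)
  have "dist (f y) (f x) < e" if "y \<in> {a..b}" "dist y x < \<delta>" for y
  proof (cases "x \<le> y")
    case True
    then show ?thesis
      using \<delta>[of "{(x, y)}"] x that by (simp add: dist_real_def)
  next
    case False
    then show ?thesis
      using \<delta>[of "{(y, x)}"] x that by (simp add: dist_real_def abs_minus_commute)
  qed
  then show "\<exists>d>0. \<forall>x'\<in>{a..b}. dist x' x < d \<longrightarrow> dist (f x') (f x) < e"
    using \<open>0 < \<delta>\<close> by blast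
qed

text \<open>A difference quotient at \<open>x\<close> belongs to an interval that ends at
  \<open>x\<close>, whereas \<open>fine_at\<close> wants \<open>x\<close> inside. By continuity the
  end point may be moved slightly past \<open>x\<close>; the strict inequality in the hypothesis
  leaves room for this.\<close>

lemma fine_at_frequently_slope:
  fixes f :: "real \<Rightarrow> real"
  assumes cont: "continuous_on {a..b} f" and x: "a < x" "x < b"
    and freq: "\<exists>\<^sub>F z in at x. q < (f z - f x) / (z - x)"
  shows "fine_at (\<lambda>u v. a \<le> u \<and> v \<le> b \<and> q * (v - u) \<le> f v - f u) x"
  unfolding fine_at_def
proof (intro allI impI)
  fix d :: real assume "0 < d"
  have isC: "isCont f x"
    using continuous_on_interior[OF cont, of x] x by auto
  have "\<forall>\<^sub>F z in at x. z \<in> {max a (x - d/2)<..<min b (x + d/2)}"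
    using x \<open>0 < d\<close> by (intro eventually_at_in_open') auto
  with freq have "\<exists>\<^sub>F z in at x. q < (f z - f x) / (z - x) \<and> z \<in> {max a (x - d/2)<..<min b (x + d/2)} \<and> z \<noteq> x"
    by (intro frequently_rev_mp[OF freq]) (auto simp: eventually_at_filter elim!: eventually_mono)
  then obtain z where z: "q < (f z - f x) / (z - x)" "a < z" "z < b" "x - d/2 < z" "z < x + d/2" "z \<noteq> x"
    by (auto dest!: frequently_ex)
  show "\<exists>u v. u < x \<and> x < v \<and> v - u < d \<and> a \<le> u \<and> v \<le> b \<and> q * (v - u) \<le> f v - f u"
  proof (cases "x < z")
    case True
    have "((\<lambda>u. f z - f u - q * (z - u)) \<longlongrightarrow> f z - f x - q * (z - x)) (at_left x)"
      using isC by (intro tendsto_intros) (simp add: isCont_def filterlim_at_split)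
    moreover have "0 < f z - f x - q * (z - x)" using z True by (simp add: field_simps)
    ultimately have "\<forall>\<^sub>F u in at_left x. 0 < f z - f u - q * (z - u)"
      by (rule order_tendstoD)
    moreover have "\<forall>\<^sub>F u in at_left x. u \<in> {max a (x - d/2)<..<x}"
      using x \<open>0 < d\<close> by (intro eventually_at_leftI[of "max a (x - d/2)"]) auto
    ultimately have "\<forall>\<^sub>F u in at_left x. 0 < f z - f u - q * (z - u) \<and> u \<in> {max a (x - d/2)<..<x}"
      by (rule eventually_conj)
    then obtain u where "0 < f z - f u - q * (z - u)" "u \<in> {max a (x - d/2)<..<x}"
      by (auto dest!: eventually_happens)
    then show ?thesis
      using z True by (intro exI[of _ u] exI[of _ z]) auto
  next
    case False
    then have "z < x" using z by simp
    have "((\<lambda>v. f v - f z - q * (v - z)) \<longlongrightarrow> f x - f z - q * (x - z)) (at_right x)"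
      using isC by (intro tendsto_intros) (simp add: isCont_def filterlim_at_split)
    moreover have "0 < f x - f z - q * (x - z)" using z \<open>z < x\<close> by (simp add: field_simps)
    ultimately have "\<forall>\<^sub>F v in at_right x. 0 < f v - f z - q * (v - z)"
      by (rule order_tendstoD)
    moreover have "\<forall>\<^sub>F v in at_right x. v \<in> {x<..<min b (x + d/2)}"
      using x \<open>0 < d\<close> by (intro eventually_at_rightI[of _ "min b (x + d/2)"]) auto
    ultimately have "\<forall>\<^sub>F v in at_right x. 0 < f v - f z - q * (v - z) \<and> v \<in> {x<..<min b (x + d/2)}"
      by (rule eventually_conj)
    then obtain v where "0 < f v - f z - q * (v - z)" "v \<in> {x<..<min b (x + d/2)}"
      by (auto dest!: eventually_happens)
    then show ?thesis
      using z \<open>z < x\<close> by (intro exI[of _ z] exI[of _ v]) auto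
  qed
qed

text \<open>Where the derivative does not exist, the difference quotients are unbounded above or
  below, or two rational numbers separate their lower and upper limits. There are only countably
  many such pairs, and each case falls under one of the two Vitali lemmas.\<close>

theorem AC_on_differentiable_ae:
  fixes f :: "real \<Rightarrow> real"
  assumes AC: "AC_on a b f"
  shows "\<exists>N. negligible N \<and> (\<forall>x\<in>{a<..<b} - N. f differentiable at x)"
proof -
  \<comment> \<open>Passing to \<open>- f\<close> turns slopes at most \<open>p\<close> into slopes
    at least \<open>- p\<close>, so that the single predicate \<open>up\<close> covers both
    directions.\<close>
  define g where "g = (\<lambda>x. - f x)"
  have ACg: "AC_on a b g" using AC_on_lincomb[OF AC AC, of "-1" 0] by (simp add: g_def)
  define up where "up h q x \<longleftrightarrow> fine_at (\<lambda>u v. a \<le> u \<and> v \<le> b \<and> q * (v - u) \<le> h v - h u) x"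
    for h :: "real \<Rightarrow> real" and q x
  have meas: "{x. up h q x} \<in> sets borel" for h q
    unfolding up_def by (rule borel_fine_at)
  have sub: "x \<in> {a<..<b}" if "up h q x" for h q x
    using that unfolding up_def fine_at_def by (force dest: spec[of _ 1])
  define B where "B h = {x. \<forall>k::nat. up h (real k) x}" for h :: "real \<Rightarrow> real"
  define Op where "Op p q = {x. up f q x \<and> up g (- p) x}" for p q
  have lm: "X \<in> lmeasurable" if "X \<in> sets borel" "X \<subseteq> {a<..<b}" for X
  proof (rule bounded_set_imp_lmeasurable)
    show "bounded X" using bounded_subset[OF bounded_box, of X a b] that(2) by (simp add: box_real)
    show "X \<in> sets lebesgue" using that(1) by auto
  qed
  have Bsub: "B h \<subseteq> {a<..<b}" for h
    using sub[of h "real 0"] unfolding B_def by blast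
  have neg: "negligible (B h)" if "AC_on a b h" for h
  proof (rule Vitali_unbounded_slopes[OF that])
    have "B h = (\<Inter>k. {x. up h (real k) x})" by (auto simp: B_def)
    also have "\<dots> \<in> sets borel" by (intro sets.countable_INT') (auto intro: meas)
    finally show "B h \<in> lmeasurable" using Bsub by (rule lm)
    show "B h \<subseteq> {a..b}" using Bsub[of h] by auto
  qed (auto simp: B_def up_def)
  have negO: "negligible (Op p q)" if "p < q" for p q
  proof (rule Vitali_opposite_slopes[OF AC that])
    have "Op p q = {x. up f q x} \<inter> {x. up g (- p) x}" by (auto simp: Op_def)
    then show "Op p q \<in> lmeasurable" using sub meas by (intro lm) (auto simp: Op_def)
    show "fine_at (\<lambda>u v. a \<le> u \<and> v \<le> b \<and> q * (v - u) \<le> f v - f u) x" if "x \<in> Op p q" for x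
      using that by (simp add: Op_def up_def)
    show "fine_at (\<lambda>u v. a \<le> u \<and> v \<le> b \<and> f v - f u \<le> p * (v - u)) x" if "x \<in> Op p q" for x
    proof -
      have "- p * (v - u) \<le> g v - g u \<longleftrightarrow> f v - f u \<le> p * (v - u)" for u v
        by (auto simp: g_def algebra_simps)
      then show ?thesis using that by (simp only: Op_def up_def mem_Collect_eq)
    qed
  qed
  define N where "N = B f \<union> B g \<union> (\<Union>(p, q)\<in>{(p, q). p < q}. Op (real_of_rat p) (real_of_rat q))"
  have "negligible (\<Union>(p, q)\<in>{(p, q). p < q}. Op (real_of_rat p) (real_of_rat q))"
    by (rule negligible_countable_Union) (auto simp: of_rat_less intro!: negO)
  then have "negligible N"
    unfolding N_def using neg[OF AC] neg[OF ACg] by (intro negligible_Un)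
  moreover have "f differentiable at x" if x: "x \<in> {a<..<b} - N" for x
  proof -
    have x': "a < x" "x < b" using x by auto
    define s where "s z = (f z - f x) / (z - x)" for z
    have upf: "up f q x" if "\<exists>\<^sub>F z in at x. q < s z" for q
      unfolding up_def using that unfolding s_def
      by (rule fine_at_frequently_slope[OF AC_on_imp_continuous_on[OF AC] x'])
    have upg: "up g (- p) x" if "\<exists>\<^sub>F z in at x. s z < p" for p
      unfolding up_def
    proof (rule fine_at_frequently_slope[OF AC_on_imp_continuous_on[OF ACg] x'])
      have "(g z - g x) / (z - x) = - s z" for z
        by (simp add: g_def s_def minus_divide_left[symmetric] del: minus_diff_eq) (simp add: minus_divide_left)
      then show "\<exists>\<^sub>F z in at x. - p < (g z - g x) / (z - x)" using that by simp
    qed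
    let ?l = "Liminf (at x) (\<lambda>z. ereal (s z))" and ?L = "Limsup (at x) (\<lambda>z. ereal (s z))"
    have "?L \<le> ?l"
    proof (rule ccontr)
      assume "\<not> ?L \<le> ?l"
      then obtain q where q: "?l < ereal (real_of_rat q)" "ereal (real_of_rat q) < ?L"
        using ereal_dense3[of ?l ?L] by (meson not_le)
      then obtain p where p: "?l < ereal (real_of_rat p)" "ereal (real_of_rat p) < ereal (real_of_rat q)"
        using ereal_dense3[OF q(1)] by blast
      have "\<exists>\<^sub>F z in at x. real_of_rat q < s z"
      proof (rule ccontr)
        assume "\<not> (\<exists>\<^sub>F z in at x. real_of_rat q < s z)"
        then have "\<forall>\<^sub>F z in at x. ereal (s z) \<le> ereal (real_of_rat q)" by (simp add: not_frequently not_less)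
        then have "?L \<le> ereal (real_of_rat q)" by (rule Limsup_bounded)
        then show False using q by simp
      qed
      moreover have "\<exists>\<^sub>F z in at x. s z < real_of_rat p"
      proof (rule ccontr)
        assume "\<not> (\<exists>\<^sub>F z in at x. s z < real_of_rat p)"
        then have "\<forall>\<^sub>F z in at x. ereal (real_of_rat p) \<le> ereal (s z)" by (simp add: not_frequently not_less)
        then have "ereal (real_of_rat p) \<le> ?l" by (rule Liminf_bounded)
        then show False using p by simp
      qed
      ultimately have "x \<in> Op (real_of_rat p) (real_of_rat q)"
        using upf upg by (auto simp: Op_def)
      moreover have "p < q" using p by (simp add: of_rat_less)
      ultimately show False using x by (auto simp: N_def)
    qed
    then have eq: "?l = ?L" by (intro antisym Liminf_le_Limsup) auto
    \<comment> \<open>Lying outside \<open>B f\<close> and \<open>B g\<close> excludes infinite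
      values for the common limit.\<close>
    obtain k where "\<not> up f (real k) x" using x by (auto simp: N_def B_def)
    then have "\<forall>\<^sub>F z in at x. ereal (s z) \<le> ereal (real k)"
      using upf[of "real k"] unfolding frequently_def by (auto simp: not_less)
    then have L: "?L \<le> ereal (real k)" by (rule Limsup_bounded)
    obtain k' where "\<not> up g (real k') x" using x by (auto simp: N_def B_def)
    then have "\<forall>\<^sub>F z in at x. ereal (- real k') \<le> ereal (s z)"
      using upg[of "- real k'"] unfolding frequently_def by (auto simp: not_less)
    then have l: "ereal (- real k') \<le> ?l" by (rule Liminf_bounded)
    obtain r where "?L = ereal r" using L l eq by (cases ?L) auto
    then have "((\<lambda>z. ereal (s z)) \<longlongrightarrow> ereal r) (at x)"
      using eq by (subst tendsto_iff_Liminf_eq_Limsup) auto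
    then have "(s \<longlongrightarrow> r) (at x)" by simp
    then have "(f has_field_derivative r) (at x)"
      unfolding s_def[abs_def] by (simp add: has_field_derivative_iff)
    then show ?thesis using real_differentiable_def by blast
  qed
  ultimately show ?thesis by blast
qed

section \<open>Fractional integrals\<close>

lemma integrable_power_kernel:
  fixes \<mu> d :: real
  assumes "0 < \<mu>"
  shows "integrable lborel (\<lambda>s. indicator {0..d} s * s powr (\<mu> - 1))"
proof (cases "0 \<le> d")
  case True
  have "(\<lambda>s. s powr (\<mu> - 1)) integrable_on {0..d}"
    using has_integral_powr_from_0[of "\<mu> - 1" d] assms True by (auto simp: integrable_on_def)
  then have "set_integrable lebesgue {0..d} (\<lambda>s. s powr (\<mu> - 1))"
    by (intro nonnegative_absolutely_integrable_1) auto
  then show ?thesis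
    unfolding set_integrable_def by (subst (asm) integrable_completion) auto
qed simp

lemma bounded_on_interval:
  fixes f :: "real \<Rightarrow> 'a::real_normed_vector"
  assumes "continuous_on {a..b} f"
  obtains B where "0 < B" "\<And>x. x \<in> {a..b} \<Longrightarrow> norm (f x) \<le> B"
  using compact_imp_bounded[OF compact_continuous_image[OF assms compact_Icc]]
  unfolding bounded_pos by auto

lemma integrable_kernel_times:
  fixes F :: "real \<Rightarrow> real"
  assumes F: "continuous_on UNIV F" and "0 < \<mu>"
  shows "integrable lborel (\<lambda>s. indicator {0..d} s * s powr (\<mu> - 1) * F (x - s))"
proof -
  have [measurable]: "F \<in> borel_measurable borel" using F by (rule borel_measurable_continuous_onI)
  obtain B where B: "0 < B" "\<And>t. t \<in> {x - d..x} \<Longrightarrow> norm (F t) \<le> B"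
    using bounded_on_interval continuous_on_subset[OF F subset_UNIV] by metis
  show ?thesis
  proof (rule Bochner_Integration.integrable_bound)
    show "integrable lborel (\<lambda>s. (indicator {0..d} s * s powr (\<mu> - 1)) * B)"
      by (intro integrable_mult_left integrable_power_kernel[OF \<open>0 < \<mu>\<close>])
    show "AE s in lborel. norm (indicator {0..d} s * s powr (\<mu> - 1) * F (x - s))
        \<le> norm (indicator {0..d} s * s powr (\<mu> - 1) * B)"
    proof (rule AE_I2)
      fix s :: real
      show "norm (indicator {0..d} s * s powr (\<mu> - 1) * F (x - s))
        \<le> norm (indicator {0..d} s * s powr (\<mu> - 1) * B)"
        using B(2)[of "x - s"] B(1)
        by (auto simp: indicator_def abs_mult intro!: mult_left_mono)
    qed
  qed simp
qed

lemma integrable_kernel_left: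
  fixes F :: "real \<Rightarrow> real"
  assumes F: "continuous_on UNIV F" and "0 < \<mu>"
  shows "integrable lborel (\<lambda>t. indicator {a..x} t * ((x - t) powr (\<mu> - 1) * F t))"
proof -
  have "integrable lborel (\<lambda>s. indicator {a..x} (x + (-1) * s) * ((x - (x + (-1) * s)) powr (\<mu> - 1) * F (x + (-1) * s)))"
  proof -
    have "indicator {a..x} (x - s) = (indicator {0..x-a} s :: real)" for s
      by (auto simp: indicator_def)
    then show ?thesis
      using integrable_kernel_times[OF assms, of "x - a" x] by (simp add: mult.assoc)
  qed
  then show ?thesis
    by (subst (asm) lborel_integrable_real_affine_iff[where f = "\<lambda>t. indicator {a..x} t * ((x - t) powr (\<mu> - 1) * F t)"]) auto
qed

lemma frac_int_left_exists_continuous_UNIV: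
  assumes F: "continuous_on UNIV F" and "0 < \<mu>"
  shows "frac_int_left_exists a \<mu> F x"
proof -
  have [measurable]: "F \<in> borel_measurable borel" using F by (rule borel_measurable_continuous_onI)
  show ?thesis
    unfolding frac_int_left_exists_def set_integrable_def
    by (subst integrable_completion) (use integrable_kernel_left[OF assms, of a x] in auto)
qed

lemma frac_int_left_lborel:
  assumes F: "continuous_on UNIV F"
  shows "frac_int_left a \<mu> F x = 1 / Gamma \<mu> * (\<integral>t. indicator {a..x} t * ((x - t) powr (\<mu> - 1) * F t) \<partial>lborel)"
proof -
  have [measurable]: "F \<in> borel_measurable borel" using F by (rule borel_measurable_continuous_onI)
  show ?thesis
    unfolding frac_int_left_def set_lebesgue_integral_def
    by (subst integral_completion) auto
qed

text \<open>The substitution \<open>t = x - s\<close> places the singularity of the kernel at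
  \<open>s = 0\<close> for every \<open>x\<close>, so that a single integrable majorant serves all
  \<open>x\<close> when continuity is proved by dominated convergence.\<close>

lemma frac_int_left_translate:
  assumes F: "continuous_on UNIV F"
  shows "frac_int_left a \<mu> F x = 1 / Gamma \<mu> * (\<integral>s. indicator {0..x - a} s * s powr (\<mu> - 1) * F (x - s) \<partial>lborel)"
proof -
  have "indicator {a..x} (x - s) = (indicator {0..x-a} s :: real)" for s
    by (auto simp: indicator_def)
  then show ?thesis
    unfolding frac_int_left_lborel[OF F]
    by (subst lborel_integral_real_affine[where c = "-1" and t = x]) (simp_all add: mult.assoc)
qed

lemma continuous_on_frac_int_left_UNIV:
  assumes F: "continuous_on UNIV F" and "0 < \<mu>"
  shows "continuous_on {a..b} (frac_int_left a \<mu> F)"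
proof (rule continuous_on_sequentiallyI)
  fix u :: "nat \<Rightarrow> real" and x
  assume u: "\<forall>n. u n \<in> {a..b}" and x: "x \<in> {a..b}" and lim: "u \<longlonglongrightarrow> x"
  have [measurable]: "F \<in> borel_measurable borel" using F by (rule borel_measurable_continuous_onI)
  obtain B where B: "0 < B" "\<And>t. t \<in> {a..b} \<Longrightarrow> norm (F t) \<le> B"
    using bounded_on_interval continuous_on_subset[OF F subset_UNIV] by metis
  have "(\<lambda>n. \<integral>s. indicator {0..u n - a} s * s powr (\<mu> - 1) * F (u n - s) \<partial>lborel)
      \<longlonglongrightarrow> (\<integral>s. indicator {0..x - a} s * s powr (\<mu> - 1) * F (x - s) \<partial>lborel)"
  proof (rule integral_dominated_convergence)
    show "integrable lborel (\<lambda>s. (indicator {0..b - a} s * s powr (\<mu> - 1)) * B)"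
      by (intro integrable_mult_left integrable_power_kernel[OF \<open>0 < \<mu>\<close>])
    show "AE s in lborel. norm (indicator {0..u n - a} s * s powr (\<mu> - 1) * F (u n - s))
        \<le> indicator {0..b - a} s * s powr (\<mu> - 1) * B" for n
    proof (rule AE_I2)
      fix s :: real
      show "norm (indicator {0..u n - a} s * s powr (\<mu> - 1) * F (u n - s))
        \<le> indicator {0..b - a} s * s powr (\<mu> - 1) * B"
      proof (cases "s \<in> {0..u n - a}")
        case True
        moreover have "u n \<in> {a..b}" using u by simp
        ultimately have "u n - s \<in> {a..b}" "s \<in> {0..b - a}" by auto
        then show ?thesis
          using True B(2)[of "u n - s"] by (auto simp: abs_mult intro!: mult_left_mono)
      next
        case False
        then show ?thesis using B(1) by (simp add: indicator_def)
      qed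
    qed
    show "AE s in lborel. (\<lambda>n. indicator {0..u n - a} s * s powr (\<mu> - 1) * F (u n - s))
        \<longlonglongrightarrow> indicator {0..x - a} s * s powr (\<mu> - 1) * F (x - s)"
      \<comment> \<open>At \<open>s = x - a\<close> the indicators may fail to converge; this one
        point is excluded.\<close>
      using AE_lborel_singleton[of "x - a"]
    proof eventually_elim
      case (elim s)
      have "(\<lambda>n. F (u n - s)) \<longlonglongrightarrow> F (x - s)"
        using F lim by (intro isCont_tendsto_compose[of "x - s" F] tendsto_intros)
          (auto simp: continuous_on_eq_continuous_at)
      moreover have "(\<lambda>n. indicator {0..u n - a} s :: real) \<longlonglongrightarrow> indicator {0..x - a} s"
      proof (rule tendsto_eventually)
        have lim': "(\<lambda>n. u n - a) \<longlonglongrightarrow> x - a" using lim by (intro tendsto_intros)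
        show "\<forall>\<^sub>F n in sequentially. indicator {0..u n - a} s = (indicator {0..x - a} s :: real)"
        proof (cases "s < x - a")
          case True
          with order_tendstoD(1)[OF lim' True] show ?thesis
            by (auto elim!: eventually_mono simp: indicator_def)
        next
          case False
          with elim have "x - a < s" by simp
          with order_tendstoD(2)[OF lim' this] show ?thesis
            by (auto elim!: eventually_mono simp: indicator_def)
        qed
      qed
      ultimately show ?case by (intro tendsto_intros)
    qed
  qed measurable
  then show "(\<lambda>n. frac_int_left a \<mu> F (u n)) \<longlonglongrightarrow> frac_int_left a \<mu> F x"
    unfolding frac_int_left_translate[OF F] by (intro tendsto_intros)
qed

text \<open>Continuity on the whole line gives the Borel measurability that dominated convergence
  and Fubini's theorem ask for. With the congruence lemmas below, the extension carries the results
  over to functions that are continuous on \<open>[a,b]\<close> only.\<close>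

lemma continuous_extension:
  fixes f :: "real \<Rightarrow> 'a::topological_space"
  assumes "continuous_on {a..b} f" "a \<le> b"
  obtains F where "continuous_on UNIV F" "\<And>x. x \<in> {a..b} \<Longrightarrow> F x = f x"
proof
  show "continuous_on UNIV (\<lambda>x. f (max a (min b x)))"
    using assms(2) by (intro continuous_on_compose2[OF assms(1)] continuous_intros) auto
qed auto

lemma frac_int_left_cong:
  assumes "\<And>t. t \<in> {a..x} \<Longrightarrow> f t = g t"
  shows "frac_int_left a \<mu> f x = frac_int_left a \<mu> g x"
  unfolding frac_int_left_def using assms
  by (intro arg_cong2[of _ _ _ _ "(*)"] set_lebesgue_integral_cong refl) auto

lemma frac_int_left_exists_cong:
  assumes "\<And>t. t \<in> {a..x} \<Longrightarrow> f t = g t"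
  shows "frac_int_left_exists a \<mu> f x = frac_int_left_exists a \<mu> g x"
  unfolding frac_int_left_exists_def using assms
  by (intro set_integrable_cong refl) auto

lemma frac_int_right_cong:
  assumes "\<And>t. t \<in> {x..b} \<Longrightarrow> f t = g t"
  shows "frac_int_right b \<mu> f x = frac_int_right b \<mu> g x"
  unfolding frac_int_right_def using assms
  by (intro arg_cong2[of _ _ _ _ "(*)"] set_lebesgue_integral_cong refl) auto

text \<open>Reflection at the origin makes existence, continuity and linearity of right integrals
  corollaries of the left case.\<close>

lemma frac_int_right_reflect:
  "frac_int_right b \<mu> f x = frac_int_left (- b) \<mu> (\<lambda>t. f (- t)) (- x)"
proof -
  have *: "(LINT t:{u..v}|lebesgue. g t) = integral\<^sup>L (lebesgue_on {u..v}) g"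
    for u v :: real and g :: "real \<Rightarrow> real"
    unfolding set_lebesgue_integral_def by (subst integral_restrict_space) auto
  have e: "(\<lambda>t. (- x - t) powr (\<mu> - 1) * f (- t)) = (\<lambda>t. (- t - x) powr (\<mu> - 1) * f (- t))"
    by (simp add: minus_diff_commute)
  have "integral\<^sup>L (lebesgue_on {- b..- x}) (\<lambda>t. (- t - x) powr (\<mu> - 1) * f (- t)) =
      integral\<^sup>L (lebesgue_on {x..b}) (\<lambda>t. (t - x) powr (\<mu> - 1) * f t)"
    using integral_reflect_real[of b x "\<lambda>t. (t - x) powr (\<mu> - 1) * f t"] by simp
  then show ?thesis
    unfolding frac_int_right_def frac_int_left_def * e by simp
qed

lemma frac_int_right_exists_reflect:
  "frac_int_right_exists b \<mu> f x \<longleftrightarrow> frac_int_left_exists (- b) \<mu> (\<lambda>t. f (- t)) (- x)"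
proof -
  have e: "(\<lambda>t. (- x - t) powr (\<mu> - 1) * f (- t)) = (\<lambda>t. (- t - x) powr (\<mu> - 1) * f (- t))"
    by (simp add: minus_diff_commute)
  have "(\<lambda>t. (- t - x) powr (\<mu> - 1) * f (- t)) absolutely_integrable_on {- b..- x} \<longleftrightarrow>
      (\<lambda>t. (t - x) powr (\<mu> - 1) * f t) absolutely_integrable_on {x..b}"
    using absolutely_integrable_reflect_real[where f = "\<lambda>t. (t - x) powr (\<mu> - 1) * f t" and a = x and b = b] by simp
  then show ?thesis
    unfolding frac_int_right_exists_def frac_int_left_exists_def e by simp
qed

lemma frac_int_left_exists_continuous:
  assumes f: "continuous_on {a..b} f" and "0 < \<mu>" and x: "x \<in> {a..b}"
  shows "frac_int_left_exists a \<mu> f x"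
proof -
  obtain F where F: "continuous_on UNIV F" "\<And>x. x \<in> {a..b} \<Longrightarrow> F x = f x"
    using continuous_extension[OF f] x by (metis atLeastAtMost_iff order_trans)
  have "frac_int_left_exists a \<mu> F x = frac_int_left_exists a \<mu> f x"
    using x by (intro frac_int_left_exists_cong F) auto
  then show ?thesis using frac_int_left_exists_continuous_UNIV[OF F(1) \<open>0 < \<mu>\<close>] by simp
qed

lemma continuous_on_frac_int_left:
  assumes f: "continuous_on {a..b} f" and "0 < \<mu>" and "a \<le> b"
  shows "continuous_on {a..b} (frac_int_left a \<mu> f)"
proof -
  obtain F where F: "continuous_on UNIV F" "\<And>x. x \<in> {a..b} \<Longrightarrow> F x = f x"
    by (rule continuous_extension[OF f \<open>a \<le> b\<close>]) (rule that)
  have "frac_int_left a \<mu> f x = frac_int_left a \<mu> F x" if "x \<in> {a..b}" for x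
    using that F(2) by (intro frac_int_left_cong) auto
  then show ?thesis
    using continuous_on_frac_int_left_UNIV[OF F(1) \<open>0 < \<mu>\<close>, of a b]
    by (subst continuous_on_cong[OF refl]) auto
qed

lemma continuous_on_reflect:
  assumes "continuous_on {a..b::real} f"
  shows "continuous_on {- b..- a} (\<lambda>t. f (- t))"
  by (rule continuous_on_compose2[OF assms]) (auto intro: continuous_intros)

lemma frac_int_right_exists_continuous:
  assumes f: "continuous_on {a..b} f" and "0 < \<mu>" and x: "x \<in> {a..b}"
  shows "frac_int_right_exists b \<mu> f x"
  unfolding frac_int_right_exists_reflect
  using continuous_on_reflect[OF f] \<open>0 < \<mu>\<close> x by (intro frac_int_left_exists_continuous[of _ "- a"]) auto

lemma continuous_on_frac_int_right:
  assumes f: "continuous_on {a..b} f" and "0 < \<mu>" and "a \<le> b"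
  shows "continuous_on {a..b} (frac_int_right b \<mu> f)"
proof -
  have "continuous_on {- b..- a} (frac_int_left (- b) \<mu> (\<lambda>t. f (- t)))"
    using assms by (intro continuous_on_frac_int_left continuous_on_reflect) auto
  then have "continuous_on {a..b} (\<lambda>x. frac_int_left (- b) \<mu> (\<lambda>t. f (- t)) (- x))"
    by (rule continuous_on_compose2) (auto intro: continuous_intros)
  then show ?thesis
    by (simp add: frac_int_right_reflect[abs_def])
qed

section \<open>Fractional integration by parts\<close>

lemma integral_eq_lborel:
  fixes f :: "real \<Rightarrow> real"
  assumes "continuous_on {a..b} f"
  shows "integral {a..b} f = (\<integral>x. indicator {a..b} x * f x \<partial>lborel)"
    "integrable lborel (\<lambda>x. indicator {a..b} x * f x)"
proof -
  have "set_integrable lborel {a..b} f"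
    using borel_integrable_compact[of "{a..b}" f] assms by (simp add: set_integrable_def indicator_scaleR_eq_if)
  then show "integral {a..b} f = (\<integral>x. indicator {a..b} x * f x \<partial>lborel)"
    "integrable lborel (\<lambda>x. indicator {a..b} x * f x)"
    using set_borel_integral_eq_integral[of "{a..b}" f]
    by (auto simp: set_integrable_def set_lebesgue_integral_def)
qed

text \<open>Up to the factor \<open>1 / Gamma \<mu>\<close>, both sides are the integral of
  \<open>F x * (x - t) powr (\<mu> - 1) * G t\<close> over the triangle
  \<open>a \<le> t \<le> x \<le> b\<close>, taken in the two possible orders.\<close>

lemma frac_int_by_parts_UNIV:
  assumes F: "continuous_on UNIV F" and G: "continuous_on UNIV G" and "0 < \<mu>" and "a \<le> b"
  shows "integral {a..b} (\<lambda>x. F x * frac_int_left a \<mu> G x) = integral {a..b} (\<lambda>t. G t * frac_int_right b \<mu> F t)"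
proof -
  have [measurable]: "F \<in> borel_measurable borel" using F by (rule borel_measurable_continuous_onI)
  have [measurable]: "G \<in> borel_measurable borel" using G by (rule borel_measurable_continuous_onI)
  have \<Gamma>: "0 < Gamma \<mu>" using \<open>0 < \<mu>\<close> by (rule Gamma_real_pos)
  define H where "H x t = indicator {a..b} x * F x * (indicator {a..x} t * ((x - t) powr (\<mu> - 1) * G t))" for x t
  have meas: "case_prod H \<in> borel_measurable (lborel \<Otimes>\<^sub>M lborel)"
  proof -
    have "case_prod H = (\<lambda>p. indicator {a..b} (fst p) * F (fst p) *
       (indicator {p. a \<le> snd p \<and> snd p \<le> fst p} p * ((fst p - snd p) powr (\<mu> - 1) * G (snd p))))"
      by (auto simp: H_def fun_eq_iff indicator_def)
    also have "\<dots> \<in> borel_measurable (lborel \<Otimes>\<^sub>M lborel)"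
      by measurable
    finally show ?thesis .
  qed
  have int: "integrable lborel (H x)" for x
    unfolding H_def[abs_def] by (intro integrable_mult_right integrable_kernel_left[OF G \<open>0 < \<mu>\<close>])
  have absG: "continuous_on UNIV (\<lambda>x. \<bar>G x\<bar>)" and absF: "continuous_on UNIV (\<lambda>x. \<bar>F x\<bar>)"
    using F G by (auto intro: continuous_intros)
  \<comment> \<open>For absolute integrability on the triangle: the inner integral is a multiple of
    the left fractional integral of the absolute value of \<open>G\<close>, which is continuous in
    \<open>x\<close> and therefore integrable on \<open>[a,b]\<close>.\<close>
  have nH: "(\<integral>t. norm (H x t) \<partial>lborel) = indicator {a..b} x * (\<bar>F x\<bar> * (Gamma \<mu> * frac_int_left a \<mu> (\<lambda>x. \<bar>G x\<bar>) x))" for x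
  proof -
    have "norm (H x t) = indicator {a..b} x * \<bar>F x\<bar> * (indicator {a..x} t * ((x - t) powr (\<mu> - 1) * \<bar>G t\<bar>))" for t
      by (auto simp: H_def abs_mult indicator_def)
    then show ?thesis
      using \<Gamma> by (simp add: frac_int_left_lborel[OF absG])
  qed
  have "integrable (lborel \<Otimes>\<^sub>M lborel) (case_prod H)"
  proof (rule lborel_pair.Fubini_integrable[OF meas])
    show "AE x in lborel. integrable lborel (\<lambda>y. case (x, y) of (x, xa) \<Rightarrow> H x xa)"
      using int by simp
    have "continuous_on {a..b} (\<lambda>x. \<bar>F x\<bar> * (Gamma \<mu> * frac_int_left a \<mu> (\<lambda>x. \<bar>G x\<bar>) x))"
      by (intro continuous_on_mult continuous_on_const continuous_on_frac_int_left_UNIV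
          continuous_on_subset[OF absF] absG \<open>0 < \<mu>\<close>) auto
    from integral_eq_lborel(2)[OF this]
    show "integrable lborel (\<lambda>x. \<integral>y. norm (case (x, y) of (x, xa) \<Rightarrow> H x xa) \<partial>lborel)"
      by (simp add: nH[unfolded real_norm_def])
  qed
  from lborel_pair.Fubini_integral[OF this]
  have eq: "(\<integral>t. (\<integral>x. H x t \<partial>lborel) \<partial>lborel) = (\<integral>x. (\<integral>t. H x t \<partial>lborel) \<partial>lborel)" .
  have l: "(\<integral>t. H x t \<partial>lborel) = Gamma \<mu> * (indicator {a..b} x * (F x * frac_int_left a \<mu> G x))" for x
    using \<Gamma> by (simp add: H_def frac_int_left_lborel[OF G])
  have r: "(\<integral>x. H x t \<partial>lborel) = Gamma \<mu> * (indicator {a..b} t * (G t * frac_int_right b \<mu> F t))" for t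
  proof -
    have "H x t = indicator {a..b} t * G t * (indicator {t..b} x * ((x - t) powr (\<mu> - 1) * F x))" for x
      by (auto simp: H_def indicator_def)
    moreover have "frac_int_right b \<mu> F t = 1 / Gamma \<mu> * (\<integral>x. indicator {t..b} x * ((x - t) powr (\<mu> - 1) * F x) \<partial>lborel)"
      unfolding frac_int_right_def set_lebesgue_integral_def by (subst integral_completion) auto
    ultimately show ?thesis using \<Gamma> by simp
  qed
  have cF: "continuous_on {a..b} F" and cG: "continuous_on {a..b} G"
    using F G continuous_on_subset by blast+
  have "continuous_on {a..b} (\<lambda>x. F x * frac_int_left a \<mu> G x)"
    "continuous_on {a..b} (\<lambda>t. G t * frac_int_right b \<mu> F t)"
    using cF cG assms by (intro continuous_intros continuous_on_frac_int_left continuous_on_frac_int_right; simp)+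
  then show ?thesis
    using eq \<Gamma> by (simp add: integral_eq_lborel l r)
qed

lemma frac_int_by_parts:
  assumes f: "continuous_on {a..b} f" and g: "continuous_on {a..b} g" and "0 < \<mu>" and "a \<le> b"
  shows "integral {a..b} (\<lambda>x. f x * frac_int_left a \<mu> g x) = integral {a..b} (\<lambda>x. g x * frac_int_right b \<mu> f x)"
proof -
  obtain F where F: "continuous_on UNIV F" "\<And>x. x \<in> {a..b} \<Longrightarrow> F x = f x"
    by (rule continuous_extension[OF f \<open>a \<le> b\<close>]) (rule that)
  obtain G where G: "continuous_on UNIV G" "\<And>x. x \<in> {a..b} \<Longrightarrow> G x = g x"
    by (rule continuous_extension[OF g \<open>a \<le> b\<close>]) (rule that)
  have "frac_int_left a \<mu> g x = frac_int_left a \<mu> G x" "frac_int_right b \<mu> f x = frac_int_right b \<mu> F x"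
    if "x \<in> {a..b}" for x
    using that F(2) G(2) by (auto intro!: frac_int_left_cong frac_int_right_cong)
  then have "integral {a..b} (\<lambda>x. f x * frac_int_left a \<mu> g x) = integral {a..b} (\<lambda>x. F x * frac_int_left a \<mu> G x)"
    "integral {a..b} (\<lambda>x. g x * frac_int_right b \<mu> f x) = integral {a..b} (\<lambda>x. G x * frac_int_right b \<mu> F x)"
    using F(2) G(2) by (auto intro!: integral_cong)
  then show ?thesis
    using frac_int_by_parts_UNIV[OF F(1) G(1) \<open>0 < \<mu>\<close> \<open>a \<le> b\<close>] by simp
qed

section \<open>Linearity of the combined Caputo derivative\<close>

lemma frac_int_left_lincomb:
  assumes f: "frac_int_left_exists a \<mu> f x" and g: "frac_int_left_exists a \<mu> g x"
    and N: "negligible N" "\<forall>t\<in>{a..x} - N. h t = c * f t + d * g t"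
  shows "frac_int_left_exists a \<mu> h x"
    "frac_int_left a \<mu> h x = c * frac_int_left a \<mu> f x + d * frac_int_left a \<mu> g x"
proof -
  let ?k = "\<lambda>t. (x - t) powr (\<mu> - 1)"
  have fg: "set_integrable lebesgue {a..x} (\<lambda>t. ?k t * f t)" "set_integrable lebesgue {a..x} (\<lambda>t. ?k t * g t)"
    using f g by (simp_all add: frac_int_left_exists_def)
  have cd: "set_integrable lebesgue {a..x} (\<lambda>t. c * (?k t * f t) + d * (?k t * g t))"
    using fg by (intro set_integral_add set_integrable_mult_right) auto
  have eq: "?k t * h t = c * (?k t * f t) + d * (?k t * g t)" if "t \<in> {a..x} - N" for t
    using N(2) that by (simp add: algebra_simps)
  have h: "set_integrable lebesgue {a..x} (\<lambda>t. ?k t * h t)"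
    by (rule absolutely_integrable_spike[OF cd N(1) eq])
  then show "frac_int_left_exists a \<mu> h x" by (simp add: frac_int_left_exists_def)
  have "(LINT t:{a..x}|lebesgue. ?k t * h t) = integral {a..x} (\<lambda>t. ?k t * h t)"
    by (rule set_lebesgue_integral_eq_integral[OF h])
  also have "\<dots> = integral {a..x} (\<lambda>t. c * (?k t * f t) + d * (?k t * g t))"
    by (rule integral_spike[OF N(1)]) (use eq in simp)
  also have "\<dots> = (LINT t:{a..x}|lebesgue. c * (?k t * f t) + d * (?k t * g t))"
    by (rule set_lebesgue_integral_eq_integral(2)[OF cd, symmetric])
  also have "\<dots> = c * (LINT t:{a..x}|lebesgue. ?k t * f t) + d * (LINT t:{a..x}|lebesgue. ?k t * g t)"
    using fg by (subst set_integral_add) auto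
  finally show "frac_int_left a \<mu> h x = c * frac_int_left a \<mu> f x + d * frac_int_left a \<mu> g x"
    by (simp add: frac_int_left_def algebra_simps)
qed

lemma frac_int_right_lincomb:
  assumes f: "frac_int_right_exists b \<mu> f x" and g: "frac_int_right_exists b \<mu> g x"
    and N: "negligible N" "\<forall>t\<in>{x..b} - N. h t = c * f t + d * g t"
  shows "frac_int_right_exists b \<mu> h x"
    "frac_int_right b \<mu> h x = c * frac_int_right b \<mu> f x + d * frac_int_right b \<mu> g x"
proof -
  have "negligible (uminus ` N)"
    using N(1) by (intro negligible_differentiable_image_negligible)
      (auto intro!: linear_imp_differentiable_on bounded_linear.linear bounded_linear_minus bounded_linear_ident)
  moreover have "\<forall>t\<in>{- b..- x} - uminus ` N. h (- t) = c * f (- t) + d * g (- t)"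
    by (intro ballI N(2)[rule_format]) force
  ultimately show "frac_int_right_exists b \<mu> h x"
    "frac_int_right b \<mu> h x = c * frac_int_right b \<mu> f x + d * frac_int_right b \<mu> g x"
    using frac_int_left_lincomb[of "- b" \<mu> "\<lambda>t. f (- t)" "- x" "\<lambda>t. g (- t)" "uminus ` N" "\<lambda>t. h (- t)" c d] f g
    unfolding frac_int_right_exists_reflect frac_int_right_reflect by blast+
qed

text \<open>\<open>deriv\<close> is sure to respect sums only where both functions are
  differentiable. The end points join the null set because \<open>deriv\<close> depends there on
  values outside \<open>[a,b]\<close>, about which nothing is assumed.\<close>

lemma AC_on_deriv_lincomb:
  fixes f g :: "real \<Rightarrow> real"
  assumes "AC_on a b f" "AC_on a b g"
  obtains N where "negligible N"
    "\<And>t. t \<in> {a..b} - N \<Longrightarrow> deriv (\<lambda>t. c * f t + d * g t) t = c * deriv f t + d * deriv g t"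
proof -
  obtain N1 where N1: "negligible N1" "\<forall>x\<in>{a<..<b} - N1. f differentiable at x"
    using AC_on_differentiable_ae[OF assms(1)] by blast
  obtain N2 where N2: "negligible N2" "\<forall>x\<in>{a<..<b} - N2. g differentiable at x"
    using AC_on_differentiable_ae[OF assms(2)] by blast
  show thesis
  proof (rule that[of "N1 \<union> N2 \<union> {a, b}"])
    show "negligible (N1 \<union> N2 \<union> {a, b})"
      using N1 N2 by (intro negligible_Un) auto
    fix t assume "t \<in> {a..b} - (N1 \<union> N2 \<union> {a, b})"
    then have "f differentiable at t" "g differentiable at t" using N1 N2 by auto
    then have "(f has_real_derivative deriv f t) (at t)" "(g has_real_derivative deriv g t) (at t)"
      by (simp_all add: real_differentiable_def DERIV_deriv_iff_real_differentiable)
    then have "((\<lambda>t. c * f t + d * g t) has_real_derivative c * deriv f t + d * deriv g t) (at t)"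
      by (intro derivative_eq_intros) (auto intro!: derivative_eq_intros)
    then show "deriv (\<lambda>t. c * f t + d * g t) t = c * deriv f t + d * deriv g t"
      by (rule DERIV_imp_deriv)
  qed
qed

lemma combined_caputo_lincomb:
  assumes AC: "AC_on a b f" "AC_on a b g" and x: "x \<in> {a..b}"
    and ex: "combined_caputo_exists a b \<alpha> \<beta> \<gamma> f x" "combined_caputo_exists a b \<alpha> \<beta> \<gamma> g x"
  shows "combined_caputo_exists a b \<alpha> \<beta> \<gamma> (\<lambda>t. c * f t + d * g t) x"
    "combined_caputo a b \<alpha> \<beta> \<gamma> (\<lambda>t. c * f t + d * g t) x =
      c * combined_caputo a b \<alpha> \<beta> \<gamma> f x + d * combined_caputo a b \<alpha> \<beta> \<gamma> g x"
proof -
  obtain N where N: "negligible N"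
    "\<And>t. t \<in> {a..b} - N \<Longrightarrow> deriv (\<lambda>t. c * f t + d * g t) t = c * deriv f t + d * deriv g t"
    by (rule AC_on_deriv_lincomb[OF AC, of c d]) (rule that)
  have Nl: "\<forall>t\<in>{a..x} - N. deriv (\<lambda>t. c * f t + d * g t) t = c * deriv f t + d * deriv g t"
    using x by (intro ballI N(2)) auto
  have Nr: "\<forall>t\<in>{x..b} - N. deriv (\<lambda>t. c * f t + d * g t) t = c * deriv f t + d * deriv g t"
    using x by (intro ballI N(2)) auto
  note l = frac_int_left_lincomb[OF _ _ N(1) Nl, of "1 - \<alpha>"]
  note r = frac_int_right_lincomb[OF _ _ N(1) Nr, of "1 - \<beta>"]
  show "combined_caputo_exists a b \<alpha> \<beta> \<gamma> (\<lambda>t. c * f t + d * g t) x"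
    using ex l(1) r(1) by (simp add: combined_caputo_exists_def)
  \<comment> \<open>The factor \<open>\<gamma>\<close> stays on both sides: for
    \<open>\<gamma> = 0\<close> the left integrals need not exist, and then
    \<open>caputo_left\<close> by itself cannot be split.\<close>
  have L: "\<gamma> * caputo_left a \<alpha> (\<lambda>t. c * f t + d * g t) x = \<gamma> * (c * caputo_left a \<alpha> f x + d * caputo_left a \<alpha> g x)"
    using ex l(2) by (cases "\<gamma> = 0") (simp_all add: combined_caputo_exists_def caputo_left_def)
  have R: "(1 - \<gamma>) * caputo_right b \<beta> (\<lambda>t. c * f t + d * g t) x =
      (1 - \<gamma>) * (c * caputo_right b \<beta> f x + d * caputo_right b \<beta> g x)"
    using ex r(2) by (cases "1 - \<gamma> = 0") (simp_all add: combined_caputo_exists_def caputo_right_def algebra_simps)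
  show "combined_caputo a b \<alpha> \<beta> \<gamma> (\<lambda>t. c * f t + d * g t) x =
      c * combined_caputo a b \<alpha> \<beta> \<gamma> f x + d * combined_caputo a b \<alpha> \<beta> \<gamma> g x"
    unfolding combined_caputo_def L R by (simp add: algebra_simps)
qed

lemma space_D_lincomb:
  assumes y: "y \<in> space_D a b \<alpha> \<beta> \<gamma>" and z: "z \<in> space_D a b \<alpha> \<beta> \<gamma>"
  shows "(\<lambda>x. c *\<^sub>R y x + d *\<^sub>R z x) \<in> space_D a b \<alpha> \<beta> \<gamma>"
    "x \<in> {a..b} \<Longrightarrow> vec_caputo a b \<alpha> \<beta> \<gamma> (\<lambda>x. c *\<^sub>R y x + d *\<^sub>R z x) x =
      c *\<^sub>R vec_caputo a b \<alpha> \<beta> \<gamma> y x + d *\<^sub>R vec_caputo a b \<alpha> \<beta> \<gamma> z x"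
proof -
  have yz: "AC_on a b (\<lambda>t. y t $ i)" "AC_on a b (\<lambda>t. z t $ i)"
    "x \<in> {a..b} \<Longrightarrow> combined_caputo_exists a b (\<alpha> $ i) (\<beta> $ i) (\<gamma> $ i) (\<lambda>t. y t $ i) x"
    "x \<in> {a..b} \<Longrightarrow> combined_caputo_exists a b (\<alpha> $ i) (\<beta> $ i) (\<gamma> $ i) (\<lambda>t. z t $ i) x" for i x
    using y z by (auto simp: space_D_def)
  have eq: "vec_caputo a b \<alpha> \<beta> \<gamma> (\<lambda>x. c *\<^sub>R y x + d *\<^sub>R z x) x =
      c *\<^sub>R vec_caputo a b \<alpha> \<beta> \<gamma> y x + d *\<^sub>R vec_caputo a b \<alpha> \<beta> \<gamma> z x" if "x \<in> {a..b}" for x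
    using combined_caputo_lincomb(2)[OF yz(1,2) that yz(3,4)[OF that]]
    by (simp add: vec_caputo_def vec_eq_iff)
  then show "x \<in> {a..b} \<Longrightarrow> vec_caputo a b \<alpha> \<beta> \<gamma> (\<lambda>x. c *\<^sub>R y x + d *\<^sub>R z x) x =
      c *\<^sub>R vec_caputo a b \<alpha> \<beta> \<gamma> y x + d *\<^sub>R vec_caputo a b \<alpha> \<beta> \<gamma> z x" .
  have "continuous_on {a..b} (vec_caputo a b \<alpha> \<beta> \<gamma> y)" "continuous_on {a..b} (vec_caputo a b \<alpha> \<beta> \<gamma> z)"
    using y z by (auto simp: space_D_def)
  then have "continuous_on {a..b} (vec_caputo a b \<alpha> \<beta> \<gamma> (\<lambda>x. c *\<^sub>R y x + d *\<^sub>R z x))"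
    by (subst continuous_on_cong[OF refl eq]) (simp, intro continuous_intros)
  then show "(\<lambda>x. c *\<^sub>R y x + d *\<^sub>R z x) \<in> space_D a b \<alpha> \<beta> \<gamma>"
    using yz by (auto simp: space_D_def intro!: AC_on_lincomb combined_caputo_lincomb(1))
qed

text \<open>Membership and formula are proved together because the induction step applies linearity
  to the partial sum, which must already lie in \<open>space_D\<close>.\<close>

lemma space_D_sum:
  assumes "finite M" and y: "y \<in> space_D a b \<alpha> \<beta> \<gamma>" and h: "\<And>m. m \<in> M \<Longrightarrow> h m \<in> space_D a b \<alpha> \<beta> \<gamma>"
  shows "(\<lambda>x. y x + (\<Sum>m\<in>M. t m *\<^sub>R h m x)) \<in> space_D a b \<alpha> \<beta> \<gamma> \<and>
    (\<forall>x\<in>{a..b}. vec_caputo a b \<alpha> \<beta> \<gamma> (\<lambda>x. y x + (\<Sum>m\<in>M. t m *\<^sub>R h m x)) x =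
      vec_caputo a b \<alpha> \<beta> \<gamma> y x + (\<Sum>m\<in>M. t m *\<^sub>R vec_caputo a b \<alpha> \<beta> \<gamma> (h m) x))"
  using \<open>finite M\<close> h
proof (induction M)
  case empty
  then show ?case using y by simp
next
  case (insert m M)
  define Y where "Y = (\<lambda>x. y x + (\<Sum>m\<in>M. t m *\<^sub>R h m x))"
  have eq: "(\<lambda>x. y x + (\<Sum>m\<in>insert m M. t m *\<^sub>R h m x)) = (\<lambda>x. 1 *\<^sub>R Y x + t m *\<^sub>R h m x)"
    using insert.hyps by (simp add: Y_def algebra_simps)
  have Y: "Y \<in> space_D a b \<alpha> \<beta> \<gamma>"
    "\<forall>x\<in>{a..b}. vec_caputo a b \<alpha> \<beta> \<gamma> Y x =
      vec_caputo a b \<alpha> \<beta> \<gamma> y x + (\<Sum>m\<in>M. t m *\<^sub>R vec_caputo a b \<alpha> \<beta> \<gamma> (h m) x)"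
    using insert.IH insert.prems by (simp_all add: Y_def)
  have hm: "h m \<in> space_D a b \<alpha> \<beta> \<gamma>" using insert.prems by simp
  show ?case
    unfolding eq using space_D_lincomb[OF Y(1) hm, where c = 1 and d = "t m"] Y(2) insert.hyps
    by (simp add: algebra_simps)
qed

lemma space_D_imp_continuous_on:
  assumes "y \<in> space_D a b \<alpha> \<beta> \<gamma>"
  shows "continuous_on {a..b} y" "continuous_on {a..b} (vec_caputo a b \<alpha> \<beta> \<gamma> y)"
proof -
  have "continuous_on {a..b} (\<lambda>x. \<chi> i. y x $ i)"
    using assms by (intro continuous_on_vec_lambda AC_on_imp_continuous_on) (auto simp: space_D_def)
  then show "continuous_on {a..b} y" by simp
  show "continuous_on {a..b} (vec_caputo a b \<alpha> \<beta> \<gamma> y)" using assms by (simp add: space_D_def)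
qed

section \<open>Continuously differentiable test functions\<close>

lemma primitive_on_neighbourhood:
  fixes g :: "real \<Rightarrow> real"
  assumes g: "continuous_on {a..b} g" and "a \<le> b"
  obtains \<phi> where "\<phi> a = 0" "\<And>t. t \<in> {a..b} \<Longrightarrow> (\<phi> has_real_derivative g t) (at t)"
proof -
  \<comment> \<open>Extending \<open>g\<close> and integrating from \<open>a - 1\<close> makes the
    derivative of the primitive two-sided even at \<open>a\<close> and \<open>b\<close>, so that
    \<open>deriv\<close> agrees with \<open>g\<close> on all of \<open>[a,b]\<close>.\<close>
  obtain G where G: "continuous_on UNIV G" "\<And>x. x \<in> {a..b} \<Longrightarrow> G x = g x"
    by (rule continuous_extension[OF g \<open>a \<le> b\<close>]) (rule that)
  define \<phi> where "\<phi> x = integral {a - 1..x} G - integral {a - 1..a} G" for x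
  have "(\<phi> has_real_derivative g t) (at t)" if t: "t \<in> {a..b}" for t
  proof -
    have "((\<lambda>x. integral {a - 1..x} G) has_real_derivative G t) (at t within {a - 1..b + 1})"
      using t by (intro integral_has_real_derivative continuous_on_subset[OF G(1)]) auto
    then have "((\<lambda>x. integral {a - 1..x} G) has_real_derivative G t) (at t)"
      using t by (subst (asm) at_within_interior) auto
    then show ?thesis
      unfolding \<phi>_def using G(2)[OF t] by (auto intro!: derivative_eq_intros)
  qed
  then show ?thesis using that[of \<phi>] by (simp add: \<phi>_def)
qed

lemma AC_on_C1:
  assumes g: "continuous_on {a..b} g" and \<phi>: "\<And>t. t \<in> {a..b} \<Longrightarrow> (\<phi> has_real_derivative g t) (at t)"
  shows "AC_on a b \<phi>"
proof -
  obtain B where B: "0 < B" "\<And>t. t \<in> {a..b} \<Longrightarrow> norm (g t) \<le> B"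
    using bounded_on_interval[OF g] by metis
  show ?thesis
  proof (rule AC_on_Lipschitz)
    fix u v assume uv: "a \<le> u" "u \<le> v" "v \<le> b"
    have "norm (\<phi> v - \<phi> u) \<le> B * norm (v - u)"
    proof (rule field_differentiable_bound[of "{a..b}" \<phi> g])
      show "(\<phi> has_field_derivative g z) (at z within {a..b})" if "z \<in> {a..b}" for z
        using \<phi>[OF that] by (rule has_field_derivative_at_within)
    qed (use B uv in auto)
    then show "\<bar>\<phi> v - \<phi> u\<bar> \<le> B * (v - u)" using uv by simp
  qed
qed

lemma combined_caputo_C1:
  assumes g: "continuous_on {a..b} g" and \<phi>: "\<And>t. t \<in> {a..b} \<Longrightarrow> (\<phi> has_real_derivative g t) (at t)"
    and "\<alpha> < 1" "\<beta> < 1" and x: "x \<in> {a..b}"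
  shows "combined_caputo_exists a b \<alpha> \<beta> \<gamma> \<phi> x"
    "combined_caputo a b \<alpha> \<beta> \<gamma> \<phi> x = \<gamma> * frac_int_left a (1 - \<alpha>) g x - (1 - \<gamma>) * frac_int_right b (1 - \<beta>) g x"
proof -
  have d: "deriv \<phi> t = g t" if "t \<in> {a..b}" for t
    using \<phi>[OF that] by (rule DERIV_imp_deriv)
  then have "continuous_on {a..b} (deriv \<phi>)"
    using g by (subst continuous_on_cong[OF refl]) auto
  then show "combined_caputo_exists a b \<alpha> \<beta> \<gamma> \<phi> x"
    using assms by (auto simp: combined_caputo_exists_def intro!: frac_int_left_exists_continuous frac_int_right_exists_continuous)
  have "frac_int_left a (1 - \<alpha>) (deriv \<phi>) x = frac_int_left a (1 - \<alpha>) g x"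
    "frac_int_right b (1 - \<beta>) (deriv \<phi>) x = frac_int_right b (1 - \<beta>) g x"
    using d x by (auto intro!: frac_int_left_cong frac_int_right_cong)
  then show "combined_caputo a b \<alpha> \<beta> \<gamma> \<phi> x = \<gamma> * frac_int_left a (1 - \<alpha>) g x - (1 - \<gamma>) * frac_int_right b (1 - \<beta>) g x"
    by (simp add: combined_caputo_def caputo_left_def caputo_right_def)
qed

lemma combined_caputo_zero: "combined_caputo a b \<alpha> \<beta> \<gamma> (\<lambda>t. 0) x = 0"
  by (simp add: combined_caputo_def caputo_left_def caputo_right_def frac_int_left_def frac_int_right_def)

text \<open>Varying a single component isolates the corresponding equation of the system: the other
  components of the variation and of its fractional derivative vanish.\<close>

lemma space_D_axis:
  fixes \<alpha> \<beta> \<gamma> :: "real^'n"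
  assumes g: "continuous_on {a..b} g" and \<phi>: "\<And>t. t \<in> {a..b} \<Longrightarrow> (\<phi> has_real_derivative g t) (at t)"
    and "a \<le> b" "\<forall>i. \<alpha> $ i < 1" "\<forall>i. \<beta> $ i < 1"
  shows "(\<lambda>t. \<phi> t *\<^sub>R axis i 1) \<in> space_D a b \<alpha> \<beta> \<gamma>"
    "\<And>x. x \<in> {a..b} \<Longrightarrow> vec_caputo a b \<alpha> \<beta> \<gamma> (\<lambda>t. \<phi> t *\<^sub>R axis i 1) x =
      (\<gamma> $ i * frac_int_left a (1 - \<alpha> $ i) g x - (1 - \<gamma> $ i) * frac_int_right b (1 - \<beta> $ i) g x) *\<^sub>R axis i 1"
proof -
  have comp: "(\<lambda>t. (\<phi> t *\<^sub>R axis i 1 :: real^'n) $ j) = (if j = i then \<phi> else (\<lambda>t. 0))" for j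
    by (auto simp: axis_def)
  have zero: "AC_on a b (\<lambda>t. 0)" by (rule AC_on_Lipschitz[of _ _ _ 0]) auto
  have ac: "AC_on a b \<phi>" by (rule AC_on_C1[OF g \<phi>])
  show eq: "vec_caputo a b \<alpha> \<beta> \<gamma> (\<lambda>t. \<phi> t *\<^sub>R axis i 1) x =
      (\<gamma> $ i * frac_int_left a (1 - \<alpha> $ i) g x - (1 - \<gamma> $ i) * frac_int_right b (1 - \<beta> $ i) g x) *\<^sub>R axis i 1"
    if "x \<in> {a..b}" for x
    using assms(4,5) that
    by (auto simp: vec_caputo_def vec_eq_iff comp combined_caputo_zero axis_def
        intro!: combined_caputo_C1(2)[OF g \<phi>])
  have zero_ex: "combined_caputo_exists a b \<alpha>' \<beta>' \<gamma>' (\<lambda>t. 0) x" for \<alpha>' \<beta>' \<gamma>' x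
    by (simp add: combined_caputo_exists_def frac_int_left_exists_def frac_int_right_exists_def set_integrable_def)
  have "continuous_on {a..b} (\<lambda>x. (\<gamma> $ i * frac_int_left a (1 - \<alpha> $ i) g x - (1 - \<gamma> $ i) * frac_int_right b (1 - \<beta> $ i) g x) *\<^sub>R (axis i 1 :: real^'n))"
    using assms by (intro continuous_intros continuous_on_frac_int_left continuous_on_frac_int_right) auto
  then have "continuous_on {a..b} (vec_caputo a b \<alpha> \<beta> \<gamma> (\<lambda>t. \<phi> t *\<^sub>R axis i 1))"
    by (subst continuous_on_cong[OF refl eq])
  then show "(\<lambda>t. \<phi> t *\<^sub>R axis i 1) \<in> space_D a b \<alpha> \<beta> \<gamma>"
    unfolding space_D_def comp mem_Collect_eq
    using ac zero zero_ex combined_caputo_C1(1)[OF g \<phi>] assms(4,5) by auto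
qed

section \<open>Variations and multipliers\<close>

lemma set_lebesgue_integral_continuous:
  fixes f :: "real \<Rightarrow> real"
  assumes "continuous_on {a..b} f"
  shows "(LINT x:{a..b}|lebesgue. f x) = integral {a..b} f"
  using absolutely_integrable_continuous_real[OF assms] by (rule set_lebesgue_integral_eq_integral)

text \<open>Along finitely many directions the argument of \<open>K\<close> is affine in the
  coefficients \<open>w\<close>, so Leibniz's rule for integrals with a parameter applies. The
  derivative is taken at every \<open>w0\<close>, not just at \<open>0\<close>, because the open
  mapping theorem also asks for continuity of the map.\<close>

lemma functional_has_derivative:
  fixes K :: "real \<times> (real^'n) \<times> (real^'n) \<Rightarrow> real"
    and K' :: "real \<times> (real^'n) \<times> (real^'n) \<Rightarrow> (real \<times> (real^'n) \<times> (real^'n)) \<Rightarrow>\<^sub>L real"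
    and h :: "'k::finite \<Rightarrow> real \<Rightarrow> real^'n" and w0 :: "real^'k"
  assumes contK': "continuous_on ({a..b} \<times> UNIV) K'"
    and derK: "\<forall>p\<in>{a..b} \<times> UNIV. (K has_derivative blinfun_apply (K' p)) (at p within {a..b} \<times> UNIV)"
    and y: "y \<in> space_D a b \<alpha> \<beta> \<gamma>" and h: "\<And>m. h m \<in> space_D a b \<alpha> \<beta> \<gamma>"
  shows "((\<lambda>w. functional a b \<alpha> \<beta> \<gamma> K (\<lambda>x. y x + (\<Sum>m\<in>UNIV. w $ m *\<^sub>R h m x))) has_derivative
     (\<lambda>w. \<Sum>m\<in>UNIV. w $ m * integral {a..b} (\<lambda>x. K' (frac_arg a b \<alpha> \<beta> \<gamma> (\<lambda>x. y x + (\<Sum>m\<in>UNIV. w0 $ m *\<^sub>R h m x)) x)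
        (0, h m x, vec_caputo a b \<alpha> \<beta> \<gamma> (h m) x)))) (at w0)"
proof -
  let ?D = "vec_caputo a b \<alpha> \<beta> \<gamma>"
  define u where "u w = (\<lambda>x. y x + (\<Sum>m\<in>UNIV. w $ m *\<^sub>R h m x))" for w :: "real^'k"
  \<comment> \<open>The Caputo derivative of a combination is known to split on \<open>[a,b]\<close>
    only. \<open>E\<close> is affine in \<open>w\<close> for all \<open>x\<close> and is identified
    with \<open>frac_arg\<close> on that interval.\<close>
  define E where "E w x = (x, u w x, ?D y x + (\<Sum>m\<in>UNIV. w $ m *\<^sub>R ?D (h m) x))" for w :: "real^'k" and x
  have arg: "frac_arg a b \<alpha> \<beta> \<gamma> (u w) x = E w x" if "x \<in> {a..b}" for w x
    using space_D_sum[OF finite y h, of "\<lambda>m. w $ m"] that by (simp add: frac_arg_def E_def u_def)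
  note cont_y = space_D_imp_continuous_on[OF y] and cont_h = space_D_imp_continuous_on[OF h]
  define A0 where "A0 x w = (0::real, (\<Sum>m\<in>UNIV. w $ m *\<^sub>R h m x), (\<Sum>m\<in>UNIV. w $ m *\<^sub>R ?D (h m) x))"
    for x and w :: "real^'k"
  have bl: "bounded_linear (A0 x)" for x
    unfolding A0_def[abs_def]
    by (intro bounded_linear_Pair bounded_linear_zero bounded_linear_sum
        bounded_linear_compose[OF bounded_linear_scaleR_left bounded_linear_vec_nth])
  \<comment> \<open>Leibniz's rule expects derivatives that are continuous as bounded linear maps;
    in finite dimension this continuity may be checked by evaluating at vectors.\<close>
  define A where "A x = Blinfun (A0 x)" for x
  have A: "blinfun_apply (A x) = A0 x" for x
    unfolding A_def by (rule bounded_linear_Blinfun_apply[OF bl])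
  have contA: "continuous_on {a..b} A"
  proof (rule continuous_on_blinfun_componentwise)
    fix i :: "real^'k"
    show "continuous_on {a..b} (\<lambda>x. blinfun_apply (A x) i)"
      unfolding A A0_def by (intro continuous_intros cont_h)
  qed
  have E_mem: "E w x \<in> {a..b} \<times> UNIV" if "x \<in> {a..b}" for w x
    using that by (simp add: E_def)
  have contE: "continuous_on (UNIV \<times> {a..b}) (\<lambda>(w, x). E w x)"
  proof -
    have 1: "continuous_on (UNIV \<times> {a..b}) (\<lambda>p. f (snd p))" if "continuous_on {a..b} f"
      for f :: "real \<Rightarrow> real^'n"
      by (rule continuous_on_compose2[OF that]) (auto intro: continuous_intros)
    show ?thesis
      unfolding E_def u_def split_beta
      by (intro continuous_intros 1 cont_y cont_h)
  qed
  have pair: "continuous_on {a..b} (Pair w)" "Pair w ` {a..b} \<subseteq> UNIV \<times> {a..b}" for w :: "real^'k"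
    by (auto intro!: continuous_intros)
  have contKE: "continuous_on (UNIV \<times> {a..b}) (\<lambda>(w, x). K' (E w x) o\<^sub>L A x)"
  proof -
    have 1: "continuous_on (UNIV \<times> {a..b}) (\<lambda>p. K' (case p of (w, x) \<Rightarrow> E w x))"
      by (rule continuous_on_compose2[OF contK' contE]) (auto simp: E_def)
    have 2: "continuous_on (UNIV \<times> {a..b}) (\<lambda>p::(real^'k) \<times> real. A (snd p))"
      by (rule continuous_on_compose2[OF contA]) (auto intro: continuous_intros)
    show ?thesis
      using bounded_bilinear.continuous_on[OF bounded_bilinear_blinfun_compose 1 2]
      by (simp add: split_beta)
  qed
  have derE: "((\<lambda>w. E w x) has_derivative A0 x) (at w)" for w x
    unfolding E_def[abs_def] u_def A0_def
    by (auto intro!: derivative_eq_intros bounded_linear_imp_has_derivative[OF bounded_linear_vec_nth])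
  have der: "((\<lambda>w. K (E w x)) has_derivative blinfun_apply (K' (E w x) o\<^sub>L A x)) (at w within UNIV)"
    if "x \<in> cbox a b" for w x
  proof -
    have x: "x \<in> {a..b}" using that by simp
    have "((\<lambda>w. K (E w x)) has_derivative (\<lambda>v. blinfun_apply (K' (E w x)) (A0 x v))) (at w)"
    proof (rule has_derivative_in_compose2[of "{a..b} \<times> UNIV" K "\<lambda>p. blinfun_apply (K' p)" "\<lambda>w. E w x" UNIV])
      show "(K has_derivative blinfun_apply (K' p)) (at p within {a..b} \<times> UNIV)" if "p \<in> {a..b} \<times> UNIV" for p
        using derK that by blast
      show "(\<lambda>w. E w x) ` UNIV \<subseteq> {a..b} \<times> UNIV" using E_mem[OF x] by blast
    qed (auto intro: derE)
    then show ?thesis by (simp add: blinfun_compose.rep_eq o_def A)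
  qed
  have contK: "continuous_on ({a..b} \<times> UNIV) K"
    using derK by (intro has_derivative_continuous_on[of _ _ "\<lambda>p. blinfun_apply (K' p)"]) auto
  have contKE0: "continuous_on {a..b} (\<lambda>x. K (E w x))" for w
  proof -
    have "continuous_on {a..b} (\<lambda>x. E w x)"
      using continuous_on_compose2[OF contE pair[of w]] by simp
    then show ?thesis
      by (rule continuous_on_compose2[OF contK]) (auto simp: E_def)
  qed
  have leib: "((\<lambda>w. integral (cbox a b) (\<lambda>x. K (E w x))) has_derivative
      integral (cbox a b) (\<lambda>x. K' (E w0 x) o\<^sub>L A x)) (at w0 within UNIV)"
    by (rule leibniz_rule[OF der]) (use contKE0 contKE in \<open>auto intro: integrable_continuous_real\<close>)
  have "functional a b \<alpha> \<beta> \<gamma> K (u w) = integral {a..b} (\<lambda>x. K (E w x))" for w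
  proof -
    have "functional a b \<alpha> \<beta> \<gamma> K (u w) = (LINT x:{a..b}|lebesgue. K (E w x))"
      unfolding functional_def by (rule set_lebesgue_integral_cong) (auto simp: arg)
    then show ?thesis by (simp add: set_lebesgue_integral_continuous[OF contKE0])
  qed
  moreover have "blinfun_apply (integral (cbox a b) (\<lambda>x. K' (E w0 x) o\<^sub>L A x)) w =
      (\<Sum>m\<in>UNIV. w $ m * integral {a..b} (\<lambda>x. K' (frac_arg a b \<alpha> \<beta> \<gamma> (u w0) x) (0, h m x, ?D (h m) x)))" for w
  proof -
    have c: "continuous_on {a..b} (\<lambda>x. K' (E w0 x) o\<^sub>L A x)"
      using continuous_on_compose2[OF contKE pair[of w0]] by simp
    have cE: "continuous_on {a..b} (\<lambda>x. K' (E w0 x))"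
    proof (rule continuous_on_compose2[OF contK'])
      show "continuous_on {a..b} (E w0)"
        using continuous_on_compose2[OF contE pair[of w0]] by simp
    qed (auto simp: E_def)
    have ci: "(\<lambda>x. blinfun_apply (K' (E w0 x)) (0, h m x, ?D (h m) x)) integrable_on {a..b}" for m
      by (intro integrable_continuous_real continuous_intros cE cont_h)
    \<comment> \<open>Evaluation at \<open>w\<close> is bounded and linear, hence commutes with the
      integral of operators.\<close>
    have "blinfun_apply (integral {a..b} (\<lambda>x. K' (E w0 x) o\<^sub>L A x)) w = integral {a..b} (\<lambda>x. blinfun_apply (K' (E w0 x) o\<^sub>L A x) w)"
      using integral_linear[OF integrable_continuous_real[OF c] blinfun.bounded_linear_left[of w]]
      by (simp add: o_def)
    also have "\<dots> = integral {a..b} (\<lambda>x. \<Sum>m\<in>UNIV. w $ m * K' (E w0 x) (0, h m x, ?D (h m) x))"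
    proof (rule arg_cong[of _ _ "integral {a..b}"], rule ext)
      fix x
      have "A0 x w = (\<Sum>m\<in>UNIV. w $ m *\<^sub>R (0, h m x, ?D (h m) x))"
        by (simp add: A0_def sum_prod)
      then show "blinfun_apply (K' (E w0 x) o\<^sub>L A x) w = (\<Sum>m\<in>UNIV. w $ m * K' (E w0 x) (0, h m x, ?D (h m) x))"
        by (simp add: A blinfun.sum_right blinfun.scaleR_right del: scaleR_Pair)
    qed
    also have "\<dots> = (\<Sum>m\<in>UNIV. w $ m * integral {a..b} (\<lambda>x. K' (E w0 x) (0, h m x, ?D (h m) x)))"
      using ci by (subst integral_sum) (auto intro!: integrable_on_mult_right ci)
    also have "\<dots> = (\<Sum>m\<in>UNIV. w $ m * integral {a..b} (\<lambda>x. K' (frac_arg a b \<alpha> \<beta> \<gamma> (u w0) x) (0, h m x, ?D (h m) x)))"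
      by (intro sum.cong arg_cong2[of _ _ _ _ "(*)"] refl integral_cong) (simp add: arg)
    finally show ?thesis by simp
  qed
  then have "blinfun_apply (integral (cbox a b) (\<lambda>x. K' (E w0 x) o\<^sub>L A x)) =
      (\<lambda>w. \<Sum>m\<in>UNIV. w $ m * integral {a..b} (\<lambda>x. K' (frac_arg a b \<alpha> \<beta> \<gamma> (u w0) x) (0, h m x, ?D (h m) x)))"
    by (rule ext)
  ultimately show ?thesis
    using leib unfolding u_def by simp
qed

lemma first_variation_eq:
  fixes K :: "real \<times> (real^'n) \<times> (real^'n) \<Rightarrow> real"
    and K' :: "real \<times> (real^'n) \<times> (real^'n) \<Rightarrow> (real \<times> (real^'n) \<times> (real^'n)) \<Rightarrow>\<^sub>L real"
  assumes contK': "continuous_on ({a..b} \<times> UNIV) K'"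
    and derK: "\<forall>p\<in>{a..b} \<times> UNIV. (K has_derivative blinfun_apply (K' p)) (at p within {a..b} \<times> UNIV)"
    and y: "y \<in> space_D a b \<alpha> \<beta> \<gamma>" and z: "z \<in> space_D a b \<alpha> \<beta> \<gamma>"
  shows "first_variation (functional a b \<alpha> \<beta> \<gamma> K) y z =
    integral {a..b} (\<lambda>x. K' (frac_arg a b \<alpha> \<beta> \<gamma> y x) (0, z x, vec_caputo a b \<alpha> \<beta> \<gamma> z x))"
proof -
  let ?V = "integral {a..b} (\<lambda>x. K' (frac_arg a b \<alpha> \<beta> \<gamma> y x) (0, z x, vec_caputo a b \<alpha> \<beta> \<gamma> z x))"
  let ?J = "functional a b \<alpha> \<beta> \<gamma> K"
  \<comment> \<open>The index type \<open>unit\<close> specialises the preceding lemma to one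
    direction; the map \<open>\<epsilon> \<mapsto> \<epsilon> *\<^sub>R 1\<close> then identifies
    \<open>real^unit\<close> with the real parameter of the variation.\<close>
  have "((\<lambda>w::real^unit. ?J (\<lambda>x. y x + w $ () *\<^sub>R z x)) has_derivative (\<lambda>w. w $ () * ?V)) (at (0 *\<^sub>R 1))"
    using functional_has_derivative[OF contK' derK y, of "\<lambda>_. z" "0::real^unit"] z by (simp add: UNIV_unit)
  moreover have "((\<lambda>\<epsilon>::real. \<epsilon> *\<^sub>R (1::real^unit)) has_derivative (\<lambda>\<epsilon>. \<epsilon> *\<^sub>R 1)) (at 0)"
    by (auto intro!: derivative_eq_intros)
  ultimately have "((\<lambda>\<epsilon>. ?J (\<lambda>x. y x + (\<epsilon> *\<^sub>R (1::real^unit)) $ () *\<^sub>R z x)) has_derivative (\<lambda>\<epsilon>. (\<epsilon> *\<^sub>R (1::real^unit)) $ () * ?V)) (at 0)"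
    using has_derivative_compose by fast
  then have "((\<lambda>\<epsilon>. ?J (\<lambda>x. y x + \<epsilon> *\<^sub>R z x)) has_derivative (\<lambda>\<epsilon>. \<epsilon> * ?V)) (at 0)"
    by simp
  then have "((\<lambda>\<epsilon>. ?J (\<lambda>x. y x + \<epsilon> *\<^sub>R z x)) has_field_derivative ?V) (at 0)"
    by (rule has_derivative_imp_has_field_derivative) simp
  then have "(variation_quotient ?J y z \<longlongrightarrow> ?V) (at 0)"
    by (simp add: has_field_derivative_iff variation_quotient_def[abs_def])
  then show ?thesis
    unfolding first_variation_def by (intro tendsto_Lim) auto
qed

section \<open>Norm estimates for finite combinations of directions\<close>

lemma is_norm_bound:
  fixes \<nu> :: "real^'n \<Rightarrow> real"
  assumes \<nu>: "is_norm \<nu>"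
  shows "\<exists>C\<ge>0. \<forall>v. \<nu> v \<le> C * norm v"
proof (intro exI conjI allI)
  have nn: "0 \<le> \<nu> v" for v using \<nu> by (simp add: is_norm_def)
  show "0 \<le> (\<Sum>i\<in>UNIV. \<nu> (axis i 1))" using nn by (simp add: sum_nonneg)
  fix v :: "real^'n"
  have sum_le: "\<nu> (\<Sum>i\<in>I. g i) \<le> (\<Sum>i\<in>I. \<nu> (g i))" if "finite I" for I and g :: "'n \<Rightarrow> real^'n"
    using that
  proof (induction I)
    case empty
    have "\<nu> 0 = 0" using \<nu> by (simp add: is_norm_def)
    then show ?case by simp
  next
    case (insert i I)
    have "\<nu> (g i + (\<Sum>i\<in>I. g i)) \<le> \<nu> (g i) + \<nu> (\<Sum>i\<in>I. g i)" using \<nu> by (simp add: is_norm_def)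
    then show ?case using insert by simp
  qed
  have "v = (\<Sum>i\<in>UNIV. v $ i *\<^sub>R axis i 1)"
    using basis_expansion[of v] by (simp add: scalar_mult_eq_scaleR)
  then have "\<nu> v \<le> (\<Sum>i\<in>UNIV. \<nu> (v $ i *\<^sub>R axis i 1))"
    using sum_le[of UNIV "\<lambda>i. v $ i *\<^sub>R axis i 1"] by simp
  also have "\<dots> = (\<Sum>i\<in>UNIV. \<bar>v $ i\<bar> * \<nu> (axis i 1))" using \<nu> by (simp add: is_norm_def)
  also have "\<dots> \<le> (\<Sum>i\<in>UNIV. norm v * \<nu> (axis i 1))"
    using nn component_le_norm_cart[of v] by (intro sum_mono mult_right_mono) auto
  finally show "\<nu> v \<le> (\<Sum>i\<in>UNIV. \<nu> (axis i 1)) * norm v"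
    by (simp add: sum_distrib_left mult.commute)
qed

text \<open>Guarantees that small coefficients lead to functions close to the minimizer, whichever
  norm \<open>\<nu>\<close> is used on the values.\<close>

lemma norm_D_sum_le:
  fixes h :: "'k::finite \<Rightarrow> real \<Rightarrow> real^'n"
  assumes "is_norm \<nu>" and "a \<le> b" and h: "\<And>m. h m \<in> space_D a b \<alpha> \<beta> \<gamma>"
  shows "\<exists>M\<ge>0. \<forall>w::real^'k. norm_D \<nu> a b \<alpha> \<beta> \<gamma> (\<lambda>x. \<Sum>m\<in>UNIV. w $ m *\<^sub>R h m x) \<le> M * norm w"
proof -
  let ?D = "vec_caputo a b \<alpha> \<beta> \<gamma>"
  obtain C where C: "0 \<le> C" "\<And>v. \<nu> v \<le> C * norm v" using is_norm_bound[OF assms(1)] by blast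
  have "\<exists>B. \<forall>x\<in>{a..b}. norm (h m x) \<le> B \<and> norm (?D (h m) x) \<le> B" for m
  proof -
    obtain B1 where B1: "\<And>x. x \<in> {a..b} \<Longrightarrow> norm (h m x) \<le> B1"
      using bounded_on_interval[OF space_D_imp_continuous_on(1)[OF h]] by metis
    obtain B2 where B2: "\<And>x. x \<in> {a..b} \<Longrightarrow> norm (?D (h m) x) \<le> B2"
      using bounded_on_interval[OF space_D_imp_continuous_on(2)[OF h]] by metis
    show ?thesis
      using B1 B2 by (intro exI[of _ "max B1 B2"]) (auto simp: le_max_iff_disj)
  qed
  then obtain B where B: "\<And>m x. x \<in> {a..b} \<Longrightarrow> norm (h m x) \<le> B m"
    "\<And>m x. x \<in> {a..b} \<Longrightarrow> norm (?D (h m) x) \<le> B m"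
    by metis
  have B0: "0 \<le> B m" for m using B(1)[of a m] \<open>a \<le> b\<close> norm_ge_zero[of "h m a"] by (meson atLeastAtMost_iff order_refl order_trans)
  \<comment> \<open>The zero function arises as a combination with coefficients \<open>0\<close>, so
    that the formula for sums can start from it.\<close>
  have zero: "(\<lambda>x. 0) \<in> space_D a b \<alpha> \<beta> \<gamma>" "x \<in> {a..b} \<Longrightarrow> ?D (\<lambda>x. 0) x = 0" for x
    using space_D_lincomb[OF h h, where c = 0 and d = 0] by simp_all
  have D: "?D (\<lambda>x. \<Sum>m\<in>UNIV. w $ m *\<^sub>R h m x) x = (\<Sum>m\<in>UNIV. w $ m *\<^sub>R ?D (h m) x)" if "x \<in> {a..b}"
    for w :: "real^'k" and x
    using space_D_sum[OF finite zero(1) h, of "\<lambda>m. w $ m"] zero(2) that by simp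
  have le: "\<nu> (\<Sum>m\<in>UNIV. w $ m *\<^sub>R v m) \<le> C * (\<Sum>m\<in>UNIV. B m) * norm w"
    if "\<And>m. norm (v m) \<le> B m" for v and w :: "real^'k"
  proof -
    have "norm (\<Sum>m\<in>UNIV. w $ m *\<^sub>R v m) \<le> (\<Sum>m\<in>UNIV. norm w * B m)"
      using that component_le_norm_cart[of w] B0 by (intro sum_norm_le) (auto intro: mult_mono)
    also have "\<dots> = (\<Sum>m\<in>UNIV. B m) * norm w" by (simp add: sum_distrib_left mult.commute)
    finally have "C * norm (\<Sum>m\<in>UNIV. w $ m *\<^sub>R v m) \<le> C * ((\<Sum>m\<in>UNIV. B m) * norm w)"
      using C(1) by (rule mult_left_mono)
    then show ?thesis using C(2)[of "\<Sum>m\<in>UNIV. w $ m *\<^sub>R v m"] by simp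
  qed
  have ne: "{a..b} \<noteq> {}" using \<open>a \<le> b\<close> by simp
  show ?thesis
  \<comment> \<open>The factor \<open>2\<close> accounts for the two suprema in
    \<open>norm_D\<close>.\<close>
  proof (intro exI[of _ "2 * (C * (\<Sum>m\<in>UNIV. B m))"] conjI allI)
    show "0 \<le> 2 * (C * (\<Sum>m\<in>UNIV. B m))" using C B0 by (simp add: sum_nonneg)
    fix w :: "real^'k"
    have "(SUP x\<in>{a..b}. \<nu> (\<Sum>m\<in>UNIV. w $ m *\<^sub>R h m x)) \<le> C * (\<Sum>m\<in>UNIV. B m) * norm w"
      by (rule cSUP_least[OF ne]) (intro le B)
    moreover have "(SUP x\<in>{a..b}. \<nu> (?D (\<lambda>x. \<Sum>m\<in>UNIV. w $ m *\<^sub>R h m x) x)) \<le> C * (\<Sum>m\<in>UNIV. B m) * norm w"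
    proof (rule cSUP_least[OF ne])
      fix x assume x: "x \<in> {a..b}"
      show "\<nu> (?D (\<lambda>x. \<Sum>m\<in>UNIV. w $ m *\<^sub>R h m x) x) \<le> C * (\<Sum>m\<in>UNIV. B m) * norm w"
        unfolding D[OF x] by (intro le B x)
    qed
    ultimately show "norm_D \<nu> a b \<alpha> \<beta> \<gamma> (\<lambda>x. \<Sum>m\<in>UNIV. w $ m *\<^sub>R h m x) \<le> 2 * (C * (\<Sum>m\<in>UNIV. B m)) * norm w"
      by (simp add: norm_D_def)
  qed
qed

lemma sum_UNIV_option:
  fixes f :: "'r::finite option \<Rightarrow> 'a::comm_monoid_add"
  shows "(\<Sum>k\<in>UNIV. f k) = f None + (\<Sum>m\<in>UNIV. f (Some m))"
  by (simp add: UNIV_option_conv sum.reindex)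

lemma has_derivative_vec_lambda:
  fixes f f' :: "'i::finite \<Rightarrow> 'a::real_normed_vector \<Rightarrow> real"
  assumes "\<And>i. (f i has_derivative f' i) (at x within S)"
  shows "((\<lambda>x. \<chi> i. f i x) has_derivative (\<lambda>x. \<chi> i. f' i x)) (at x within S)"
  using assms by (subst has_derivative_componentwise_within) (auto simp: Basis_vec_def inner_axis)

text \<open>By \<open>first_variation_eq\<close> this is the first variation when \<open>K'\<close>
  is the derivative of the integrand. In this form linearity in \<open>K'\<close> is visible, which
  merges the variations of \<open>L\<close> and of all \<open>G j\<close> into one.\<close>

definition variation_integral ::
  "real \<Rightarrow> real \<Rightarrow> real^'n \<Rightarrow> real^'n \<Rightarrow> real^'n
     \<Rightarrow> (real \<times> (real^'n) \<times> (real^'n) \<Rightarrow> (real \<times> (real^'n) \<times> (real^'n)) \<Rightarrow>\<^sub>L real)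
     \<Rightarrow> (real \<Rightarrow> real^'n) \<Rightarrow> (real \<Rightarrow> real^'n) \<Rightarrow> real" where
  "variation_integral a b \<alpha> \<beta> \<gamma> K' y z =
     integral {a..b} (\<lambda>x. K' (frac_arg a b \<alpha> \<beta> \<gamma> y x) (0, z x, vec_caputo a b \<alpha> \<beta> \<gamma> z x))"

text \<open>The multipliers are computed from the directions \<open>h m\<close> alone, so that one
  choice serves every \<open>\<phi>\<close>. Since \<open>\<phi>\<close> and all \<open>h m\<close>
  vanish at both ends, any combination keeps the boundary values, and only the integral constraints
  have to be met by choosing coefficients.\<close>

lemma Lagrange_multipliers:
  fixes L :: "real \<times> (real^'n) \<times> (real^'n) \<Rightarrow> real"
    and G :: "'r::finite \<Rightarrow> real \<times> (real^'n) \<times> (real^'n) \<Rightarrow> real"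
    and L' :: "real \<times> (real^'n) \<times> (real^'n) \<Rightarrow> (real \<times> (real^'n) \<times> (real^'n)) \<Rightarrow>\<^sub>L real"
    and G' :: "'r \<Rightarrow> real \<times> (real^'n) \<times> (real^'n) \<Rightarrow> (real \<times> (real^'n) \<times> (real^'n)) \<Rightarrow>\<^sub>L real"
    and h :: "'r \<Rightarrow> real \<Rightarrow> real^'n" and l :: "real^'r"
  assumes "a < b" and \<nu>: "is_norm \<nu>"
    and L': "continuous_on ({a..b} \<times> UNIV) L'"
      "\<forall>p\<in>{a..b} \<times> UNIV. (L has_derivative blinfun_apply (L' p)) (at p within {a..b} \<times> UNIV)"
    and G': "\<And>j. continuous_on ({a..b} \<times> UNIV) (G' j)"
      "\<And>j. \<forall>p\<in>{a..b} \<times> UNIV. (G j has_derivative blinfun_apply (G' j p)) (at p within {a..b} \<times> UNIV)"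
    and min: "local_minimizer \<nu> a b \<alpha> \<beta> \<gamma> (functional a b \<alpha> \<beta> \<gamma> L)
           {z \<in> space_D a b \<alpha> \<beta> \<gamma>. z a = ya \<and> z b = yb \<and>
              (\<forall>j. functional a b \<alpha> \<beta> \<gamma> (G j) z = l $ j)} y"
    and h: "\<And>m. h m \<in> space_D a b \<alpha> \<beta> \<gamma>" "\<And>m. h m a = 0 \<and> h m b = 0"
    and rank: "rank ((\<chi> k m. variation_integral a b \<alpha> \<beta> \<gamma> (G' k) y (h m)) :: real^'r^'r) = CARD('r)"
  shows "\<exists>lam :: real^'r. \<forall>\<phi>\<in>space_D a b \<alpha> \<beta> \<gamma>. \<phi> a = 0 \<longrightarrow> \<phi> b = 0 \<longrightarrow>
    variation_integral a b \<alpha> \<beta> \<gamma> L' y \<phi> = (\<Sum>j\<in>UNIV. lam $ j * variation_integral a b \<alpha> \<beta> \<gamma> (G' j) y \<phi>)"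
proof -
  let ?\<Delta> = "variation_integral a b \<alpha> \<beta> \<gamma>"
  let ?J = "functional a b \<alpha> \<beta> \<gamma>"
  define A where "A = ((\<chi> k m. ?\<Delta> (G' k) y (h m)) :: real^'r^'r)"
  define jh where "jh = ((\<chi> m. ?\<Delta> L' y (h m)) :: real^'r)"
  have "surj ((*v) A)" using rank by (simp add: A_def full_rank_surjective)
  then obtain B where B: "A ** B = mat 1"
    using matrix_right_invertible_surjective by blast
  \<comment> \<open>This is \<open>jh\<close> times the inverse of \<open>A\<close>: the multipliers
    for which the combined variation vanishes along every \<open>h m\<close>.\<close>
  define lam where "lam = jh v* B"
  have y: "y \<in> space_D a b \<alpha> \<beta> \<gamma>" "y a = ya" "y b = yb" "\<And>j. ?J (G j) y = l $ j"
    using min by (auto simp: local_minimizer_def)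
  obtain \<delta> where "0 < \<delta>" and \<delta>: "\<And>z. \<lbrakk>z \<in> space_D a b \<alpha> \<beta> \<gamma>; z a = ya; z b = yb; \<And>j. ?J (G j) z = l $ j;
      norm_D \<nu> a b \<alpha> \<beta> \<gamma> (\<lambda>x. z x - y x) < \<delta>\<rbrakk> \<Longrightarrow> ?J L y \<le> ?J L z"
    using min unfolding local_minimizer_def by blast
  have "?\<Delta> L' y \<phi> = (\<Sum>j\<in>UNIV. lam $ j * ?\<Delta> (G' j) y \<phi>)"
    if \<phi>: "\<phi> \<in> space_D a b \<alpha> \<beta> \<gamma>" "\<phi> a = 0" "\<phi> b = 0" for \<phi>
  proof (rule ccontr)
    define g where "g = ((\<chi> j. ?\<Delta> (G' j) y \<phi>) :: real^'r)"
    define jp where "jp = ?\<Delta> L' y \<phi>"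
    assume "?\<Delta> L' y \<phi> \<noteq> (\<Sum>j\<in>UNIV. lam $ j * ?\<Delta> (G' j) y \<phi>)"
    then have ne: "jp - lam \<bullet> g \<noteq> 0" by (simp add: jp_def g_def inner_vec_def)
    \<comment> \<open>The index \<open>None\<close> stands for \<open>\<phi>\<close>. There are then
      as many directions as values to control: one for the functional and one for each
      constraint.\<close>
    define k where "k = case_option \<phi> h"
    have k: "k i \<in> space_D a b \<alpha> \<beta> \<gamma>" "k i a = 0" "k i b = 0" for i
      using \<phi> h by (auto simp: k_def split: option.split)
    define u where "u w = (\<lambda>x. y x + (\<Sum>i\<in>UNIV. w $ i *\<^sub>R k i x))" for w :: "real^'r option"
    define \<Psi> where "\<Psi> w = (?J L (u w), (\<chi> j. ?J (G j) (u w)) :: real^'r)" for w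
    define \<Psi>' where "\<Psi>' w0 w = (\<Sum>i\<in>UNIV. w $ i * ?\<Delta> L' (u w0) (k i), (\<chi> j. \<Sum>i\<in>UNIV. w $ i * ?\<Delta> (G' j) (u w0) (k i)) :: real^'r)"
      for w0 w
    have der: "(\<Psi> has_derivative \<Psi>' w0) (at w0)" for w0
      unfolding \<Psi>_def[abs_def] \<Psi>'_def[abs_def] u_def variation_integral_def
      by (intro has_derivative_Pair has_derivative_vec_lambda functional_has_derivative L' G' y k)
    have u0: "u 0 = y" by (simp add: u_def)
    have "surj (\<Psi>' 0)"
      unfolding surj_def
    proof (intro allI)
      fix q :: "real \<times> (real^'r)"
      obtain r v where q: "q = (r, v)" by force
      \<comment> \<open>Prescribing the constraint coordinates \<open>v\<close> makes
        \<open>t\<close> the image under \<open>B\<close> of \<open>v\<close> minus \<open>s\<close>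
        times \<open>g\<close>. The first coordinate becomes
        \<open>s * (jp - lam \<bullet> g) + lam \<bullet> v\<close>; equating it with
        \<open>r\<close> gives \<open>s\<close>, and \<open>ne\<close> permits the division.\<close>
      define s where "s = (r - lam \<bullet> v) / (jp - lam \<bullet> g)"
      define t where "t = B *v (v - s *\<^sub>R g)"
      define w where "w = ((\<chi> i. case i of None \<Rightarrow> s | Some m \<Rightarrow> t $ m) :: real^'r option)"
      have "A *v t = v - s *\<^sub>R g"
        by (simp add: t_def matrix_vector_mul_assoc B)
      then have "(\<Sum>m\<in>UNIV. ?\<Delta> (G' j) y (h m) * t $ m) = v $ j - s * g $ j" for j
        by (simp add: A_def matrix_vector_mult_def vec_eq_iff)
      then have 1: "(\<Sum>i\<in>UNIV. w $ i * ?\<Delta> (G' j) y (k i)) = v $ j" for j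
        by (simp add: sum_UNIV_option w_def k_def g_def mult.commute)
      have "jh \<bullet> t = lam \<bullet> (v - s *\<^sub>R g)"
        by (simp add: lam_def t_def dot_lmul_matrix)
      moreover have "s * (jp - lam \<bullet> g) = r - lam \<bullet> v" using ne by (simp add: s_def)
      ultimately have "s * jp + jh \<bullet> t = r" by (simp add: algebra_simps inner_diff_right)
      then have 2: "(\<Sum>i\<in>UNIV. w $ i * ?\<Delta> L' y (k i)) = r"
        by (simp add: sum_UNIV_option w_def k_def jp_def jh_def inner_vec_def mult.commute)
      show "\<exists>w. q = \<Psi>' 0 w"
        using 1 2 by (intro exI[of _ w]) (simp add: q \<Psi>'_def u0 vec_eq_iff)
    qed
    moreover have "linear (\<Psi>' 0)"
      using der[of 0] by (simp add: has_derivative_def bounded_linear.linear)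
    ultimately obtain R where R: "linear R" "\<Psi>' 0 \<circ> R = id"
      using linear_surjective_right_inverse by blast
    obtain M where M: "0 \<le> M" "\<And>w. norm_D \<nu> a b \<alpha> \<beta> \<gamma> (\<lambda>x. \<Sum>i\<in>UNIV. w $ i *\<^sub>R k i x) \<le> M * norm (w :: real^'r option)"
      using norm_D_sum_le[where h = k, OF \<nu> less_imp_le[OF \<open>a < b\<close>] k(1)] by blast
    \<comment> \<open>On this ball the perturbation stays below \<open>\<delta>\<close> in
      \<open>norm_D\<close>; \<open>M + 1\<close> avoids a division by zero.\<close>
    define T where "T = ball (0 :: real^'r option) (\<delta> / (M + 1))"
    have "\<Psi> 0 \<in> interior (\<Psi> ` T)"
    proof (rule sussmann_open_mapping[OF open_UNIV _ UNIV_I der _ R(2)])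
      show "continuous_on UNIV \<Psi>"
        using der by (intro continuous_at_imp_continuous_on ballI has_derivative_continuous) blast
      show "bounded_linear R" using R(1) by (simp add: linear_conv_bounded_linear)
      show "0 \<in> interior T" using M(1) \<open>0 < \<delta>\<close> by (simp add: T_def)
    qed simp
    then obtain e where e: "0 < e" "ball (\<Psi> 0) e \<subseteq> \<Psi> ` T"
      by (auto simp: mem_interior)
    have "(?J L y - e / 2, l) \<in> ball (\<Psi> 0) e"
    proof -
      have "\<Psi> 0 = (?J L y, l)" using y(4) by (simp add: \<Psi>_def u0 vec_eq_iff)
      then show ?thesis using e(1) by (simp add: dist_Pair_Pair dist_real_def)
    qed
    then obtain w where w: "w \<in> T" "\<Psi> w = (?J L y - e / 2, l)" using e(2) by fastforce
    have "?J L y \<le> ?J L (u w)"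
    proof (rule \<delta>)
      show "u w \<in> space_D a b \<alpha> \<beta> \<gamma>"
        unfolding u_def using space_D_sum[where h = k, OF finite y(1) k(1)] by blast
      show "u w a = ya" "u w b = yb" using y k by (simp_all add: u_def)
      show "?J (G j) (u w) = l $ j" for j using w(2) by (auto simp: \<Psi>_def vec_eq_iff)
      have "norm w < \<delta> / (M + 1)" using w(1) by (simp add: T_def)
      then have "(M + 1) * norm w < \<delta>" using M(1) by (simp add: field_simps)
      moreover have "M * norm w \<le> (M + 1) * norm w" by (intro mult_right_mono) auto
      ultimately show "norm_D \<nu> a b \<alpha> \<beta> \<gamma> (\<lambda>x. u w x - y x) < \<delta>"
        using M(2)[of w] by (simp add: u_def)
    qed
    moreover have "?J L (u w) = ?J L y - e / 2" using w(2) by (simp add: \<Psi>_def)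
    ultimately show False using e(1) by simp
  qed
  then show ?thesis by blast
qed

section \<open>The Euler--Lagrange equation\<close>

text \<open>Take for \<open>g\<close> the deviation of \<open>m\<close> from its mean value. Its
  integral is zero, so its primitive is an admissible \<open>\<phi>\<close>, and the integral of
  \<open>g * m\<close> equals that of \<open>g * g\<close>.\<close>

lemma du_Bois_Reymond:
  fixes m :: "real \<Rightarrow> real"
  assumes m: "continuous_on {a..b} m" and "a < b"
    and orth: "\<And>g \<phi>. \<lbrakk>continuous_on {a..b} g; \<And>t. t \<in> {a..b} \<Longrightarrow> (\<phi> has_real_derivative g t) (at t);
      \<phi> a = 0; \<phi> b = 0\<rbrakk> \<Longrightarrow> integral {a..b} (\<lambda>x. g x * m x) = 0"
  shows "\<exists>c. \<forall>x\<in>{a..b}. m x = c"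
proof -
  define c where "c = integral {a..b} m / (b - a)"
  define g where "g x = m x - c" for x
  have g: "continuous_on {a..b} g" unfolding g_def[abs_def] using m by (intro continuous_intros)
  obtain \<phi> where \<phi>: "\<phi> a = 0" "\<And>t. t \<in> {a..b} \<Longrightarrow> (\<phi> has_real_derivative g t) (at t)"
    by (rule primitive_on_neighbourhood[OF g less_imp_le[OF \<open>a < b\<close>]]) (rule that)
  have "(g has_integral \<phi> b - \<phi> a) {a..b}"
    using \<open>a < b\<close> \<phi>(2)
    by (intro fundamental_theorem_of_calculus)
      (auto intro: has_vector_derivative_at_within simp: has_real_derivative_iff_has_vector_derivative)
  then have i\<phi>: "integral {a..b} g = \<phi> b" using \<phi>(1) by (simp add: integral_unique)
  have "integral {a..b} g = integral {a..b} m - integral {a..b} (\<lambda>x. c)"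
    unfolding g_def[abs_def] using m by (intro integral_diff integrable_continuous_real continuous_intros)
  also have "\<dots> = 0" using \<open>a < b\<close> by (simp add: c_def)
  finally have ig: "integral {a..b} g = 0" .
  with i\<phi> have "\<phi> b = 0" by simp
  have "integral {a..b} (\<lambda>x. g x * m x) = 0"
    by (rule orth[OF g \<phi>(2) \<phi>(1) \<open>\<phi> b = 0\<close>])
  moreover have "integral {a..b} (\<lambda>x. g x * m x) = integral {a..b} (\<lambda>x. g x * g x) + integral {a..b} (\<lambda>x. c * g x)"
  proof -
    have "(\<lambda>x. g x * m x) = (\<lambda>x. g x * g x + c * g x)" by (simp add: g_def algebra_simps)
    then show ?thesis
      using g by (simp only:) (intro integral_add integrable_continuous_real continuous_intros)
  qed
  ultimately have "integral {a..b} (\<lambda>x. g x * g x) = 0" using ig by simp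
  moreover have "continuous_on {a..b} (\<lambda>x. g x * g x)" using g by (intro continuous_intros)
  ultimately have "\<forall>x\<in>{a..b}. g x * g x = 0"
    using integral_eq_0_iff[of a b "\<lambda>x. g x * g x"] \<open>a < b\<close> by simp
  then show ?thesis by (intro exI[of _ c]) (simp add: g_def)
qed

text \<open>Both partial derivatives keep the first argument fixed, so the lines involved stay in
  \<open>{a..b} \<times> UNIV\<close> even over the end points, and the derivative within that set
  determines the two-sided \<open>deriv\<close>.\<close>

lemma partial_eq_derivative:
  fixes F :: "real \<times> (real^'n) \<times> (real^'n) \<Rightarrow> real"
  assumes "\<forall>p\<in>{a..b} \<times> UNIV. (F has_derivative blinfun_apply (F' p)) (at p within {a..b} \<times> UNIV)"
    and p: "p \<in> {a..b} \<times> UNIV"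
  shows "partial_y F i p = F' p (0, axis i 1, 0)" "partial_v F i p = F' p (0, 0, axis i 1)"
proof -
  obtain x u v where puv: "p = (x, u, v)" by (metis prod_cases3)
  have x: "x \<in> {a..b}" using p puv by simp
  have "((\<lambda>s. F (x, u + s *\<^sub>R c, v + s *\<^sub>R d)) has_derivative (\<lambda>s. F' (x, u, v) (0, s *\<^sub>R c, s *\<^sub>R d))) (at 0)"
    for c d :: "real^'n"
  proof -
    have "((\<lambda>s. F (x, u + s *\<^sub>R c, v + s *\<^sub>R d)) has_derivative
      (\<lambda>s. F' (x, u + 0 *\<^sub>R c, v + 0 *\<^sub>R d) (0, s *\<^sub>R c, s *\<^sub>R d))) (at 0)"
    proof (rule has_derivative_in_compose2[of "{a..b} \<times> UNIV" F "\<lambda>p. blinfun_apply (F' p)" "\<lambda>s. (x, u + s *\<^sub>R c, v + s *\<^sub>R d)" UNIV])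
      show "((\<lambda>s. (x, u + s *\<^sub>R c, v + s *\<^sub>R d)) has_derivative (\<lambda>s. (0, s *\<^sub>R c, s *\<^sub>R d))) (at 0)"
        by (auto intro!: derivative_eq_intros)
    qed (use assms(1) x in auto)
    then show ?thesis by simp
  qed
  then have "((\<lambda>s. F (x, u + s *\<^sub>R c, v + s *\<^sub>R d)) has_real_derivative F' (x, u, v) (0, c, d)) (at 0)" for c d
  proof (rule has_derivative_imp_has_field_derivative)
    show "s * F' (x, u, v) (0, c, d) = F' (x, u, v) (0, s *\<^sub>R c, s *\<^sub>R d)" for s
      using blinfun.scaleR_right[of "F' (x, u, v)" s "(0, c, d)"] by simp
  qed
  from DERIV_imp_deriv[OF this[of "axis i 1" 0]] DERIV_imp_deriv[OF this[of 0 "axis i 1"]]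
  show "partial_y F i p = F' p (0, axis i 1, 0)" "partial_v F i p = F' p (0, 0, axis i 1)"
    by (simp_all add: partial_y_def partial_v_def puv)
qed

text \<open>With \<open>P\<close> a primitive of \<open>p\<close> and \<open>R\<close> the combined
  primitive for \<open>q\<close>, integrating by parts turns the variation into minus the integral
  of \<open>g * (P + R)\<close>. Hence \<open>P + R\<close> is constant. Differentiability of
  \<open>R\<close> is not presupposed; it is inherited from \<open>P\<close>.\<close>

lemma Euler_Lagrange_primitive:
  fixes p q :: "real \<Rightarrow> real"
  assumes "a < b" "0 < \<alpha>" "\<alpha> < 1" "0 < \<beta>" "\<beta> < 1"
    and p: "continuous_on {a..b} p" and q: "continuous_on {a..b} q"
    and var: "\<And>g \<phi>. \<lbrakk>continuous_on {a..b} g; \<And>t. t \<in> {a..b} \<Longrightarrow> (\<phi> has_real_derivative g t) (at t);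
      \<phi> a = 0; \<phi> b = 0\<rbrakk> \<Longrightarrow> integral {a..b} (\<lambda>x. p x * \<phi> x +
        q x * (\<gamma> * frac_int_left a (1 - \<alpha>) g x - (1 - \<gamma>) * frac_int_right b (1 - \<beta>) g x)) = 0"
    and x: "x \<in> {a..b}"
  shows "(combined_RL_primitive a b \<beta> \<alpha> (1 - \<gamma>) q has_real_derivative - p x) (at x within {a..b})"
proof -
  let ?R = "combined_RL_primitive a b \<beta> \<alpha> (1 - \<gamma>) q"
  define P where "P x = integral {a..x} p" for x
  have P: "(P has_real_derivative p x) (at x within {a..b})" if "x \<in> {a..b}" for x
    unfolding P_def[abs_def] by (rule integral_has_real_derivative[OF p that])
  have contP: "continuous_on {a..b} P" using P DERIV_continuous_on by blast
  have contl: "continuous_on {a..b} (frac_int_left a (1 - \<beta>) q)"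
    and contr: "continuous_on {a..b} (frac_int_right b (1 - \<alpha>) q)"
    using assms by (auto intro!: continuous_on_frac_int_left continuous_on_frac_int_right)
  have contR: "continuous_on {a..b} ?R"
    unfolding combined_RL_primitive_def[abs_def] using contl contr by (intro continuous_intros)
  have "\<exists>c. \<forall>x\<in>{a..b}. P x + ?R x = c"
  proof (rule du_Bois_Reymond[OF _ \<open>a < b\<close>])
    show "continuous_on {a..b} (\<lambda>x. P x + ?R x)" using contP contR by (intro continuous_intros)
    fix g \<phi> :: "real \<Rightarrow> real"
    assume g: "continuous_on {a..b} g" and \<phi>: "\<And>t. t \<in> {a..b} \<Longrightarrow> (\<phi> has_real_derivative g t) (at t)"
      and bc: "\<phi> a = 0" "\<phi> b = 0"
    have cont\<phi>: "continuous_on {a..b} \<phi>"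
      using \<phi> by (meson DERIV_isCont continuous_at_imp_continuous_on)
    have cgl: "continuous_on {a..b} (frac_int_left a (1 - \<alpha>) g)"
      and cgr: "continuous_on {a..b} (frac_int_right b (1 - \<beta>) g)"
      using assms g by (auto intro!: continuous_on_frac_int_left continuous_on_frac_int_right)
    note int = integrable_continuous_real
    have "((\<lambda>x. p x * \<phi> x + P x * g x) has_integral P b * \<phi> b - P a * \<phi> a) {a..b}"
    proof (rule fundamental_theorem_of_calculus)
      show "((\<lambda>x. P x * \<phi> x) has_vector_derivative p x * \<phi> x + P x * g x) (at x within {a..b})"
        if "x \<in> {a..b}" for x
        using DERIV_mult[OF P[OF that] has_field_derivative_at_within[OF \<phi>[OF that]]]
        by (simp add: has_real_derivative_iff_has_vector_derivative[symmetric] algebra_simps)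
    qed (use \<open>a < b\<close> in simp)
    then have "integral {a..b} (\<lambda>x. p x * \<phi> x + P x * g x) = 0"
      using bc by (simp add: integral_unique)
    moreover have "integral {a..b} (\<lambda>x. p x * \<phi> x + P x * g x) = integral {a..b} (\<lambda>x. p x * \<phi> x) + integral {a..b} (\<lambda>x. P x * g x)"
      by (intro integral_add int continuous_intros p g contP cont\<phi>)
    ultimately have 1: "integral {a..b} (\<lambda>x. p x * \<phi> x) = - integral {a..b} (\<lambda>x. P x * g x)" by simp
    have "0 = integral {a..b} (\<lambda>x. p x * \<phi> x + (\<gamma> * (q x * frac_int_left a (1 - \<alpha>) g x) - (1 - \<gamma>) * (q x * frac_int_right b (1 - \<beta>) g x)))"
      using var[OF g \<phi> bc] by (simp add: algebra_simps)
    also have "\<dots> = integral {a..b} (\<lambda>x. p x * \<phi> x) + (integral {a..b} (\<lambda>x. \<gamma> * (q x * frac_int_left a (1 - \<alpha>) g x))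
        - integral {a..b} (\<lambda>x. (1 - \<gamma>) * (q x * frac_int_right b (1 - \<beta>) g x)))"
      by (subst integral_add, (intro int continuous_intros p q cont\<phi> cgl cgr)+)
        (subst integral_diff, (intro int continuous_intros p q cont\<phi> cgl cgr)+, simp)
    \<comment> \<open>The fractional rule is applied with \<open>q\<close> as outer factor for order
      \<open>1 - \<alpha>\<close> and with \<open>g\<close> as outer factor for order
      \<open>1 - \<beta>\<close>; this is how \<open>\<alpha>\<close> ends up with the right
      operator and \<open>\<beta>\<close> with the left one.\<close>
    also have "\<dots> = - integral {a..b} (\<lambda>x. P x * g x) + (\<gamma> * integral {a..b} (\<lambda>x. g x * frac_int_right b (1 - \<alpha>) q x)
        - (1 - \<gamma>) * integral {a..b} (\<lambda>x. g x * frac_int_left a (1 - \<beta>) q x))"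
      using frac_int_by_parts[OF q g, of "1 - \<alpha>"] frac_int_by_parts[OF g q, of "1 - \<beta>"] assms(1-5)
      by (simp add: 1)
    finally have 2: "integral {a..b} (\<lambda>x. P x * g x) = \<gamma> * integral {a..b} (\<lambda>x. g x * frac_int_right b (1 - \<alpha>) q x)
        - (1 - \<gamma>) * integral {a..b} (\<lambda>x. g x * frac_int_left a (1 - \<beta>) q x)" by simp
    have "(\<lambda>x. g x * (P x + ?R x)) = (\<lambda>x. P x * g x + ((1 - \<gamma>) * (g x * frac_int_left a (1 - \<beta>) q x) - \<gamma> * (g x * frac_int_right b (1 - \<alpha>) q x)))"
      by (simp add: combined_RL_primitive_def algebra_simps)
    then have "integral {a..b} (\<lambda>x. g x * (P x + ?R x)) = integral {a..b} (\<lambda>x. P x * g x + ((1 - \<gamma>) * (g x * frac_int_left a (1 - \<beta>) q x) - \<gamma> * (g x * frac_int_right b (1 - \<alpha>) q x)))"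
      by simp
    also have "\<dots> = integral {a..b} (\<lambda>x. P x * g x) + (integral {a..b} (\<lambda>x. (1 - \<gamma>) * (g x * frac_int_left a (1 - \<beta>) q x))
        - integral {a..b} (\<lambda>x. \<gamma> * (g x * frac_int_right b (1 - \<alpha>) q x)))"
      by (subst integral_add, (intro int continuous_intros contP g contl contr)+)
        (subst integral_diff, (intro int continuous_intros contP g contl contr)+, simp)
    also have "\<dots> = 0" using 2 by simp
    finally show "integral {a..b} (\<lambda>x. g x * (P x + ?R x)) = 0" .
  qed
  then obtain c where c: "\<And>x. x \<in> {a..b} \<Longrightarrow> ?R x = c - P x" by (metis add_diff_cancel_left')
  have "((\<lambda>x. c - P x) has_real_derivative - p x) (at x within {a..b})"
    using P[OF x] by (auto intro!: derivative_eq_intros)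
  then show ?thesis
    by (rule has_field_derivative_transform_within[OF _ zero_less_one x]) (simp add: c)
qed

lemma combined_RL_primitive_cong:
  assumes "\<And>t. t \<in> {a..b} \<Longrightarrow> f t = g t" and "x \<in> {a..b}"
  shows "combined_RL_primitive a b \<beta> \<alpha> c f x = combined_RL_primitive a b \<beta> \<alpha> c g x"
proof -
  have "frac_int_left a (1 - \<beta>) f x = frac_int_left a (1 - \<beta>) g x"
    "frac_int_right b (1 - \<alpha>) f x = frac_int_right b (1 - \<alpha>) g x"
    using assms by (auto intro!: frac_int_left_cong frac_int_right_cong)
  then show ?thesis by (simp add: combined_RL_primitive_def)
qed

text \<open>Derivatives within a nondegenerate interval are unique, so wherever the summands can be
  differentiated separately they add up to the derivative of the primitive.\<close>

lemma combined_RL_eq_derivative_primitive: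
  assumes "a < b" and x: "x \<in> {a..b}" and ex: "combined_RL_exists a b \<beta> \<alpha> c f x"
    and der: "(combined_RL_primitive a b \<beta> \<alpha> c f has_real_derivative d) (at x within {a..b})"
  shows "combined_RL a b \<beta> \<alpha> c f x = d"
proof -
  \<comment> \<open>For \<open>c = 0\<close> the value \<open>RL_left\<close> may be an arbitrary
    default, yet its product with \<open>c\<close> is the derivative of the zero function.\<close>
  have l: "((\<lambda>x. c * frac_int_left a (1 - \<beta>) f x) has_vector_derivative c * RL_left a b \<beta> f x) (at x within {a..b})"
    using ex by (cases "c = 0")
      (auto simp: combined_RL_exists_def RL_left_def vector_derivative_works[symmetric]
        intro!: has_vector_derivative_mult_right)
  have r: "((\<lambda>x. (1 - c) * frac_int_right b (1 - \<alpha>) f x) has_vector_derivative (1 - c) * (- RL_right a b \<alpha> f x)) (at x within {a..b})"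
    using ex by (cases "1 - c = 0")
      (auto simp: combined_RL_exists_def RL_right_def vector_derivative_works[symmetric]
        intro!: has_vector_derivative_mult_right)
  have "(combined_RL_primitive a b \<beta> \<alpha> c f has_vector_derivative combined_RL a b \<beta> \<alpha> c f x) (at x within {a..b})"
    using has_vector_derivative_diff[OF l r]
    by (simp add: combined_RL_primitive_def[abs_def] combined_RL_def)
  moreover have "(combined_RL_primitive a b \<beta> \<alpha> c f has_vector_derivative d) (at x within {a..b})"
    using der by (simp add: has_real_derivative_iff_has_vector_derivative)
  ultimately show ?thesis
    using vector_derivative_unique_within_closed_interval[of a b x] \<open>a < b\<close> x by (simp add: cbox_interval)
qed

text \<open>The second conjunct is the equation with the derivative applied to the whole combination
  of fractional integrals; it holds at every point of \<open>[a,b]\<close>. The first is its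
  separated form, conditional because the variational argument does not yield the existence of each
  Riemann-Liouville derivative. The directions \<open>h m\<close> vanish at both ends so that adding
  them to \<open>y\<close> preserves the boundary conditions.\<close>

theorem theorem4p8:
  fixes a b :: real
    and \<alpha> \<beta> \<gamma> :: "real^'n"
    and \<nu> :: "real^'n \<Rightarrow> real"
    and L :: "real \<times> (real^'n) \<times> (real^'n) \<Rightarrow> real"
    and G :: "'r::finite \<Rightarrow> real \<times> (real^'n) \<times> (real^'n) \<Rightarrow> real"
    and ya yb :: "real^'n"
    and l :: "real^'r"
    and y :: "real \<Rightarrow> real^'n"
    and h :: "'r \<Rightarrow> real \<Rightarrow> real^'n"
  assumes "a < b"
    and "\<forall>i. 0 < \<alpha> $ i \<and> \<alpha> $ i < 1"
    and "\<forall>i. 0 < \<beta> $ i \<and> \<beta> $ i < 1"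
    and "\<forall>i. 0 \<le> \<gamma> $ i \<and> \<gamma> $ i \<le> 1"
    and "is_norm \<nu>"
    and "C1_integrand a b L"
    and "\<forall>j. C1_integrand a b (G j)"
    and "local_minimizer \<nu> a b \<alpha> \<beta> \<gamma> (functional a b \<alpha> \<beta> \<gamma> L)
           {z \<in> space_D a b \<alpha> \<beta> \<gamma>. z a = ya \<and> z b = yb \<and>
              (\<forall>j. functional a b \<alpha> \<beta> \<gamma> (G j) z = l $ j)} y"
    and "continuous_variations_near \<nu> a b \<alpha> \<beta> \<gamma> L y"
    and "\<forall>j. continuous_variations_near \<nu> a b \<alpha> \<beta> \<gamma> (G j) y"
    and "\<forall>m. h m \<in> space_D a b \<alpha> \<beta> \<gamma>"
    and "\<forall>m. h m a = 0 \<and> h m b = 0"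
    and "rank ((\<chi> k m. first_variation (functional a b \<alpha> \<beta> \<gamma> (G k)) y (h m)) :: real^'r^'r)
           = CARD('r)"
  shows "\<exists>lam :: real^'r.
    let F = (\<lambda>p. L p - (\<Sum>j\<in>UNIV. lam $ j * G j p)) in
    \<forall>i. \<forall>x\<in>{a..b}.
      (combined_RL_exists a b (\<beta> $ i) (\<alpha> $ i) (1 - \<gamma> $ i)
           (\<lambda>t. partial_v F i (frac_arg a b \<alpha> \<beta> \<gamma> y t)) x \<longrightarrow>
         partial_y F i (frac_arg a b \<alpha> \<beta> \<gamma> y x)
           + combined_RL a b (\<beta> $ i) (\<alpha> $ i) (1 - \<gamma> $ i)
               (\<lambda>t. partial_v F i (frac_arg a b \<alpha> \<beta> \<gamma> y t)) x = 0) \<and>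
      (combined_RL_primitive a b (\<beta> $ i) (\<alpha> $ i) (1 - \<gamma> $ i)
           (\<lambda>t. partial_v F i (frac_arg a b \<alpha> \<beta> \<gamma> y t))
         has_real_derivative - partial_y F i (frac_arg a b \<alpha> \<beta> \<gamma> y x)) (at x within {a..b})"
proof -
  let ?D = "space_D a b \<alpha> \<beta> \<gamma>"
  let ?arg = "frac_arg a b \<alpha> \<beta> \<gamma> y"
  let ?V = "variation_integral a b \<alpha> \<beta> \<gamma>"
  have y: "y \<in> ?D" using assms(8) by (simp add: local_minimizer_def)
  obtain L' where L': "continuous_on ({a..b} \<times> UNIV) L'"
    "\<forall>p\<in>{a..b} \<times> UNIV. (L has_derivative blinfun_apply (L' p)) (at p within {a..b} \<times> UNIV)"
    using assms(6) unfolding C1_integrand_def by blast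
  obtain G' where G': "\<And>j. continuous_on ({a..b} \<times> UNIV) (G' j)"
    "\<And>j. \<forall>p\<in>{a..b} \<times> UNIV. (G j has_derivative blinfun_apply (G' j p)) (at p within {a..b} \<times> UNIV)"
    using assms(7) unfolding C1_integrand_def by metis
  have "first_variation (functional a b \<alpha> \<beta> \<gamma> (G k)) y (h m) = ?V (G' k) y (h m)" for k m
    unfolding variation_integral_def using assms(11) by (intro first_variation_eq G' y) blast
  then have rank: "rank ((\<chi> k m. ?V (G' k) y (h m)) :: real^'r^'r) = CARD('r)"
    using assms(13) by simp
  have "\<exists>lam :: real^'r. \<forall>\<phi>\<in>?D. \<phi> a = 0 \<longrightarrow> \<phi> b = 0 \<longrightarrow>
      ?V L' y \<phi> = (\<Sum>j\<in>UNIV. lam $ j * ?V (G' j) y \<phi>)"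
    by (rule Lagrange_multipliers[OF assms(1,5) L' G' assms(8) _ _ rank]) (use assms(11,12) in auto)
  then obtain lam :: "real^'r" where lam: "\<And>\<phi>. \<lbrakk>\<phi> \<in> ?D; \<phi> a = 0; \<phi> b = 0\<rbrakk> \<Longrightarrow>
      ?V L' y \<phi> = (\<Sum>j\<in>UNIV. lam $ j * ?V (G' j) y \<phi>)"
    by blast
  define F where "F = (\<lambda>p. L p - (\<Sum>j\<in>UNIV. lam $ j * G j p))"
  define F' where "F' p = L' p - (\<Sum>j\<in>UNIV. lam $ j *\<^sub>R G' j p)" for p
  have contF': "continuous_on ({a..b} \<times> UNIV) F'"
    unfolding F'_def[abs_def] by (intro continuous_intros L' G')
  have derF: "\<forall>p\<in>{a..b} \<times> UNIV. (F has_derivative blinfun_apply (F' p)) (at p within {a..b} \<times> UNIV)"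
  proof
    fix p :: "real \<times> (real^'n) \<times> (real^'n)" assume p: "p \<in> {a..b} \<times> UNIV"
    have "blinfun_apply (F' p) = (\<lambda>v. L' p v - (\<Sum>j\<in>UNIV. lam $ j * G' j p v))"
      by (simp add: F'_def fun_eq_iff blinfun.diff_left blinfun.sum_left blinfun.scaleR_left)
    moreover have "(F has_derivative (\<lambda>v. L' p v - (\<Sum>j\<in>UNIV. lam $ j * G' j p v))) (at p within {a..b} \<times> UNIV)"
      unfolding F_def using L'(2) G'(2) p
      by (intro has_derivative_diff has_derivative_sum has_derivative_mult_right) auto
    ultimately show "(F has_derivative blinfun_apply (F' p)) (at p within {a..b} \<times> UNIV)" by simp
  qed
  have arg: "?arg x \<in> {a..b} \<times> UNIV" if "x \<in> {a..b}" for x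
    using that by (simp add: frac_arg_def)
  have cont_arg: "continuous_on {a..b} ?arg"
    unfolding frac_arg_def[abs_def] by (intro continuous_intros space_D_imp_continuous_on[OF y])
  have comp: "continuous_on {a..b} (\<lambda>x. K' (?arg x))" if "continuous_on ({a..b} \<times> UNIV) K'"
    for K' :: "real \<times> (real^'n) \<times> (real^'n) \<Rightarrow> (real \<times> (real^'n) \<times> (real^'n)) \<Rightarrow>\<^sub>L real"
    by (rule continuous_on_compose2[OF that cont_arg]) (use arg in blast)
  \<comment> \<open>The multiplier relation is absorbed into the single integrand \<open>F\<close>,
    after which the constraints no longer appear.\<close>
  have varF: "?V F' y \<phi> = 0" if \<phi>: "\<phi> \<in> ?D" "\<phi> a = 0" "\<phi> b = 0" for \<phi>
  proof -
    have int: "(\<lambda>x. blinfun_apply (K' (?arg x)) (0, \<phi> x, vec_caputo a b \<alpha> \<beta> \<gamma> \<phi> x)) integrable_on {a..b}"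
      if "continuous_on ({a..b} \<times> UNIV) K'"
      for K' :: "real \<times> (real^'n) \<times> (real^'n) \<Rightarrow> (real \<times> (real^'n) \<times> (real^'n)) \<Rightarrow>\<^sub>L real"
      by (intro integrable_continuous_real continuous_intros comp[OF that] space_D_imp_continuous_on[OF \<phi>(1)])
    have "?V F' y \<phi> = ?V L' y \<phi> - (\<Sum>j\<in>UNIV. lam $ j * ?V (G' j) y \<phi>)"
      unfolding variation_integral_def F'_def blinfun.diff_left blinfun.sum_left blinfun.scaleR_left real_scaleR_def
      using int[OF L'(1)] int[OF G'(1)]
      by (subst integral_diff, simp, intro integrable_sum integrable_on_mult_right, simp, simp)
        (subst integral_sum, simp, intro integrable_on_mult_right, simp_all)
    then show ?thesis using lam[OF \<phi>] by simp
  qed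
  have der: "(combined_RL_primitive a b (\<beta> $ i) (\<alpha> $ i) (1 - \<gamma> $ i) (\<lambda>t. partial_v F i (?arg t))
      has_real_derivative - partial_y F i (?arg x)) (at x within {a..b})" if x: "x \<in> {a..b}" for i x
  proof -
    \<comment> \<open>Defined through \<open>F'\<close>, these functions inherit its continuity;
      they coincide with the partial derivatives along \<open>y\<close> on
      \<open>[a,b]\<close>.\<close>
    define p q where "p t = F' (?arg t) (0, axis i 1, 0)" and "q t = F' (?arg t) (0, 0, axis i 1)" for t
    have pq: "partial_y F i (?arg t) = p t" "partial_v F i (?arg t) = q t" if "t \<in> {a..b}" for t
      using partial_eq_derivative[OF derF arg[OF that]] by (simp_all add: p_def q_def)
    have "(combined_RL_primitive a b (\<beta> $ i) (\<alpha> $ i) (1 - \<gamma> $ i) q has_real_derivative - p x) (at x within {a..b})"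
    proof (rule Euler_Lagrange_primitive[OF assms(1) _ _ _ _ _ _ _ x])
      show "continuous_on {a..b} p" "continuous_on {a..b} q"
        unfolding p_def[abs_def] q_def[abs_def] by (intro continuous_intros comp[OF contF'])+
      fix g \<phi> :: "real \<Rightarrow> real"
      assume g: "continuous_on {a..b} g" and \<phi>: "\<And>t. t \<in> {a..b} \<Longrightarrow> (\<phi> has_real_derivative g t) (at t)"
        and bc: "\<phi> a = 0" "\<phi> b = 0"
      let ?w = "\<lambda>x. \<gamma> $ i * frac_int_left a (1 - \<alpha> $ i) g x - (1 - \<gamma> $ i) * frac_int_right b (1 - \<beta> $ i) g x"
      have D: "(\<lambda>t. \<phi> t *\<^sub>R axis i 1) \<in> ?D"
        "\<And>x. x \<in> {a..b} \<Longrightarrow> vec_caputo a b \<alpha> \<beta> \<gamma> (\<lambda>t. \<phi> t *\<^sub>R axis i 1) x = ?w x *\<^sub>R axis i 1"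
        by (rule space_D_axis[OF g \<phi>]; use assms(1-3) in simp)+
      have "integral {a..b} (\<lambda>x. p x * \<phi> x + q x * ?w x) = ?V F' y (\<lambda>t. \<phi> t *\<^sub>R axis i 1)"
        unfolding variation_integral_def
      proof (rule integral_cong)
        fix x assume x: "x \<in> {a..b}"
        have "(0, \<phi> x *\<^sub>R axis i 1, ?w x *\<^sub>R axis i 1) =
            \<phi> x *\<^sub>R (0::real, axis i 1 :: real^'n, 0 :: real^'n) + ?w x *\<^sub>R (0, 0, axis i 1)"
          by simp
        then show "p x * \<phi> x + q x * ?w x =
            F' (?arg x) (0, \<phi> x *\<^sub>R axis i 1, vec_caputo a b \<alpha> \<beta> \<gamma> (\<lambda>t. \<phi> t *\<^sub>R axis i 1) x)"
          unfolding D(2)[OF x] p_def q_def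
          by (simp only: blinfun.add_right blinfun.scaleR_right real_scaleR_def mult.commute)
      qed
      then show "integral {a..b} (\<lambda>x. p x * \<phi> x + q x * ?w x) = 0"
        using varF[OF D(1)] bc by simp
    qed (use assms(2,3) in auto)
    \<comment> \<open>Agreement on \<open>[a,b]\<close> suffices, since for \<open>x\<close> in that
      interval the fractional integrals involve no other values.\<close>
    then have "(combined_RL_primitive a b (\<beta> $ i) (\<alpha> $ i) (1 - \<gamma> $ i) (\<lambda>t. partial_v F i (?arg t))
        has_real_derivative - p x) (at x within {a..b})"
      by (rule has_field_derivative_transform_within[OF _ zero_less_one x])
        (intro combined_RL_primitive_cong, auto simp: pq)
    then show ?thesis using pq x by simp
  qed
  have "partial_y F i (?arg x) + combined_RL a b (\<beta> $ i) (\<alpha> $ i) (1 - \<gamma> $ i) (\<lambda>t. partial_v F i (?arg t)) x = 0"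
    if "x \<in> {a..b}"
      "combined_RL_exists a b (\<beta> $ i) (\<alpha> $ i) (1 - \<gamma> $ i) (\<lambda>t. partial_v F i (?arg t)) x" for i x
    using combined_RL_eq_derivative_primitive[OF assms(1) that der[OF that(1)]] by simp
  then show ?thesis
    using der unfolding F_def Let_def by (intro exI[of _ lam]) blast
qed

end
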